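(* Let $[\cdot]$ stand either for $\{\cdot\}$ throughout (Roumieu case) or for $(\cdot)$ throughout (Beurling case). Let $\mathfrak{M}$ be an [admissible] weight matrix, i.e. $\mathfrak M$ is R-admissible in the Roumieu case and B-admissible in the Beurling case. Let $U \subseteq \mathbb{R}^d$ be an open subset. Let $f : U \to \mathbb{C}$ be a function such that $f^j, f^{j+1} \in \mathcal{E}^{[\mathfrak{M}]}(U)$ for some positive integer $j$ (where $f^j$, $f^{j+1}$ are pointwise powers). Then $f \in \mathcal{E}^{[\mathfrak{M}]}(U)$.
   Context: Weight sequences and matrices. A weight sequence is a positive sequence $M=(M_k)_{k\ge 0}$ that is log-convex, with $M_0=1\le M_1$ and $M_k^{1/k}\to\infty$. A weight matrix $\mathfrak{M}$ is a (nonempty) family of weight sequences that is totally ordered with respect to the pointwise order relation on sequences. With $M$ one associates the sequence $m=(m_k)$ given by $k!\,m_k = M_k$ (similarly $n$ for $N$). If $m_k^{1/k}\to\infty$, define for $t>0$ $$h_m(t):=\inf_{k\in\mathbb{N}} m_k t^k,\quad \overline{\Gamma}_m(t):=\min\{k\in\mathbb N : h_m(t)=m_kt^k\},\quad \underline{\Gamma}_m(t):=\min\Big\{k\in\mathbb N: \frac{m_{k+1}}{m_k}\ge \frac1t\Big\},$$ where $\mathbb{N}=\{0,1,2,\dots\}$. For positive sequences $M,N$ set $$\operatorname{mg}(M,N):=\sup_{j,k\ge 0,\ j+k\ge 1}\Big(\frac{M_{j+k}}{N_jN_k}\Big)^{1/(j+k)}\in(0,\infty].$$ Admissibility. A weight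 matrix $\mathfrak{M}$ with $m_k^{1/k}\to\infty$ for all $M\in\mathfrak{M}$ is called: - R-admissible (= {admissible}) if: for every $M\in\mathfrak{M}$ there are $N\in\mathfrak{M}$ and $C\ge1$ with $\overline{\Gamma}_n(Ct)\le\underline{\Gamma}_m(t)$ for all $t>0$; and for every $M\in\mathfrak{M}$ there is $N\in\mathfrak{M}$ with $\operatorname{mg}(M,N)<\infty$. - B-admissible (= (admissible)) if: for every $M\in\mathfrak{M}$ there are $N\in\mathfrak{M}$ and $C\ge1$ with $\overline{\Gamma}_m(Ct)\le\underline{\Gamma}_n(t)$ for all $t>0$; and for every $M\in\mathfrak{M}$ there is $N\in\mathfrak{M}$ with $\operatorname{mg}(N,M)<\infty$. Function classes. For $U\subseteq\mathbb{R}^d$ open, $f\in C^\infty(U)$ complex valued, $K\subseteq U$, $\rho>0$, put $$\|f\|^M_{K,\rho}:=\sup_{x\in K}\sup_{k\in\mathbb{N}}\frac{\|f^{(k)}(x)\|_{L^k(\mathbb{R}^d,\mathbb{C})}}{\rho^kM_k},$$ where $f^{(k)}$ is the Fréchet derivative of order $k$ and $\|\cdot\|_{L^k(\mathbb{R}^d,\mathbb{C})}$ is the operator norm on $k$-linear maps. Then $\mathcal{E}^{\{\mathfrak{M}\}}(U)$ is the set of $f\in C^\infty(U)$ such that for every compact $K\subseteq U$ there exist $M\in\mathfrak{M}$ and $\rho>0$ with $\|f\|^M_{K,\rho}<\infty$; $\mathcal{E}^{(\mathfrak{M})}(U)$ is the set of $f\in C^\infty(U)$ such that $\|f\|^M_{K,\rho}<\infty$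 for all compact $K\subseteq U$, all $M\in\mathfrak{M}$ and all $\rho>0$. *)

theory Defs
  imports "HOL-Analysis.Analysis"
begin

section \<open>Weight sequences and weight matrices\<close>

definition weight_sequence :: "(nat \<Rightarrow> real) \<Rightarrow> bool" where
  "weight_sequence M \<longleftrightarrow>
     (\<forall>k. M k > 0) \<and>
     (\<forall>k. (M (Suc k))\<^sup>2 \<le> M k * M (Suc (Suc k))) \<and>
     M 0 = 1 \<and> 1 \<le> M 1 \<and>
     filterlim (\<lambda>k. root k (M k)) at_top sequentially"

definition weight_matrix :: "(nat \<Rightarrow> real) set \<Rightarrow> bool" where
  "weight_matrix \<MM> \<longleftrightarrow>
     \<MM> \<noteq> {} \<and> (\<forall>M\<in>\<MM>. weight_sequence M) \<and>
     (\<forall>M\<in>\<MM>. \<forall>N\<in>\<MM>. (\<forall>k. M k \<le> N k) \<or> (\<forall>k. N k \<le> M k))"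

text \<open>The sequence denoted by the corresponding lower case letter, \<open>k! m\<^sub>k = M\<^sub>k\<close>.\<close>

definition reduced :: "(nat \<Rightarrow> real) \<Rightarrow> nat \<Rightarrow> real" where
  "reduced M k = M k / fact k"

text \<open>The following three functions are only used for positive sequences with
  \<open>m\<^sub>k\<^bsup>1/k\<^esup> \<rightarrow> \<infinity>\<close> and for \<open>t > 0\<close>; then the infimum is attained and the two
  minima exist.\<close>

definition h_fun :: "(nat \<Rightarrow> real) \<Rightarrow> real \<Rightarrow> real" where
  "h_fun m t = (INF k. m k * t ^ k)"

definition Gamma_upper :: "(nat \<Rightarrow> real) \<Rightarrow> real \<Rightarrow> nat" where
  "Gamma_upper m t = (LEAST k. h_fun m t = m k * t ^ k)"

definition Gamma_lower :: "(nat \<Rightarrow> real) \<Rightarrow> real \<Rightarrow> nat" where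
  "Gamma_lower m t = (LEAST k. m (Suc k) / m k \<ge> 1 / t)"

definition mg :: "(nat \<Rightarrow> real) \<Rightarrow> (nat \<Rightarrow> real) \<Rightarrow> ennreal" where
  "mg M N = (SUP (j, k) \<in> {(j, k). j + k \<ge> 1}.
               ennreal (root (j + k) (M (j + k) / (N j * N k))))"

definition R_admissible :: "(nat \<Rightarrow> real) set \<Rightarrow> bool" where
  "R_admissible \<MM> \<longleftrightarrow>
     weight_matrix \<MM> \<and>
     (\<forall>M\<in>\<MM>. filterlim (\<lambda>k. root k (reduced M k)) at_top sequentially) \<and>
     (\<forall>M\<in>\<MM>. \<exists>N\<in>\<MM>. \<exists>C\<ge>1. \<forall>t>0.
        Gamma_upper (reduced N) (C * t) \<le> Gamma_lower (reduced M) t) \<and>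
     (\<forall>M\<in>\<MM>. \<exists>N\<in>\<MM>. mg M N < \<infinity>)"

definition B_admissible :: "(nat \<Rightarrow> real) set \<Rightarrow> bool" where
  "B_admissible \<MM> \<longleftrightarrow>
     weight_matrix \<MM> \<and>
     (\<forall>M\<in>\<MM>. filterlim (\<lambda>k. root k (reduced M k)) at_top sequentially) \<and>
     (\<forall>M\<in>\<MM>. \<exists>N\<in>\<MM>. \<exists>C\<ge>1. \<forall>t>0.
        Gamma_upper (reduced M) (C * t) \<le> Gamma_lower (reduced N) t) \<and>
     (\<forall>M\<in>\<MM>. \<exists>N\<in>\<MM>. mg N M < \<infinity>)"

section \<open>Higher Frechet derivatives\<close>

text \<open>The \<open>k\<close>-linear map \<open>f\<^bsup>(k)\<^esup>(x)\<close> is represented by its values on lists of length \<open>k\<close>: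
  \<open>f\<^bsup>(k)\<^esup>(x)(v\<^sub>1, \<dots>, v\<^sub>k) = Frechet_deriv f [v\<^sub>1, \<dots>, v\<^sub>k] x\<close>.  The first vector is the
  direction of the last differentiation:
  \<open>f\<^bsup>(k+1)\<^esup>(x)(v, v\<^sub>1, \<dots>, v\<^sub>k) = d(f\<^bsup>(k)\<^esup>(\<cdot>)(v\<^sub>1, \<dots>, v\<^sub>k))(x)(v)\<close>.\<close>

primrec Frechet_deriv ::
    "('a::real_normed_vector \<Rightarrow> 'b::real_normed_vector) \<Rightarrow> 'a list \<Rightarrow> 'a \<Rightarrow> 'b" where
  "Frechet_deriv f [] = f"
| "Frechet_deriv f (v # vs) = (\<lambda>x. frechet_derivative (Frechet_deriv f vs) (at x) v)"

text \<open>Functions on an open set \<open>U\<close> are represented by total functions; the values outside \<open>U\<close>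
  have no influence on the derivatives at points of \<open>U\<close>.  On a finite-dimensional space a map into
  the \<open>k\<close>-linear maps is differentiable in operator norm iff its evaluations at all fixed
  arguments are differentiable; lemmas \<open>Frechet_deriv_linear\<close> and
  \<open>Frechet_deriv_operator_norm\<close> below confirm that the definition gives the
  Frechet derivatives with respect to the operator norm.\<close>

definition smooth_fun_on :: "'a::euclidean_space set \<Rightarrow> ('a \<Rightarrow> 'b::real_normed_vector) \<Rightarrow> bool" where
  "smooth_fun_on U f \<longleftrightarrow> (\<forall>vs. \<forall>x\<in>U. Frechet_deriv f vs differentiable (at x))"

definition Frechet_norm :: "('a::real_normed_vector \<Rightarrow> 'b::real_normed_vector) \<Rightarrow> nat \<Rightarrow> 'a \<Rightarrow> ennreal" where
  "Frechet_norm f k x =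
     (SUP vs \<in> {vs. length vs = k \<and> (\<forall>v\<in>set vs. norm v \<le> 1)}. ennreal (norm (Frechet_deriv f vs x)))"

section \<open>The function classes\<close>

definition M_seminorm ::
    "(nat \<Rightarrow> real) \<Rightarrow> 'a::euclidean_space set \<Rightarrow> real \<Rightarrow> ('a \<Rightarrow> complex) \<Rightarrow> ennreal" where
  "M_seminorm M K \<rho> f = (SUP x\<in>K. SUP k. Frechet_norm f k x / ennreal (\<rho> ^ k * M k))"

definition Roumieu_class :: "(nat \<Rightarrow> real) set \<Rightarrow> 'a::euclidean_space set \<Rightarrow> ('a \<Rightarrow> complex) set" where
  "Roumieu_class \<MM> U =
     {f. smooth_fun_on U f \<and>
         (\<forall>K. compact K \<and> K \<subseteq> U \<longrightarrow> (\<exists>M\<in>\<MM>. \<exists>\<rho>>0. M_seminorm M K \<rho> f < \<infinity>))}"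

definition Beurling_class :: "(nat \<Rightarrow> real) set \<Rightarrow> 'a::euclidean_space set \<Rightarrow> ('a \<Rightarrow> complex) set" where
  "Beurling_class \<MM> U =
     {f. smooth_fun_on U f \<and>
         (\<forall>K. compact K \<and> K \<subseteq> U \<longrightarrow> (\<forall>M\<in>\<MM>. \<forall>\<rho>>0. M_seminorm M K \<rho> f < \<infinity>))}"

section \<open>Iterated derivatives and the operator norm\<close>

lemma Frechet_deriv_has_derivative:
  assumes "smooth_fun_on U f" "x \<in> U"
  shows "(Frechet_deriv f vs has_derivative (\<lambda>v. Frechet_deriv f (v # vs) x)) (at x)"
  using assms by (auto simp: smooth_fun_on_def frechet_derivative_works)

lemma Frechet_deriv_linear:
  assumes "smooth_fun_on U f" "open U" "x \<in> U"
  shows "linear (\<lambda>v. Frechet_deriv f (us @ v # vs) x)"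
  using assms(3)
proof (induction us arbitrary: x)
  case Nil
  from Frechet_deriv_has_derivative[OF assms(1) Nil, of vs] show ?case
    by (simp add: has_derivative_linear)
next
  case (Cons w us)
  have D: "(Frechet_deriv f ws has_derivative (\<lambda>v. Frechet_deriv f (v # ws) x)) (at x)" for ws
    by (rule Frechet_deriv_has_derivative[OF assms(1) Cons.prems])
  show ?case
  proof (rule linearI)
    fix a b
    have "(Frechet_deriv f (us @ (a + b) # vs) has_derivative
        (\<lambda>v. Frechet_deriv f (v # us @ a # vs) x + Frechet_deriv f (v # us @ b # vs) x)) (at x)"
      by (rule has_derivative_transform_within_open[OF has_derivative_add[OF D D] assms(2) Cons.prems])
         (simp add: linear_add[OF Cons.IH])
    from has_derivative_unique[OF this D]
    show "Frechet_deriv f ((w # us) @ (a + b) # vs) x =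
        Frechet_deriv f ((w # us) @ a # vs) x + Frechet_deriv f ((w # us) @ b # vs) x"
      by (metis append_Cons)
  next
    fix r a
    have "(Frechet_deriv f (us @ (r *\<^sub>R a) # vs) has_derivative
        (\<lambda>v. r *\<^sub>R Frechet_deriv f (v # us @ a # vs) x)) (at x)"
      by (rule has_derivative_transform_within_open[OF has_derivative_scaleR_right[OF D] assms(2) Cons.prems])
         (simp add: linear_scale[OF Cons.IH])
    from has_derivative_unique[OF this D]
    show "Frechet_deriv f ((w # us) @ (r *\<^sub>R a) # vs) x = r *\<^sub>R Frechet_deriv f ((w # us) @ a # vs) x"
      by (metis append_Cons)
  qed
qed

lemma Frechet_deriv_operator_norm:
  fixes f :: "'a::euclidean_space \<Rightarrow> 'b::real_normed_vector"
  assumes "smooth_fun_on U f" "open U" "x \<in> U" "e > 0"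
  shows "\<forall>\<^sub>F y in nhds x. \<forall>vs. length vs = k \<and> (\<forall>v\<in>set vs. norm v \<le> 1) \<longrightarrow>
     norm (Frechet_deriv f vs y - Frechet_deriv f vs x - Frechet_deriv f ((y - x) # vs) x)
       \<le> e * norm (y - x)"
proof -
  define R where "R = (\<lambda>y vs. Frechet_deriv f vs y - Frechet_deriv f vs x - Frechet_deriv f ((y - x) # vs) x)"
  have lin: "linear (\<lambda>v. R y (us @ v # vs))" if "y \<in> U" for y us vs
    unfolding R_def
    using Frechet_deriv_linear[OF assms(1,2) that, of us vs]
      Frechet_deriv_linear[OF assms(1-3), of us vs]
      Frechet_deriv_linear[OF assms(1-3), of "(y - x) # us" vs]
    by (intro linear_compose_sub) auto
  have "\<forall>\<^sub>F y in nhds x. \<forall>us. length us = n \<and> (\<forall>v\<in>set us. norm v \<le> 1) \<longrightarrow>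
     norm (R y (us @ bs)) \<le> e * norm (y - x)" if "e > 0" for n bs e
    using that
  proof (induction n arbitrary: bs e)
    case 0
    have "\<exists>d>0. \<forall>y. norm (y - x) < d \<longrightarrow> norm (R y bs) \<le> e * norm (y - x)"
      using Frechet_deriv_has_derivative[OF assms(1,3), of bs] 0
      unfolding has_derivative_at_alt R_def by blast
    then show ?case
      by (auto simp: eventually_nhds_metric dist_norm)
  next
    case (Suc n)
    define e' where "e' = e / DIM('a)"
    have e': "e' > 0" using Suc.prems by (simp add: e'_def)
    have "\<forall>\<^sub>F y in nhds x. \<forall>b\<in>Basis. \<forall>us. length us = n \<and> (\<forall>v\<in>set us. norm v \<le> 1) \<longrightarrow>
       norm (R y (us @ b # bs)) \<le> e' * norm (y - x)"
      by (rule eventually_ball_finite) (use Suc.IH[OF e'] in auto)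
    moreover have "\<forall>\<^sub>F y in nhds x. y \<in> U"
      using assms(2,3) by (rule eventually_nhds_in_open)
    ultimately show ?case
    proof eventually_elim
      case (elim y)
      show ?case
      proof (intro allI impI, elim conjE)
        fix us :: "'a list"
        assume us: "length us = Suc n" "\<forall>v\<in>set us. norm v \<le> 1"
        then obtain ws u where usw: "us = ws @ [u]" by (metis length_Suc_conv_rev)
        have ws: "length ws = n" "\<forall>v\<in>set ws. norm v \<le> 1" and u: "norm u \<le> 1"
          using us usw by auto
        have "R y (us @ bs) = R y (ws @ (\<Sum>b\<in>Basis. (u \<bullet> b) *\<^sub>R b) # bs)"
          by (simp add: usw euclidean_representation)
        also have "\<dots> = (\<Sum>b\<in>Basis. (u \<bullet> b) *\<^sub>R R y (ws @ b # bs))"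
          using linear_sum[OF lin[OF elim(2), of ws bs], of "\<lambda>b. (u \<bullet> b) *\<^sub>R b" Basis]
            linear_scale[OF lin[OF elim(2), of ws bs]] by simp
        finally have "norm (R y (us @ bs)) \<le> (\<Sum>b\<in>Basis. norm ((u \<bullet> b) *\<^sub>R R y (ws @ b # bs)))"
          by (simp only: norm_sum)
        also have "\<dots> \<le> (\<Sum>b\<in>(Basis :: 'a set). e' * norm (y - x))"
        proof (rule sum_mono)
          fix b :: 'a assume b: "b \<in> Basis"
          have "\<bar>u \<bullet> b\<bar> \<le> 1" using Basis_le_norm[OF b, of u] u by linarith
          moreover have "norm (R y (ws @ b # bs)) \<le> e' * norm (y - x)"
            using elim(1) b ws by blast
          ultimately show "norm ((u \<bullet> b) *\<^sub>R R y (ws @ b # bs)) \<le> e' * norm (y - x)"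
            using mult_mono[of "\<bar>u \<bullet> b\<bar>" 1 "norm (R y (ws @ b # bs))" "e' * norm (y - x)"] by simp
        qed
        also have "\<dots> = e * norm (y - x)" by (simp add: e'_def)
        finally show "norm (R y (us @ bs)) \<le> e * norm (y - x)" .
      qed
    qed
  qed
  from this[OF assms(4), of k "[]"] show ?thesis by (simp add: R_def)
qed

end

theory Submission
  imports Defs "HOL-Complex_Analysis.Complex_Analysis" "HOL-Computational_Algebra.Fundamental_Theorem_Algebra"
begin

text \<open>Fix a segment of length \<open>e\<close> around a point and let \<open>G\<close>, \<open>H\<close> be the Taylor polynomials of
  \<open>f\<^sup>j\<close> and \<open>f\<^sup>j\<^sup>+\<^sup>1\<close> on it, of degree \<open>p = Gamma_lower m t\<close> with \<open>t\<close> proportional to \<open>e\<close>. Then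
  \<open>G\<^sup>j\<^sup>+\<^sup>1 - H\<^sup>j\<close> is of the order of the Taylor remainder \<open>m\<^sub>p t\<^sup>p\<close> on the segment, and, being a
  polynomial, it is still small on a complex disc when \<open>t\<close> is a large enough multiple of \<open>e\<close>.
  By Lagrange extrapolation \<open>\<bar>G\<bar>\<close> is bounded below on some circle, and the nonnegative part \<open>F\<close> of the
  Laurent expansion of \<open>H / G\<close> there is an approximate root: the negative part is small, because
  \<open>H / G\<close> is close to \<open>H cnj G / (\<bar>G\<bar>\<^sup>2 + r\<^sup>2)\<close> whose \<open>\<partial>\<close>-bar derivative is small in the mean by Green's formula.
  So \<open>f\<close> is within a power of \<open>m\<^sub>p t\<^sup>p\<close> of a bounded holomorphic function, and
  admissibility, the moderate growth condition being iterated, replaces that power by \<open>l\<^sub>k (B e)\<^sup>k\<close> for all \<open>k\<close>.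
  Comparing the approximants at the scales \<open>e / 2\<^sup>i\<close> by a two-constants estimate and summing yields the
  derivatives of \<open>f\<close> along lines with the right bounds; polarization gives all of them.\<close>

section \<open>Polynomials with complex coefficients\<close>

text \<open>The quotient of the two given powers says nothing at the zeros of \<open>f\<close>, and
  \<open>f\<close> is not even assumed continuous. So \<open>f\<close> is never differentiated; it
  is approximated on lines, and its smoothness is deduced from the approximants. Two consecutive
  powers determine \<open>f\<close> wherever \<open>f\<close> is not too small, by dividing a
  combination of both errors by \<open>f^j\<close>; where \<open>f\<close> is small, any small
  approximant will do. Two kinds of losses shape the constants. Losses exponential in the degree
  \<open>p\<close> (a factor 6 per degree for extrapolation from a segment to a disc, 84 per degree
  for keeping a circle away from the zeros of \<open>G\<close>) are paid by shortening the segment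
  by the fixed factor \<open>root_scale j\<close>, because the Taylor remainder then gains the
  \<open>p\<close>-th power of that factor. Losses of a fixed power (the exponent
  \<open>7 j (j+1)^2\<close>) are paid by iterated moderate growth. The same device leaves a fourth
  power in reserve: the two-constants estimate consumes a square root, and what remains splits into
  one factor for the \<open>k\<close>-th derivative and one that makes the sum over the scales
  converge.\<close>

definition lagrange_basis :: "('b \<Rightarrow> 'a::field) \<Rightarrow> 'b set \<Rightarrow> 'b \<Rightarrow> 'a poly" where
  "lagrange_basis t I l = (\<Prod>i\<in>I-{l}. smult (1 / (t l - t i)) [:- t i, 1:])"

lemma poly_lagrange_basis:
  "poly (lagrange_basis t I l) x = (\<Prod>i\<in>I-{l}. (x - t i) / (t l - t i))"
  by (simp add: lagrange_basis_def poly_prod diff_divide_distrib)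

lemma lagrange_interpolation:
  fixes q :: "'a::field poly"
  assumes fin: "finite I" and inj: "inj_on t I" and deg: "degree q < card I"
  shows "q = (\<Sum>l\<in>I. smult (poly q (t l)) (lagrange_basis t I l))"
proof (rule poly_eqI_degree[of "t ` I"])
  fix x assume "x \<in> t ` I"
  then obtain k where k: "k \<in> I" "x = t k" by auto
  have "poly (lagrange_basis t I l) x = (if l = k then 1 else 0)" if "l \<in> I" for l
  proof (cases "l = k")
    case True
    have "(x - t i) / (t l - t i) = 1" if "i \<in> I - {l}" for i
      using that k True inj by (auto simp: inj_on_def)
    then show ?thesis using True by (simp add: poly_lagrange_basis)
  next
    case False
    then show ?thesis using fin k that by (auto simp: poly_lagrange_basis)
  qed
  then have "(\<Sum>l\<in>I. poly q (t l) * poly (lagrange_basis t I l) x) = (\<Sum>l\<in>I. if l = k then poly q (t l) else 0)"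
    by (intro sum.cong) auto
  also have "\<dots> = poly q x" using k fin by simp
  finally show "poly q x = poly (\<Sum>l\<in>I. smult (poly q (t l)) (lagrange_basis t I l)) x"
    by (simp add: poly_sum)
next
  show "card (t ` I) > degree q" using card_image[OF inj] deg by simp
  have "degree (lagrange_basis t I l) \<le> card I - 1" if "l \<in> I" for l
  proof -
    have "degree (lagrange_basis t I l) \<le> (\<Sum>i\<in>I-{l}. degree (smult (1 / (t l - t i)) [:- t i, 1:]))"
      unfolding lagrange_basis_def by (rule degree_prod_sum_le[unfolded o_def]) (use fin in auto)
    also have "\<dots> \<le> (\<Sum>i\<in>I-{l}. 1)" by (rule sum_mono) (simp add: degree_smult_le)
    also have "\<dots> = card I - 1" using fin that by simp
    finally show ?thesis .
  qed
  then have "degree (\<Sum>l\<in>I. smult (poly q (t l)) (lagrange_basis t I l)) \<le> card I - 1"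
    by (intro degree_sum_le) (auto intro: fin order_trans[OF degree_smult_le])
  then show "card (t ` I) > degree (\<Sum>l\<in>I. smult (poly q (t l)) (lagrange_basis t I l))"
    using card_image[OF inj] deg by simp
qed

text \<open>A substitute for Stirling's formula: \<open>p^p / p!\<close> is a single term of the
  exponential series at \<open>p\<close>, all of whose terms are nonnegative.\<close>

lemma pow_le_exp_fact: "real p ^ p \<le> exp (real p) * fact p"
proof -
  have "(\<Sum>n\<in>{p}. real p ^ n /\<^sub>R fact n) \<le> (\<Sum>n. real p ^ n /\<^sub>R fact n)"
    by (rule sum_le_suminf) (use summable_exp_generic[of "real p"] in auto)
  then have "real p ^ p /\<^sub>R fact p \<le> exp (real p)" by (simp add: exp_def)
  then show ?thesis by (simp add: field_simps)
qed

text \<open>Up to the spacing, these are the denominators of the Lagrange basis at equidistant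
  nodes. Their reciprocals add up to \<open>2^p / p!\<close> by the binomial theorem.\<close>

lemma prod_abs_diff_nat:
  assumes "l \<le> p"
  shows "(\<Prod>i\<in>{..p}-{l}. \<bar>real l - real i\<bar>) = fact l * fact (p - l)"
proof -
  have s: "{..p}-{l} = {..<l} \<union> {l<..p}" using assms by auto
  have "(\<Prod>i\<in>{..<l}. \<bar>real l - real i\<bar>) = (\<Prod>i\<in>{1..l}. real i)"
    by (rule prod.reindex_bij_witness[of _ "\<lambda>i. l - i" "\<lambda>i. l - i"]) (auto simp: of_nat_diff)
  moreover have "(\<Prod>i\<in>{l<..p}. \<bar>real l - real i\<bar>) = (\<Prod>i\<in>{1..p-l}. real i)"
    by (rule prod.reindex_bij_witness[of _ "\<lambda>i. i + l" "\<lambda>i. i - l"]) (auto simp: of_nat_diff)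
  ultimately show ?thesis
    unfolding s by (subst prod.union_disjoint) (auto simp: fact_prod)
qed

text \<open>Lagrange interpolation at nodes with spacing \<open>2 / p\<close>: every numerator is at
  most \<open>2 R\<close>, the denominators sum up through binomial coefficients, and
  \<open>p^p / p!\<close> is at most \<open>3^p\<close>. This gives \<open>(2 R)^p * 3^p\<close>.
  The spacing degenerates for \<open>p = 0\<close>, where the polynomial is constant.\<close>

lemma poly_extrapolate:
  fixes q :: "complex poly"
  assumes deg: "degree q \<le> p" and R: "1 \<le> R"
    and bd: "\<And>t. t \<in> {-1..1} \<Longrightarrow> cmod (poly q (of_real t)) \<le> \<eta>" and z: "cmod z \<le> R"
  shows "cmod (poly q z) \<le> (6 * R) ^ p * \<eta>"
proof (cases "p = 0")
  case True
  then obtain c where "q = [:c:]" using deg by (metis degree_eq_zeroE le_zero_eq)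
  then show ?thesis using bd[of 0] True by simp
next
  case False
  define t :: "nat \<Rightarrow> real" where "t i = -1 + 2 * real i / real p" for i
  have eta: "\<eta> \<ge> 0" using order_trans[OF norm_ge_zero bd[of 0]] by simp
  have td: "t l - t i = 2 / real p * (real l - real i)" for l i
    by (simp add: t_def right_diff_distrib diff_divide_distrib mult.commute)
  have inj: "inj_on (\<lambda>i. of_real (t i) :: complex) {..p}"
  proof (rule inj_onI)
    fix i k assume "of_real (t i) = (of_real (t k) :: complex)"
    then have "t i - t k = 0" by (simp only: of_real_eq_iff)
    then show "i = k" using False by (simp add: td)
  qed
  have tb: "t i \<in> {-1..1}" if "i \<le> p" for i
    using that False by (auto simp: t_def field_simps)
  have L: "cmod (poly (lagrange_basis (\<lambda>i. of_real (t i)) {..p} l) z) \<le> (2*R * real p / 2) ^ p / (fact l * fact (p - l))"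
    if l: "l \<le> p" for l
  proof -
    have "cmod (poly (lagrange_basis (\<lambda>i. of_real (t i)) {..p} l) z)
        = (\<Prod>i\<in>{..p}-{l}. cmod (z - t i) / (2 / real p * \<bar>real l - real i\<bar>))"
    proof -
      have "cmod (of_real (t l) - of_real (t i)) = 2 / real p * \<bar>real l - real i\<bar>" for i
        by (simp only: of_real_diff[symmetric] norm_of_real td abs_mult) simp
      then show ?thesis
        unfolding poly_lagrange_basis prod_norm[symmetric] norm_divide by simp
    qed
    also have "\<dots> \<le> (\<Prod>i\<in>{..p}-{l}. 2*R / (2 / real p * \<bar>real l - real i\<bar>))"
    proof (intro prod_mono conjI divide_right_mono)
      fix i assume "i \<in> {..p} - {l}"
      then have "cmod (of_real (t i)) \<le> 1" using tb[of i] by auto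
      then show "cmod (z - t i) \<le> 2*R" using norm_triangle_ineq4[of z "of_real (t i)"] z R by linarith
    qed auto
    also have "\<dots> = (2*R * real p / 2) ^ p / (\<Prod>i\<in>{..p}-{l}. \<bar>real l - real i\<bar>)"
      using l by (simp add: prod_dividef prod.distrib power_mult_distrib divide_simps)
    finally show ?thesis using prod_abs_diff_nat[OF l] by simp
  qed
  have "q = (\<Sum>l\<le>p. smult (poly q (t l)) (lagrange_basis (\<lambda>i. of_real (t i)) {..p} l))"
    by (rule lagrange_interpolation[OF _ inj]) (use deg in auto)
  then have "poly q z = (\<Sum>l\<le>p. poly q (t l) * poly (lagrange_basis (\<lambda>i. of_real (t i)) {..p} l) z)"
    by (metis (no_types, lifting) poly_smult poly_sum sum.cong)
  then have "cmod (poly q z) \<le> (\<Sum>l\<le>p. cmod (poly q (t l)) * cmod (poly (lagrange_basis (\<lambda>i. of_real (t i)) {..p} l) z))"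
    by (simp add: norm_sum flip: norm_mult)
  also have "\<dots> \<le> (\<Sum>l\<le>p. \<eta> * ((2*R * real p / 2) ^ p / (fact l * fact (p - l))))"
    by (intro sum_mono mult_mono L bd tb) (use eta in auto)
  also have "\<dots> = \<eta> * (R * real p) ^ p / fact p * (\<Sum>l\<le>p. real (p choose l))"
    by (simp add: sum_distrib_left binomial_fact field_simps)
  also have "(\<Sum>l\<le>p. real (p choose l)) = 2 ^ p"
    using choose_row_sum[of p] by (metis of_nat_numeral of_nat_power of_nat_sum)
  also have "\<eta> * (R * real p) ^ p / fact p * 2 ^ p = \<eta> * (2*R)^p * (real p ^ p / fact p)"
    by (simp add: power_mult_distrib)
  also have "\<dots> \<le> \<eta> * (2*R)^p * 3 ^ p"
  proof (rule mult_left_mono)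
    have "real p ^ p / fact p \<le> exp (real p)" using pow_le_exp_fact[of p] by (simp add: pos_divide_le_eq)
    also have "\<dots> = exp 1 ^ p" using exp_of_nat_mult[of p "1::real"] by simp
    also have "\<dots> \<le> 3 ^ p" using exp_le by (intro power_mono) auto
    finally show "real p ^ p / fact p \<le> 3 ^ p" .
  qed (use eta R in auto)
  also have "\<dots> = (6*R) ^ p * \<eta>"
  proof -
    have "(2*R) ^ p * 3 ^ p = (6*R) ^ p" by (subst power_mult_distrib[symmetric]) simp
    then show ?thesis by (metis mult.assoc mult.commute)
  qed
  finally show ?thesis .
qed

lemma pderiv_sum_fun: "pderiv (\<Sum>i\<in>A. f i) = (\<Sum>i\<in>A. pderiv (f i))"
  by (induction A rule: infinite_finite_induct) (auto simp: pderiv_add)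

text \<open>The Lagrange formula at the nodes \<open>0, ..., m\<close> is differentiated term by
  term. The weights later replace a derivative in one direction by a combination of values on
  parallel lines.\<close>

lemma numeric_derivative_weights:
  "\<exists>c :: nat \<Rightarrow> complex. \<forall>q. degree q \<le> m \<longrightarrow> poly (pderiv q) 0 = (\<Sum>l\<le>m. c l * poly q (of_nat l))"
proof (intro exI allI impI)
  fix q :: "complex poly" assume "degree q \<le> m"
  then have "q = (\<Sum>l\<le>m. smult (poly q (of_nat l)) (lagrange_basis of_nat {..m} l))"
    by (intro lagrange_interpolation) auto
  then have "pderiv q = (\<Sum>l\<le>m. smult (poly q (of_nat l)) (pderiv (lagrange_basis of_nat {..m} l)))"
    by (metis (no_types, lifting) pderiv_smult pderiv_sum_fun sum.cong)
  then have "poly (pderiv q) 0 = (\<Sum>l\<le>m. poly q (of_nat l) * poly (pderiv (lagrange_basis of_nat {..m} l)) 0)"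
    by (simp add: poly_sum)
  then show "poly (pderiv q) 0 = (\<Sum>l\<le>m. poly (pderiv (lagrange_basis of_nat {..m} l)) 0 * poly q (of_nat l))"
    by (simp add: mult.commute)
qed

text \<open>Extrapolating the polynomial with roots the moduli of the roots of the given one
  produces a radius that stays away from all these moduli.\<close>

lemma poly_good_circle:
  fixes G :: "complex poly"
  assumes deg: "degree G \<le> p" and w: "cmod w \<le> 1"
  obtains s where "s \<in> {1/2..3/4}" "\<And>z. cmod z = s \<Longrightarrow> cmod (poly G w) \<le> 2 * 84 ^ p * cmod (poly G z)"
proof (cases "poly G w = 0")
  case True
  then show ?thesis by (intro that[of "1/2"]) auto
next
  case False
  obtain a where a: "smult (lead_coeff G) (\<Prod>i<degree G. [:- a i, 1:]) = G"
    by (rule complex_poly_decompose')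
  have G: "poly G z = lead_coeff G * (\<Prod>i<degree G. z - a i)" for z
    by (subst a[symmetric]) (simp add: poly_prod)
  \<comment> \<open>A polynomial in \<open>t\<close> attached to the radius
    \<open>s = 5/8 + t/8\<close>: its modulus at real \<open>t\<close> is the product of the
    distances of \<open>s\<close> from the moduli of the roots. The interval from -1 to 1
    corresponds to radii between 1/2 and 3/4. The point -13 corresponds to \<open>s = -1\<close>,
    where the product becomes \<open>Q\<close>, an upper bound for the product of
    \<open>|w - a i|\<close>.\<close>
  define q :: "complex poly" where "q = (\<Prod>i<degree G. [:- of_real (5/8 - cmod (a i)), - 1/8:])"
  have q: "poly q z = (\<Prod>i<degree G. - (z / 8) - of_real (5/8 - cmod (a i)))" for z
    by (simp add: q_def poly_prod algebra_simps)
  have degq: "degree q \<le> p"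
  proof -
    have "degree q \<le> (\<Sum>i<degree G. degree [:- of_real (5/8 - cmod (a i)), - 1/8 :: complex:])"
      unfolding q_def by (rule degree_prod_sum_le[unfolded o_def]) auto
    also have "\<dots> \<le> (\<Sum>i<degree G. 1)" by (intro sum_mono) simp
    finally show ?thesis using deg by simp
  qed
  define Q where "Q = (\<Prod>i<degree G. 1 + cmod (a i))"
  have Q: "Q > 0" unfolding Q_def by (intro prod_pos) (simp add: add_pos_nonneg)
  have qm: "cmod (poly q (-13)) = Q"
  proof -
    have "cmod (poly q (-13)) = (\<Prod>i<degree G. cmod (13/8 - of_real (5/8 - cmod (a i))))"
      by (simp add: q prod_norm)
    also have "\<dots> = Q" unfolding Q_def
    proof (rule prod.cong[OF refl])
      fix i
      have "(13/8 - of_real (5/8 - cmod (a i))) = (of_real (1 + cmod (a i)) :: complex)" by simp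
      then show "cmod (13/8 - of_real (5/8 - cmod (a i))) = 1 + cmod (a i)"
        by (metis abs_of_nonneg add_nonneg_nonneg norm_ge_zero norm_of_real zero_le_one)
    qed
    finally show ?thesis .
  qed
  have "\<exists>t\<in>{-1..1}. cmod (poly q (of_real t)) > Q / (2 * 84 ^ p)"
  proof (rule ccontr)
    assume "\<not> ?thesis"
    then have "\<And>t. t \<in> {-1..1} \<Longrightarrow> cmod (poly q (of_real t)) \<le> Q / (2 * 84 ^ p)" by force
    \<comment> \<open>Extrapolation to -13 inside the disc of radius 14 costs
      \<open>(6 * 14)^p = 84^p\<close>. The additional factor 2 makes the resulting inequality
      \<open>Q \<le> Q / 2\<close>, which is absurd.\<close>
    from poly_extrapolate[OF degq _ this, of 14 "-13"] have "Q \<le> 84 ^ p * (Q / (2 * 84 ^ p))"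
      unfolding qm by simp
    then show False using Q by simp
  qed
  then obtain t where t: "t \<in> {-1..1}" "cmod (poly q (of_real t)) > Q / (2 * 84 ^ p)" by auto
  define s where "s = 5/8 + t/8"
  have qs: "cmod (poly q (of_real t)) = (\<Prod>i<degree G. \<bar>s - cmod (a i)\<bar>)"
  proof -
    have "cmod (- (of_real t / 8) - of_real (5/8 - cmod (a i))) = \<bar>s - cmod (a i)\<bar>" for i
    proof -
      have "- (of_real t / 8) - of_real (5/8 - cmod (a i)) = (of_real (- (s - cmod (a i))) :: complex)"
        by (simp add: s_def)
      then show ?thesis by (metis abs_minus_cancel norm_of_real)
    qed
    then show ?thesis by (simp add: q flip: prod_norm)
  qed
  show ?thesis
  proof (rule that[of s])
    show "s \<in> {1/2..3/4}" using t by (auto simp: s_def)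
    fix z :: complex assume z: "cmod z = s"
    have "cmod (poly G w) = cmod (lead_coeff G) * (\<Prod>i<degree G. cmod (w - a i))"
      by (simp add: G norm_mult prod_norm)
    also have "\<dots> \<le> cmod (lead_coeff G) * Q"
      unfolding Q_def
    proof (intro mult_left_mono prod_mono conjI)
      show "cmod (w - a i) \<le> 1 + cmod (a i)" for i
        using w norm_triangle_ineq4[of w "a i"] by linarith
    qed auto
    also have "Q \<le> 2 * 84 ^ p * cmod (poly q (of_real t))"
      using t(2) by (simp add: field_simps)
    also have "cmod (poly q (of_real t)) \<le> (\<Prod>i<degree G. cmod (z - a i))"
      unfolding qs by (intro prod_mono) (use z norm_triangle_ineq3[of z "a _"] in auto)
    finally show "cmod (poly G w) \<le> 2 * 84 ^ p * cmod (poly G z)"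
      using mult_left_mono[of _ _ "cmod (lead_coeff G)"]
      by (simp add: G norm_mult prod_norm mult.assoc mult.left_commute)
  qed
qed

section \<open>Green's formula and regularised quotients\<close>

text \<open>\<open>P\<close> and \<open>Q\<close> are the Wirtinger derivatives of \<open>V\<close>,
  with \<open>Q\<close> the d-bar derivative. This is Green's formula differentiated with respect to
  the radius, a form that avoids area integrals: differentiation under the integral sign gives
  \<open>fx\<close>, and \<open>fx\<close> differs from \<open>2 \<rho> Q\<close> by the angular
  derivative of a periodic function, up to a constant factor.\<close>

lemma green_circle:
  fixes V P Q :: "complex \<Rightarrow> complex"
  assumes V: "\<And>z. z \<in> ball 0 R \<Longrightarrow> (V has_derivative (\<lambda>h. P z * h + Q z * cnj h)) (at z)"
    and P: "continuous_on (ball 0 R) P" and Q: "continuous_on (ball 0 R) Q"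
    and \<rho>: "\<bar>\<rho>\<bar> < R"
  shows "((\<lambda>\<rho>. integral {0..2*pi} (\<lambda>\<theta>. V (of_real \<rho> * cis \<theta>) * (of_real \<rho> * cis \<theta>))) has_vector_derivative
      of_real (2 * \<rho>) * integral {0..2*pi} (\<lambda>\<theta>. Q (of_real \<rho> * cis \<theta>))) (at \<rho>)"
proof -
  have Vc: "continuous_on (ball 0 R) V"
    using V by (meson continuous_at_imp_continuous_on has_derivative_continuous)
  define U where "U = {-R<..<R}"
  have U: "open U" "convex U" "\<rho> \<in> U" using \<rho> by (auto simp: U_def)
  define fx where "fx \<rho> \<theta> = (P (of_real \<rho> * cis \<theta>) * cis \<theta> + Q (of_real \<rho> * cis \<theta>) * cnj (cis \<theta>)) * (of_real \<rho> * cis \<theta>)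
      + V (of_real \<rho> * cis \<theta>) * cis \<theta>" for \<rho> \<theta>
  have inb: "of_real \<rho> * cis \<theta> \<in> ball 0 R" if "\<rho> \<in> U" for \<rho> \<theta>
    using that by (auto simp: U_def norm_mult abs_less_iff)
  note cont = continuous_on_compose2[OF P] continuous_on_compose2[OF Q] continuous_on_compose2[OF Vc]
  have d1: "((\<lambda>\<rho>. V (of_real \<rho> * cis \<theta>) * (of_real \<rho> * cis \<theta>)) has_vector_derivative fx \<rho> \<theta>) (at \<rho> within U)"
    if "\<rho> \<in> U" for \<rho> \<theta>
  proof -
    have "((\<lambda>\<rho>. of_real \<rho> * cis \<theta>) has_derivative (\<lambda>h. of_real h * cis \<theta>)) (at \<rho> within U)"
      by (auto intro!: derivative_eq_intros)
    from has_derivative_compose[OF this V[OF inb[OF that]]]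
    have "((\<lambda>\<rho>. V (of_real \<rho> * cis \<theta>)) has_derivative (\<lambda>h. P (of_real \<rho> * cis \<theta>) * (of_real h * cis \<theta>) + Q (of_real \<rho> * cis \<theta>) * cnj (of_real h * cis \<theta>))) (at \<rho> within U)" .
    from has_derivative_mult[OF this \<open>((\<lambda>\<rho>. of_real \<rho> * cis \<theta>) has_derivative (\<lambda>h. of_real h * cis \<theta>)) (at \<rho> within U)\<close>]
    show ?thesis unfolding has_vector_derivative_def fx_def
      by (rule has_derivative_eq_rhs) (simp add: fun_eq_iff scaleR_conv_of_real algebra_simps)
  qed
  have cfx: "continuous_on (U \<times> cbox 0 (2*pi)) (\<lambda>(\<rho>, \<theta>). fx \<rho> \<theta>)"
    unfolding fx_def split_beta using inb
    by (intro continuous_intros cont) auto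
  have cV: "continuous_on {0..2*pi} (\<lambda>\<theta>. V (of_real \<rho> * cis \<theta>) * (of_real \<rho> * cis \<theta>))" if "\<rho> \<in> U" for \<rho>
    using inb[OF that] by (intro continuous_intros cont) auto
  have cQ: "continuous_on {0..2*pi} (\<lambda>\<theta>. Q (of_real \<rho> * cis \<theta>))"
    using inb[OF U(3)] by (intro continuous_intros cont) auto
  have L: "((\<lambda>\<rho>. integral (cbox 0 (2*pi)) (\<lambda>\<theta>. V (of_real \<rho> * cis \<theta>) * (of_real \<rho> * cis \<theta>))) has_vector_derivative
      integral (cbox 0 (2*pi)) (fx \<rho>)) (at \<rho> within U)"
    by (rule leibniz_rule_vector_derivative[where f="\<lambda>\<rho> \<theta>. V (of_real \<rho> * cis \<theta>) * (of_real \<rho> * cis \<theta>)"])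
       (use d1 cfx U cV in \<open>auto intro!: integrable_continuous_interval\<close>)
  \<comment> \<open>The periodic function: as \<open>cis \<theta>\<close> times its conjugate is 1,
    the chain rule gives \<open>g' = \<i> (fx - 2 \<rho> Q)\<close>, and the integral of
    \<open>g'\<close> over a period vanishes.\<close>
  define g where "g \<theta> = V (of_real \<rho> * cis \<theta>) * cis \<theta>" for \<theta>
  have g: "(g has_vector_derivative \<i> * (fx \<rho> \<theta> - of_real (2 * \<rho>) * Q (of_real \<rho> * cis \<theta>))) (at \<theta>)" for \<theta>
  proof -
    have c: "(cis has_derivative (\<lambda>h. of_real h * (\<i> * cis \<theta>))) (at \<theta>)"
      using has_derivative_cis[OF has_derivative_ident, of \<theta> UNIV]
      by (simp add: scaleR_conv_of_real)
    have "((\<lambda>\<theta>. of_real \<rho> * cis \<theta>) has_derivative (\<lambda>h. of_real \<rho> * (of_real h * (\<i> * cis \<theta>)))) (at \<theta>)"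
      by (rule has_derivative_mult_right[OF c])
    from has_derivative_compose[OF this V[OF inb[OF U(3)]]]
    have "((\<lambda>\<theta>. V (of_real \<rho> * cis \<theta>)) has_derivative (\<lambda>h. P (of_real \<rho> * cis \<theta>) * (of_real \<rho> * (of_real h * (\<i> * cis \<theta>)))
       + Q (of_real \<rho> * cis \<theta>) * cnj (of_real \<rho> * (of_real h * (\<i> * cis \<theta>))))) (at \<theta>)" .
    from has_derivative_mult[OF this c] have D: "(g has_derivative
       (\<lambda>h. V (of_real \<rho> * cis \<theta>) * (of_real h * (\<i> * cis \<theta>)) + (P (of_real \<rho> * cis \<theta>) * (of_real \<rho> * (of_real h * (\<i> * cis \<theta>)))
       + Q (of_real \<rho> * cis \<theta>) * cnj (of_real \<rho> * (of_real h * (\<i> * cis \<theta>)))) * cis \<theta>)) (at \<theta>)"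
      by (simp only: g_def[abs_def])
    have u: "cis \<theta> * cnj (cis \<theta>) = 1" by (simp add: cis_cnj cis_mult)
    show ?thesis unfolding has_vector_derivative_def
    proof (rule has_derivative_eq_rhs[OF D], rule ext)
      fix h
      define e e' a b c' where "e = cis \<theta>" and "e' = cnj e" and "a = P (of_real \<rho> * e)" and "b = Q (of_real \<rho> * e)" and "c' = V (of_real \<rho> * e)"
      have u': "e * e' = 1" using u by (simp add: e_def e'_def)
      have e2: "e * (e' * x) = x" for x using u' by (metis mult.assoc mult_1)
      have e3: "e' * e = 1" using u' by (simp add: mult.commute)
      have "c' * (of_real h * (\<i> * e)) + (a * (of_real \<rho> * (of_real h * (\<i> * e))) + b * (of_real \<rho> * (of_real h * (- \<i> * e')))) * e
        = of_real h * (\<i> * ((a * e + b * e') * (of_real \<rho> * e) + c' * e - of_real (2 * \<rho>) * b))"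
        by (simp add: algebra_simps e2 e3)
      then show "V (of_real \<rho> * cis \<theta>) * (of_real h * (\<i> * cis \<theta>)) + (P (of_real \<rho> * cis \<theta>) * (of_real \<rho> * (of_real h * (\<i> * cis \<theta>)))
       + Q (of_real \<rho> * cis \<theta>) * cnj (of_real \<rho> * (of_real h * (\<i> * cis \<theta>)))) * cis \<theta> =
        h *\<^sub>R (\<i> * (fx \<rho> \<theta> - of_real (2 * \<rho>) * Q (of_real \<rho> * cis \<theta>)))"
        by (simp add: fx_def scaleR_conv_of_real flip: e_def a_def b_def c'_def e'_def)
    qed
  qed
  have "((\<lambda>\<theta>. \<i> * (fx \<rho> \<theta> - of_real (2 * \<rho>) * Q (of_real \<rho> * cis \<theta>))) has_integral g (2*pi) - g 0) {0..2*pi}"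
    by (rule fundamental_theorem_of_calculus) (simp, rule has_vector_derivative_at_within[OF g])
  then have "((\<lambda>\<theta>. \<i> * (fx \<rho> \<theta> - of_real (2 * \<rho>) * Q (of_real \<rho> * cis \<theta>))) has_integral 0) {0..2*pi}"
    by (simp add: g_def)
  from has_integral_mult_right[OF this, of "- \<i>"]
  have "((\<lambda>\<theta>. fx \<rho> \<theta> - of_real (2 * \<rho>) * Q (of_real \<rho> * cis \<theta>)) has_integral 0) {0..2*pi}"
    by (simp flip: mult.assoc)
  from has_integral_add[OF this has_integral_mult_right[OF integrable_integral[OF integrable_continuous_interval[OF cQ]], of "of_real (2*\<rho>)"]]
  have "(fx \<rho> has_integral of_real (2 * \<rho>) * integral {0..2*pi} (\<lambda>\<theta>. Q (of_real \<rho> * cis \<theta>))) {0..2*pi}"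
    by simp
  then have J: "integral (cbox 0 (2*pi)) (fx \<rho>) = of_real (2 * \<rho>) * integral {0..2*pi} (\<lambda>\<theta>. Q (of_real \<rho> * cis \<theta>))"
    by (simp add: integral_unique)
  show ?thesis
    by (rule L[unfolded J, unfolded at_within_open[OF U(3,1)] cbox_interval])
qed

text \<open>Adding \<open>r^2\<close> to \<open>|G|^2\<close> keeps the quotient
  \<open>E / G\<close> smooth across the zeros of \<open>G\<close>. The price is a d-bar derivative,
  the coefficient of \<open>cnj h\<close>, which carries the factor \<open>r^2\<close>. For
  \<open>E = G'\<close> this coefficient is the square of \<open>|G'| r / (|G|^2 + r^2)\<close>,
  hence nonnegative.\<close>

lemma regularised_quotient_derivative:
  fixes E G :: "complex \<Rightarrow> complex" and r :: real
  assumes "(E has_field_derivative E') (at z)" "(G has_field_derivative G') (at z)" and r: "r > 0"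
  shows "((\<lambda>z. E z * cnj (G z) / (G z * cnj (G z) + of_real (r^2))) has_derivative
    (\<lambda>h. ((E' * cnj (G z) * (G z * cnj (G z) + of_real (r^2)) - E z * cnj (G z) * G' * cnj (G z))
           / (G z * cnj (G z) + of_real (r^2))^2) * h
       + (E z * cnj G' * of_real (r^2) / (G z * cnj (G z) + of_real (r^2))^2) * cnj h)) (at z)"
proof -
  have T: "G z * cnj (G z) + of_real (r^2) \<noteq> 0"
  proof -
    have "G z * cnj (G z) + of_real (r^2) = of_real ((cmod (G z))^2 + r^2)"
      by (simp only: of_real_add complex_norm_square)
    moreover have "(cmod (G z))^2 + r^2 > 0" using r by (simp add: add_nonneg_pos)
    ultimately show ?thesis by (metis less_irrefl of_real_eq_0_iff)
  qed
  have E: "(E has_derivative (\<lambda>h. E' * h)) (at z)" and G: "(G has_derivative (\<lambda>h. G' * h)) (at z)"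
    using assms by (simp_all add: has_field_derivative_def)
  have cG: "((\<lambda>z. cnj (G z)) has_derivative (\<lambda>h. cnj (G' * h))) (at z)"
    by (rule bounded_linear.has_derivative[OF bounded_linear_cnj G])
  have D: "((\<lambda>z. G z * cnj (G z) + of_real (r^2)) has_derivative (\<lambda>h. G z * cnj (G' * h) + G' * h * cnj (G z))) (at z)"
    using has_derivative_add[OF has_derivative_mult[OF G cG] has_derivative_const] by simp
  show ?thesis
    by (rule has_derivative_eq_rhs[OF has_derivative_divide'[OF has_derivative_mult[OF E cG] D T]])
       (simp add: fun_eq_iff power2_eq_square divide_simps, simp add: algebra_simps)
qed


text \<open>Here \<open>a\<close> and \<open>b\<close> stand for \<open>|G|\<close> and
  \<open>|H|\<close>. With \<open>R^2 = a^2 + r^2\<close> and \<open>r = \<sigma>^j\<close>, the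
  hypothesis gives \<open>b^j \<le> (1+C) R^(j+1)\<close>. Multiplication by
  \<open>r^(j-1) \<le> R^(j-1)\<close> makes the left side the \<open>j\<close>-th power of
  \<open>b \<sigma>^(j-1)\<close> and the right side at most the \<open>j\<close>-th power of
  \<open>(1+C) R^2\<close>. The one factor \<open>\<sigma>\<close> that is left over is the gain
  that makes the d-bar derivative of the regularised quotient small.\<close>

lemma quasi_root_bound:
  fixes a b \<sigma> C :: real
  assumes j: "j > 0" and nn: "a \<ge> 0" "b \<ge> 0" "\<sigma> > 0" "C \<ge> 0"
    and b: "b ^ j \<le> a ^ (j+1) + C * (\<sigma> ^ j) ^ (j+1)"
  shows "b * \<sigma> ^ j \<le> (1 + C) * \<sigma> * (a\<^sup>2 + (\<sigma> ^ j)\<^sup>2)"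
proof -
  define r where "r = \<sigma> ^ j"
  define R where "R = sqrt (a\<^sup>2 + r\<^sup>2)"
  have r: "r > 0" using nn by (simp add: r_def)
  have R2: "R\<^sup>2 = a\<^sup>2 + r\<^sup>2" by (simp add: R_def)
  have Ra: "a \<le> R" and Rr: "r \<le> R" unfolding R_def by (auto intro!: real_le_rsqrt)
  have R0: "R > 0" using r Rr by linarith
  obtain i where i: "j = Suc i" using j by (cases j) auto
  have "(b * \<sigma> ^ i) ^ j = b ^ j * r ^ i"
    by (simp add: power_mult_distrib r_def mult.commute flip: power_mult)
  also have "\<dots> \<le> (R ^ (j+1) + C * R ^ (j+1)) * R ^ i"
  proof (rule mult_mono)
    have "a ^ (j+1) \<le> R ^ (j+1)" "r ^ (j+1) \<le> R ^ (j+1)"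
      using Ra Rr nn r by (auto intro!: power_mono simp del: power_Suc)
    then show "b ^ j \<le> R ^ (j+1) + C * R ^ (j+1)"
      using b mult_left_mono[of "r ^ (j+1)" "R ^ (j+1)" C] nn by (simp add: r_def)
    show "r ^ i \<le> R ^ i" using Rr r by (simp add: power_mono)
  qed (use nn R0 r in auto)
  also have "\<dots> = (1 + C) * (R\<^sup>2) ^ j"
    by (simp add: i algebra_simps mult_2_right flip: power_mult power_add)
  also have "\<dots> \<le> (1 + C) ^ j * (R\<^sup>2) ^ j"
    using nn j self_le_power[of "1 + C" j] by (intro mult_right_mono) auto
  finally have "(b * \<sigma> ^ i) ^ j \<le> ((1 + C) * R\<^sup>2) ^ j" by (simp add: power_mult_distrib)
  then have "b * \<sigma> ^ i \<le> (1 + C) * R\<^sup>2"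
    by (rule power_le_imp_le_base[of _ i, folded i]) (use nn in auto)
  then have "b * \<sigma> ^ i * \<sigma> \<le> (1 + C) * R\<^sup>2 * \<sigma>" using nn by (intro mult_right_mono) auto
  then show ?thesis by (simp add: i R2 r_def mult_ac)
qed

text \<open>Green's formula is used twice. With \<open>y = |G'| r / (|G|^2 + r^2)\<close>, the d-bar
  derivative of the quotient is at most \<open>\<kappa> c y \<le> \<kappa> c (1 + y^2)\<close>. Now
  \<open>y^2\<close> is itself the d-bar derivative of the regularised logarithmic derivative of
  \<open>G\<close>, so its integral over the disc is a boundary integral, and this is controlled by
  \<open>D / g\<close>. Neither the number nor the position of the zeros of \<open>G\<close> in the
  disc enters.\<close>

lemma green_quotient_bound:
  fixes G H k :: "complex \<Rightarrow> complex"
  assumes hol: "G holomorphic_on ball 0 R" "H holomorphic_on ball 0 R" "k holomorphic_on ball 0 R"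
    and \<rho>: "0 < \<rho>" "\<rho> < R" "\<rho> \<le> 1" and r: "r > 0" and c: "c \<ge> 0" "\<kappa> \<ge> 0" "g > 0"
    and k: "\<And>z. cmod z \<le> \<rho> \<Longrightarrow> cmod (k z) \<le> \<kappa>"
    and H: "\<And>z. cmod z \<le> \<rho> \<Longrightarrow> cmod (H z) * r \<le> c * ((cmod (G z))\<^sup>2 + r\<^sup>2)"
    and g: "\<And>z. cmod z = \<rho> \<Longrightarrow> g \<le> cmod (G z)"
    and D: "\<And>z. cmod z = \<rho> \<Longrightarrow> cmod (deriv G z) \<le> D"
  shows "cmod (integral {0..2*pi} (\<lambda>\<theta>. (H (of_real \<rho> * cis \<theta>) * k (of_real \<rho> * cis \<theta>) * cnj (G (of_real \<rho> * cis \<theta>)) /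
      (G (of_real \<rho> * cis \<theta>) * cnj (G (of_real \<rho> * cis \<theta>)) + of_real (r\<^sup>2))) * (of_real \<rho> * cis \<theta>)))
     \<le> \<kappa> * c * (2 * pi * (1 + D / g))"
proof -
  define T where "T z = G z * cnj (G z) + of_real (r\<^sup>2)" for z
  have T: "T z = of_real ((cmod (G z))\<^sup>2 + r\<^sup>2)" for z
    by (simp only: T_def of_real_add complex_norm_square)
  have Tpos: "(cmod (G z))\<^sup>2 + r\<^sup>2 > 0" for z using r by (simp add: add_nonneg_pos)
  have Tn: "cmod (T z) = (cmod (G z))\<^sup>2 + r\<^sup>2" for z
    unfolding T norm_of_real using Tpos[of z] by simp
  have T0: "T z \<noteq> 0" for z unfolding T using Tpos[of z] by (metis less_irrefl of_real_eq_0_iff)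
  define V where "V E z = E z * cnj (G z) / T z" for E z
  define P where "P E z = (deriv E z * cnj (G z) * T z - E z * cnj (G z) * deriv G z * cnj (G z)) / (T z)^2" for E z
  define Q where "Q E z = E z * cnj (deriv G z) * of_real (r\<^sup>2) / (T z)^2" for E z
  define I where "I E \<rho> = integral {0..2*pi} (\<lambda>\<theta>. V E (of_real \<rho> * cis \<theta>) * (of_real \<rho> * cis \<theta>))" for E \<rho>
  have hG': "deriv G holomorphic_on ball 0 R" by (intro holomorphic_deriv hol) auto
  have contE: "continuous_on (ball 0 R) E" if "E holomorphic_on ball 0 R" for E
    using that by (rule holomorphic_on_imp_continuous_on)
  note cG = contE[OF hol(1)] and cG' = contE[OF hG']
  have Vd: "(V E has_derivative (\<lambda>h. P E z * h + Q E z * cnj h)) (at z)"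
    if "E holomorphic_on ball 0 R" "z \<in> ball 0 R" for E z
    using regularised_quotient_derivative[OF holomorphic_derivI[OF that(1) open_ball that(2)] holomorphic_derivI[OF hol(1) open_ball that(2)] r]
    unfolding V_def P_def Q_def T_def by simp
  have PQ: "continuous_on (ball 0 R) (P E)" "continuous_on (ball 0 R) (Q E)" if "E holomorphic_on ball 0 R" for E
  proof -
    have "continuous_on (ball 0 R) T" unfolding T_def by (intro continuous_intros cG)
    moreover have "deriv E holomorphic_on ball 0 R" by (intro holomorphic_deriv that) auto
    ultimately show "continuous_on (ball 0 R) (P E)" "continuous_on (ball 0 R) (Q E)"
      unfolding P_def Q_def using T0 by (auto intro!: continuous_intros cG cG' contE[OF that] contE[of "deriv E"])
  qed
  have I': "(I E has_vector_derivative of_real (2 * x) * integral {0..2*pi} (\<lambda>\<theta>. Q E (of_real x * cis \<theta>))) (at x)"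
    if "E holomorphic_on ball 0 R" "\<bar>x\<bar> < R" for E x
    using green_circle[OF Vd[OF that(1)] PQ[OF that(1)] that(2)] unfolding I_def[abs_def] by simp
  define E where "E z = H z * k z" for z
  have hE: "E holomorphic_on ball 0 R" unfolding E_def by (intro holomorphic_intros hol)
  have contI: "continuous_on {0..\<rho>} (I E)" if "E holomorphic_on ball 0 R" for E
    by (rule continuous_at_imp_continuous_on) (use I'[OF that] \<rho> has_vector_derivative_continuous in force)
  have QE: "cmod (Q E z) \<le> \<kappa> * c * (1 + Re (Q (deriv G) z))" if z: "cmod z \<le> \<rho>" for z
  proof -
    define t y where "t = (cmod (G z))\<^sup>2 + r\<^sup>2" and "y = cmod (deriv G z) * r / t"
    have t: "t > 0" unfolding t_def by (rule Tpos)
    have "Q (deriv G) z = of_real (y\<^sup>2)"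
      unfolding Q_def T t_def[symmetric] y_def
      by (simp add: power_divide power_mult_distrib complex_norm_square[symmetric] flip: of_real_power of_real_mult)
    moreover have "cmod (Q E z) = cmod (k z) * (cmod (H z) * r / t) * y"
      unfolding Q_def T t_def[symmetric] y_def E_def using t r
      by (simp add: norm_mult norm_divide norm_power power2_eq_square)
    moreover have "cmod (H z) * r / t \<le> c" using H[OF z] t by (simp add: t_def pos_divide_le_eq)
    moreover have y0: "y \<ge> 0" using t r by (simp add: y_def)
    moreover have "cmod (k z) * (cmod (H z) * r / t) \<le> \<kappa> * c"
      using k[OF z] calculation(3) c t r by (intro mult_mono) auto
    moreover have "y \<le> 1 + y\<^sup>2" using zero_le_power2[of "y - 1/2"] by (simp add: power2_eq_square algebra_simps)
    ultimately show ?thesis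
      using mult_mono[of "cmod (k z) * (cmod (H z) * r / t)" "\<kappa> * c" y "1 + y\<^sup>2"] c by simp
  qed
  \<comment> \<open>A majorant: the derivative of \<open>J\<close> dominates the norm of the
    derivative of \<open>I E\<close>. The term \<open>2 pi x^2\<close> integrates the summand 1, and
    \<open>Re (I (deriv G) x)\<close> integrates \<open>y^2\<close>. The mean value inequality then
    bounds \<open>I E \<rho>\<close> by \<open>J \<rho>\<close>.\<close>
  define J where "J x = \<kappa> * c * (2 * pi * x\<^sup>2 + Re (I (deriv G) x))" for x
  define J' where "J' x = \<kappa> * c * (4 * pi * x + Re (of_real (2 * x) * integral {0..2*pi} (\<lambda>\<theta>. Q (deriv G) (of_real x * cis \<theta>))))" for x
  have Jd: "(J has_vector_derivative J' x) (at x)" if "\<bar>x\<bar> < R" for x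
  proof -
    have "((\<lambda>x. Re (I (deriv G) x)) has_real_derivative Re (of_real (2 * x) * integral {0..2*pi} (\<lambda>\<theta>. Q (deriv G) (of_real x * cis \<theta>)))) (at x)"
      using bounded_linear.has_vector_derivative[OF bounded_linear_Re I'[OF hG' that]]
      by (simp add: has_real_derivative_iff_has_vector_derivative)
    moreover have "((\<lambda>x. 2 * pi * x\<^sup>2) has_real_derivative 4 * pi * x) (at x)"
      by (auto intro!: derivative_eq_intros)
    ultimately have "(J has_real_derivative J' x) (at x)" unfolding J_def J'_def
      by (intro DERIV_cmult DERIV_add)
    then show ?thesis by (simp add: has_real_derivative_iff_has_vector_derivative)
  qed
  have "cmod (I E \<rho> - I E 0) \<le> J \<rho> - J 0"
  proof (rule differentiable_bound_general[OF \<rho>(1) contI[OF hE]])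
    show "continuous_on {0..\<rho>} J"
      by (rule continuous_at_imp_continuous_on) (use Jd \<rho> has_vector_derivative_continuous in force)
    fix x assume x: "0 < x" "x < \<rho>"
    then have x': "\<bar>x\<bar> < R" using \<rho> by auto
    show "(I E has_vector_derivative of_real (2 * x) * integral {0..2*pi} (\<lambda>\<theta>. Q E (of_real x * cis \<theta>))) (at x)"
      by (rule I'[OF hE x'])
    show "(J has_vector_derivative J' x) (at x)" by (rule Jd[OF x'])
    have inb: "of_real x * cis \<theta> \<in> ball 0 R" for \<theta> using x' by (simp add: norm_mult)
    have cQ: "continuous_on {0..2*pi} (\<lambda>\<theta>. Q A (of_real x * cis \<theta>))" if "A holomorphic_on ball 0 R" for A
      by (rule continuous_on_compose2[OF PQ(2)[OF that]]) (use inb in \<open>auto intro!: continuous_intros\<close>)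
    have B1: "cmod (integral {0..2*pi} (\<lambda>\<theta>. Q E (of_real x * cis \<theta>))) \<le> integral {0..2*pi} (\<lambda>\<theta>. \<kappa> * c * (1 + Re (Q (deriv G) (of_real x * cis \<theta>))))"
    proof (rule integral_norm_bound_integral)
      show "(\<lambda>\<theta>. Q E (of_real x * cis \<theta>)) integrable_on {0..2*pi}"
        by (rule integrable_continuous_interval[OF cQ[OF hE]])
      show "(\<lambda>\<theta>. \<kappa> * c * (1 + Re (Q (deriv G) (of_real x * cis \<theta>)))) integrable_on {0..2*pi}"
        by (intro integrable_continuous_interval continuous_intros cQ[OF hG'])
      show "cmod (Q E (of_real x * cis \<theta>)) \<le> \<kappa> * c * (1 + Re (Q (deriv G) (of_real x * cis \<theta>)))" for \<theta>
        by (rule QE) (use x in \<open>simp add: norm_mult\<close>)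
    qed
    have B2: "integral {0..2*pi} (\<lambda>\<theta>. \<kappa> * c * (1 + Re (Q (deriv G) (of_real x * cis \<theta>))))
      = \<kappa> * c * (2 * pi + Re (integral {0..2*pi} (\<lambda>\<theta>. Q (deriv G) (of_real x * cis \<theta>))))"
    proof -
      have "((\<lambda>\<theta>. Re (Q (deriv G) (of_real x * cis \<theta>))) has_integral Re (integral {0..2*pi} (\<lambda>\<theta>. Q (deriv G) (of_real x * cis \<theta>)))) {0..2*pi}"
        by (intro has_integral_Re integrable_integral integrable_continuous_interval cQ[OF hG'])
      from has_integral_mult_right[OF has_integral_add[OF has_integral_const_real[of 1 0 "2*pi"] this], of "\<kappa> * c"]
      show ?thesis by (intro integral_unique) simp
    qed
    note B = B1[unfolded B2]
    show "cmod (of_real (2 * x) * integral {0..2*pi} (\<lambda>\<theta>. Q E (of_real x * cis \<theta>))) \<le> J' x"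
      using mult_left_mono[OF B, of "2 * x"] x by (simp add: norm_mult J'_def algebra_simps)
  qed
  moreover have "I A 0 = 0" for A by (simp add: I_def)
  ultimately have "cmod (I E \<rho>) \<le> J \<rho>" by (simp add: J_def)
  also have "J \<rho> \<le> \<kappa> * c * (2 * pi * (1 + D / g))"
    unfolding J_def
  proof (rule mult_left_mono)
    have inb: "of_real \<rho> * cis \<theta> \<in> ball 0 R" for \<theta> using \<rho> by (simp add: norm_mult)
    have "cmod (I (deriv G) \<rho>) \<le> integral {0..2*pi} (\<lambda>\<theta>. D / g)"
      unfolding I_def
    proof (rule integral_norm_bound_integral)
      have cV: "continuous_on (ball 0 R) (V (deriv G))"
        using Vd[OF hG'] by (meson continuous_at_imp_continuous_on has_derivative_continuous)
      have cc: "continuous_on {0..2*pi} (\<lambda>\<theta>. of_real \<rho> * cis \<theta>)"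
        by (intro continuous_intros)
      have "continuous_on {0..2*pi} (\<lambda>\<theta>. V (deriv G) (of_real \<rho> * cis \<theta>))"
        by (rule continuous_on_compose2[OF cV cc]) (use inb in blast)
      then show "(\<lambda>\<theta>. V (deriv G) (of_real \<rho> * cis \<theta>) * (of_real \<rho> * cis \<theta>)) integrable_on {0..2*pi}"
        by (rule integrable_continuous_interval[OF continuous_on_mult[OF _ cc]])
      fix \<theta>
      define z where "z = of_real \<rho> * cis \<theta>"
      have z: "cmod z = \<rho>" using \<rho> by (simp add: z_def norm_mult)
      note g = g[OF z] and D = D[OF z]
      have G0: "cmod (G z) > 0" using g c by linarith
      have "cmod (V (deriv G) z) = cmod (deriv G z) * (cmod (G z) / ((cmod (G z))\<^sup>2 + r\<^sup>2))"
        by (simp add: V_def norm_mult norm_divide Tn)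
      also have "\<dots> \<le> D * (1 / g)"
      proof (rule mult_mono[OF D])
        have "cmod (G z) / ((cmod (G z))\<^sup>2 + r\<^sup>2) \<le> cmod (G z) / (cmod (G z))\<^sup>2"
          using G0 Tpos[of z] by (intro divide_left_mono) auto
        also have "\<dots> = 1 / cmod (G z)" using G0 by (simp add: power2_eq_square)
        also have "\<dots> \<le> 1 / g" using g c by (intro divide_left_mono) (auto intro: mult_pos_pos G0)
        finally show "cmod (G z) / ((cmod (G z))\<^sup>2 + r\<^sup>2) \<le> 1 / g" .
        show "0 \<le> D" by (rule order_trans[OF norm_ge_zero D])
      qed (use Tpos[of z] in auto)
      finally have "cmod (V (deriv G) z) \<le> D / g" by simp
      then have "cmod (V (deriv G) z) * cmod z \<le> D / g * 1"
        using z \<rho> order_trans[OF norm_ge_zero \<open>cmod (V (deriv G) z) \<le> D / g\<close>] by (intro mult_mono) auto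
      then show "cmod (V (deriv G) (of_real \<rho> * cis \<theta>) * (of_real \<rho> * cis \<theta>)) \<le> D / g"
        by (simp add: norm_mult z_def)
    qed auto
    then have "Re (I (deriv G) \<rho>) \<le> 2 * pi * (D / g)"
      using complex_Re_le_cmod[of "I (deriv G) \<rho>"] by simp
    moreover have "\<rho>\<^sup>2 \<le> 1" using \<rho> by (simp add: power_le_one)
    then have "2 * pi * \<rho>\<^sup>2 \<le> 2 * pi * 1" by (rule mult_left_mono) simp
    ultimately show "2 * pi * \<rho>\<^sup>2 + Re (I (deriv G) \<rho>) \<le> 2 * pi * (1 + D / g)"
      unfolding distrib_left by linarith
  qed (use c in auto)
  finally show ?thesis by (simp only: I_def V_def T_def E_def)
qed

section \<open>Approximate roots on a circle\<close>

lemma norm_power_diff_bound: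
  fixes u v :: complex
  assumes "cmod u \<le> B" "cmod v \<le> B" "B \<ge> 0"
  shows "cmod (u ^ n - v ^ n) \<le> real n * B ^ (n - 1) * cmod (u - v)"
proof -
  have "cmod (u ^ n - v ^ n) = cmod (u - v) * cmod (\<Sum>i<n. v ^ (n - Suc i) * u ^ i)"
    by (simp only: power_diff_sumr2 norm_mult)
  moreover have "cmod (\<Sum>i<n. v ^ (n - Suc i) * u ^ i) \<le> (\<Sum>i<n. B ^ (n - 1))"
  proof (rule sum_norm_le)
    fix i assume i: "i \<in> {..<n}"
    have "cmod (v ^ (n - Suc i) * u ^ i) \<le> B ^ (n - Suc i) * B ^ i"
      unfolding norm_mult norm_power by (intro mult_mono power_mono) (use assms in auto)
    also have "\<dots> = B ^ (n - 1)" using i by (simp flip: power_add)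
    finally show "cmod (v ^ (n - Suc i) * u ^ i) \<le> B ^ (n - 1)" .
  qed
  ultimately have "cmod (u ^ n - v ^ n) \<le> cmod (u - v) * (\<Sum>i<n. B ^ (n - 1))"
    by (simp only: mult_left_mono norm_ge_zero)
  then show ?thesis by (simp add: mult_ac)
qed

lemma norm_le_of_power_le:
  assumes "cmod u ^ j \<le> B" "B \<ge> 1" "j > 0"
  shows "cmod u \<le> B"
proof (rule ccontr)
  assume "\<not> cmod u \<le> B"
  then have "B < cmod u" "1 \<le> cmod u" using assms by auto
  then have "B < cmod u ^ j" using self_le_power[of "cmod u" j] assms by linarith
  then show False using assms by simp
qed

text \<open>Only an annulus is known to lie in \<open>S\<close>, since \<open>u\<close> may have
  poles inside. The difference quotient \<open>q\<close> has a removable singularity at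
  \<open>z\<close>, so its integrals over the two homotopic circles agree. The kernel itself
  contributes \<open>2 pi \<i>\<close> on the outer circle and 0 on the inner one.\<close>

lemma cauchy_annulus:
  assumes u: "u holomorphic_on S" "open S" and ab: "0 < a" "a < cmod z" "cmod z < b"
    and S: "\<And>\<zeta>. a \<le> cmod \<zeta> \<Longrightarrow> cmod \<zeta> \<le> b \<Longrightarrow> \<zeta> \<in> S"
  shows "contour_integral (circlepath 0 b) (\<lambda>\<zeta>. u \<zeta> / (\<zeta> - z)) - contour_integral (circlepath 0 a) (\<lambda>\<zeta>. u \<zeta> / (\<zeta> - z))
    = 2 * pi * \<i> * u z"
proof -
  define q where "q = (\<lambda>\<zeta>. if \<zeta> = z then deriv u z else (u \<zeta> - u z) / (\<zeta> - z))"
  have q: "q holomorphic_on S" unfolding q_def by (rule pole_lemma_open[OF u])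
  have hom: "homotopic_loops S (circlepath 0 a) (circlepath 0 b)"
  proof (rule homotopic_loops_linear)
    fix t :: real
    show "closed_segment (circlepath 0 a t) (circlepath 0 b t) \<subseteq> S"
    proof
      fix x assume "x \<in> closed_segment (circlepath 0 a t) (circlepath 0 b t)"
      then obtain v where v: "0 \<le> v" "v \<le> 1" "x = (1 - v) *\<^sub>R circlepath 0 a t + v *\<^sub>R circlepath 0 b t"
        by (auto simp: in_segment)
      have x: "x = of_real ((1 - v) * a + v * b) * exp (2 * of_real pi * \<i> * of_real t)"
        by (simp add: v circlepath scaleR_conv_of_real algebra_simps)
      have "a \<le> (1 - v) * a + v * b \<and> (1 - v) * a + v * b \<le> b"
        using v ab convex_bound_le[of a b b "1 - v" v] mult_left_mono[of a b v] by (auto simp: algebra_simps)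
      moreover have "cmod x = \<bar>(1 - v) * a + v * b\<bar>"
        unfolding x norm_mult norm_of_real by (simp add: norm_exp_eq_Re)
      ultimately show "x \<in> S" using ab by (intro S) auto
    qed
  qed auto
  have eq: "contour_integral (circlepath 0 a) q = contour_integral (circlepath 0 b) q"
    by (rule Cauchy_theorem_homotopic_loops[OF hom u(2) q]) auto
  have decomp: "contour_integral (circlepath 0 c) (\<lambda>\<zeta>. u \<zeta> / (\<zeta> - z))
      = contour_integral (circlepath 0 c) q + u z * contour_integral (circlepath 0 c) (\<lambda>\<zeta>. 1 / (\<zeta> - z))"
    if c: "c \<in> {a, b}" for c
  proof -
    have im: "cmod \<zeta> = c" if "\<zeta> \<in> path_image (circlepath 0 c)" for \<zeta>
      using that c ab by auto
    have nz: "\<zeta> \<noteq> z" if "\<zeta> \<in> path_image (circlepath 0 c)" for \<zeta>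
      using im[OF that] c ab by auto
    have "continuous_on (path_image (circlepath 0 c)) q"
      by (rule continuous_on_subset[OF holomorphic_on_imp_continuous_on[OF q]]) (use im c ab S in force)
    then have i1: "q contour_integrable_on circlepath 0 c"
      by (rule contour_integrable_continuous_circlepath)
    have i2: "(\<lambda>\<zeta>. 1 / (\<zeta> - z)) contour_integrable_on circlepath 0 c"
      by (intro contour_integrable_continuous_circlepath continuous_intros) (use nz in auto)
    have "contour_integral (circlepath 0 c) (\<lambda>\<zeta>. u \<zeta> / (\<zeta> - z)) = contour_integral (circlepath 0 c) (\<lambda>\<zeta>. q \<zeta> + u z * (1 / (\<zeta> - z)))"
      by (rule contour_integral_cong) (use nz in \<open>auto simp: q_def diff_divide_distrib\<close>)
    also have "\<dots> = contour_integral (circlepath 0 c) q + contour_integral (circlepath 0 c) (\<lambda>\<zeta>. u z * (1 / (\<zeta> - z)))"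
      by (rule contour_integral_add[OF i1 contour_integrable_lmul[OF i2]])
    also have "contour_integral (circlepath 0 c) (\<lambda>\<zeta>. u z * (1 / (\<zeta> - z))) = u z * contour_integral (circlepath 0 c) (\<lambda>\<zeta>. 1 / (\<zeta> - z))"
      by (rule contour_integral_lmul[OF i2])
    finally show ?thesis .
  qed
  have "((\<lambda>\<zeta>. 1 / (\<zeta> - z)) has_contour_integral (2 * of_real pi * \<i> * 1)) (circlepath 0 b)"
    by (rule Cauchy_integral_circlepath_simple) (use ab in auto)
  then have b: "contour_integral (circlepath 0 b) (\<lambda>\<zeta>. 1 / (\<zeta> - z)) = 2 * of_real pi * \<i>"
    by (simp add: contour_integral_unique)
  have "((\<lambda>\<zeta>. 1 / (\<zeta> - z)) has_contour_integral 0) (circlepath 0 a)"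
  proof (rule Cauchy_theorem_disc_simple)
    show "(\<lambda>\<zeta>. 1 / (\<zeta> - z)) holomorphic_on ball 0 (cmod z)" by (intro holomorphic_intros) auto
  qed (use ab in auto)
  then have a: "contour_integral (circlepath 0 a) (\<lambda>\<zeta>. 1 / (\<zeta> - z)) = 0"
    by (simp add: contour_integral_unique)
  show ?thesis using decomp[of a] decomp[of b] a b eq by simp
qed

lemma contour_integral_circlepath_cis:
  "contour_integral (circlepath 0 \<rho>) f = \<i> * integral {0..2*pi} (\<lambda>\<theta>. f (of_real \<rho> * cis \<theta>) * (of_real \<rho> * cis \<theta>))"
proof -
  have "contour_integral (circlepath 0 \<rho>) f = integral {0..2*pi} (\<lambda>\<theta>. f (of_real \<rho> * cis \<theta>) * of_real \<rho> * \<i> * cis \<theta>)"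
    unfolding circlepath_def by (subst contour_integral_part_circlepath_eq) auto
  also have "(\<lambda>\<theta>. f (of_real \<rho> * cis \<theta>) * of_real \<rho> * \<i> * cis \<theta>) = (\<lambda>\<theta>. \<i> * (f (of_real \<rho> * cis \<theta>) * (of_real \<rho> * cis \<theta>)))"
    by (simp add: fun_eq_iff mult_ac)
  finally show ?thesis by simp
qed

text \<open>Cauchy's estimate on circles of radius 1/8, which stay within the radius 15/16. The
  bound 13/16 is 3/4 + 1/16, the largest outer radius of the annuli used for approximate
  roots.\<close>

lemma holomorphic_lipschitz:
  assumes G: "G holomorphic_on ball 0 1" "\<And>z. z \<in> ball 0 1 \<Longrightarrow> cmod (G z) \<le> C"
  shows "cmod z \<le> 13/16 \<Longrightarrow> cmod (deriv G z) \<le> 8 * C"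
    and "cmod z \<le> 13/16 \<Longrightarrow> cmod w \<le> 13/16 \<Longrightarrow> cmod (G z - G w) \<le> 8 * C * cmod (z - w)"
proof -
  have d: "cmod (deriv G z) \<le> 8 * C" if z: "cmod z \<le> 13/16" for z
  proof -
    have sub: "cball z (1/8) \<subseteq> ball 0 1"
    proof
      fix y assume "y \<in> cball z (1/8)"
      then show "y \<in> ball 0 1" using norm_triangle_sub[of y z] z by (auto simp: dist_norm norm_minus_commute)
    qed
    have "cmod ((deriv ^^ 1) G z) \<le> fact 1 * C / (1/8) ^ 1"
    proof (rule Cauchy_inequality)
      show "G holomorphic_on ball z (1/8)" by (rule holomorphic_on_subset[OF G(1)]) (use sub in auto)
      show "continuous_on (cball z (1/8)) G"
        by (rule continuous_on_subset[OF holomorphic_on_imp_continuous_on[OF G(1)] sub])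
      show "cmod (G x) \<le> C" if "cmod (z - x) = 1/8" for x
      proof -
        have "x \<in> cball z (1/8)" using that by (simp add: dist_norm)
        with sub show ?thesis by (intro G(2)) blast
      qed
    qed auto
    then show ?thesis by simp
  qed
  then show "cmod z \<le> 13/16 \<Longrightarrow> cmod (deriv G z) \<le> 8 * C" .
  assume z: "cmod z \<le> 13/16" and w: "cmod w \<le> 13/16"
  show "cmod (G z - G w) \<le> 8 * C * cmod (z - w)"
  proof (rule field_differentiable_bound[of "cball 0 (13/16)"])
    show "(G has_field_derivative deriv G x) (at x within cball 0 (13/16))" if "x \<in> cball 0 (13/16)" for x
      by (rule has_field_derivative_at_within, rule holomorphic_derivI[OF G(1)]) (use that in auto)
  qed (use d z w in auto)
qed

text \<open>The quotient \<open>u = H / G\<close> solves both equations approximately, but only near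
  the circle. \<open>F\<close> is the outer Cauchy integral of \<open>u\<close>, so on the circle
  \<open>F - u\<close> is the inner Cauchy integral. There \<open>u\<close> may be exchanged for the
  regularised quotient, to which the double use of Green's formula applies. The estimates for
  \<open>F\<close>, \<open>F^j - G\<close> and \<open>F^(j+1) - H\<close> then spread from the
  circle to the disc by the maximum principle.\<close>

lemma quasi_root_circle:
  fixes G H :: "complex \<Rightarrow> complex"
  assumes j: "j > 0" and C: "C \<ge> 1" and lam: "0 < \<mu>" "\<mu> \<le> 1"
    and G: "G holomorphic_on ball 0 1" "\<And>z. z \<in> ball 0 1 \<Longrightarrow> cmod (G z) \<le> C"
    and H: "H holomorphic_on ball 0 1" "\<And>z. z \<in> ball 0 1 \<Longrightarrow> cmod (H z) \<le> C"
    and GH: "\<And>z. z \<in> ball 0 1 \<Longrightarrow> cmod (G z ^ (j+1) - H z ^ j) \<le> C * \<mu> ^ (7 * j * (j+1))"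
    and s: "s \<in> {1/2..3/4}" and Gs: "\<And>z. cmod z = s \<Longrightarrow> \<mu>\<^sup>2 \<le> cmod (G z)"
  defines "C2 \<equiv> 1 + C + C * 2 ^ j"
  defines "C7 \<equiv> 16 * C * ((1 + C) * (1 + 16 * C) + 4 * C2)"
  obtains F where "F holomorphic_on ball 0 s"
    "\<And>z. z \<in> ball 0 s \<Longrightarrow> cmod (F z) \<le> C2 + C7"
    "\<And>z. z \<in> ball 0 s \<Longrightarrow> cmod (F z ^ j - G z) \<le> (real j * (C2 + C7) ^ (j-1) * C7 + C) * \<mu>"
    "\<And>z. z \<in> ball 0 s \<Longrightarrow> cmod (F z ^ (j+1) - H z) \<le> (real (j+1) * (C2 + C7) ^ j * C7 + C2 * C) * \<mu>"
proof -
  define \<rho> where "\<rho> = \<mu>\<^sup>2"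
  \<comment> \<open>The half-width of the annulus: \<open>G\<close> has Lipschitz constant
    \<open>8 C\<close>, so it changes by at most \<open>\<rho> / 2\<close> across this distance and
    keeps half of its lower bound \<open>\<rho>\<close>.\<close>
  define w where "w = \<rho> / (16 * C)"
  \<comment> \<open>In the bound for \<open>F - u\<close> the kernel costs \<open>1 / \<rho>\<close>
    and the estimates of the regularised quotient at most \<open>1 / \<rho>^2\<close> more. In total
    this is \<open>\<mu>^(-6)\<close>, so the exponent 7 leaves exactly one factor
    \<open>\<mu>\<close>.\<close>
  define \<sigma> where "\<sigma> = \<mu> ^ 7"
  define r where "r = \<sigma> ^ j"
  have rho: "0 < \<rho>" "\<rho> \<le> 1" using lam by (auto simp: \<rho>_def power_le_one)
  have w: "0 < w" "w \<le> 1/16" "8 * C * w = \<rho> / 2"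
    using rho C by (auto simp: w_def field_simps)
  have sig: "0 < \<sigma>" "\<sigma> \<le> 1" using lam by (auto simp: \<sigma>_def power_le_one)
  have r: "0 < r" "r \<le> 1" using sig by (auto simp: r_def power_le_one)
  have r_sig: "r\<^sup>2 \<le> \<sigma>"
  proof -
    have "r\<^sup>2 \<le> r" using r by (simp add: power2_eq_square mult_left_le)
    also have "r \<le> \<sigma>" unfolding r_def using power_decreasing[of 1 j \<sigma>] sig j by simp
    finally show ?thesis .
  qed
  have K: "\<mu> ^ (7 * j * (j+1)) = r ^ (j+1)" by (simp only: r_def \<sigma>_def power_mult)
  have err_j: "C * \<mu> ^ (7 * j * (j+1)) * (1 / \<rho>) ^ j \<le> C * \<mu>"
  proof -
    have "\<mu> ^ (7 * j * (j+1)) \<le> \<mu> ^ (2 * j + 1)"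
    proof (rule power_decreasing)
      have "2 * j + 1 \<le> 7 * j" using j by simp
      also have "\<dots> \<le> 7 * j * (j+1)" by simp
      finally show "2 * j + 1 \<le> 7 * j * (j+1)" .
    qed (use lam in auto)
    also have "\<dots> = \<rho> ^ j * \<mu>" by (simp add: \<rho>_def power_mult)
    finally have "\<mu> ^ (7 * j * (j+1)) * (1 / \<rho>) ^ j \<le> \<mu>" using rho by (simp add: field_simps power_divide)
    then show ?thesis using C by (simp add: mult.assoc)
  qed
  have in13: "cmod z \<le> 13/16" if "cmod z \<le> s + w" for z :: complex using that s w by auto
  have inb: "z \<in> ball 0 1" if "cmod z \<le> s + w" for z :: complex using in13[OF that] by auto
  have low: "\<rho> / 2 \<le> cmod (G z)" if z: "s - w \<le> cmod z" "cmod z \<le> s + w" for z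
  proof -
    have z0: "cmod z > 0" using z s w by auto
    define y where "y = of_real (s / cmod z) * z"
    have y: "cmod y = s" using z0 s by (simp add: y_def norm_mult norm_divide)
    have "z - y = of_real ((cmod z - s) / cmod z) * z" using z0 by (simp add: y_def field_simps)
    then have "cmod (z - y) = \<bar>(cmod z - s) / cmod z\<bar> * cmod z" by (simp only: norm_mult norm_of_real)
    then have "cmod (z - y) = \<bar>cmod z - s\<bar>" using z0 by simp
    then have "cmod (z - y) \<le> w" using z by auto
    moreover have "cmod (G z - G y) \<le> 8 * C * cmod (z - y)"
      using holomorphic_lipschitz(2)[OF G, of z y] in13[OF z(2)] y s by auto
    ultimately have "cmod (G z - G y) \<le> \<rho> / 2"
      using mult_left_mono[of "cmod (z - y)" w "8 * C"] C w by linarith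
    then show ?thesis using Gs[OF y] norm_triangle_ineq2[of "G y" "G z"] by (simp add: \<rho>_def norm_minus_commute)
  qed
  define S where "S = {z \<in> ball 0 1. G z \<noteq> 0}"
  have "S = ball 0 1 \<inter> G -` (-{0})" by (auto simp: S_def)
  then have openS: "open S"
    using continuous_open_preimage[OF holomorphic_on_imp_continuous_on[OF G(1)] open_ball, of "-{0}"] open_delete[OF open_UNIV, of 0]
    by (simp add: Compl_eq_Diff_UNIV)
  define u where "u z = H z / G z" for z
  have u: "u holomorphic_on S" unfolding u_def
    by (intro holomorphic_intros holomorphic_on_subset[OF H(1)] holomorphic_on_subset[OF G(1)]) (auto simp: S_def)
  have annS: "z \<in> S" if "s - w \<le> cmod z" "cmod z \<le> s + w" for z
    using low[OF that] rho inb[OF that(2)] by (auto simp: S_def)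
  \<comment> \<open>The identity \<open>G^j (u^j - G) = H^j - G^(j+1)\<close> moves the hypothesis
    on \<open>G\<close> and \<open>H\<close> to \<open>u\<close>, at the price of \<open>j\<close>
    factors \<open>1 / g\<close>.\<close>
  have uj: "cmod (u z ^ j - G z) \<le> C * \<mu> ^ (7 * j * (j+1)) * (1 / g) ^ j" if "z \<in> ball 0 1" "0 < g" "g \<le> cmod (G z)" for z g
  proof -
    have G0: "G z \<noteq> 0" using that by auto
    have "u z ^ j - G z = - (G z ^ (j+1) - H z ^ j) / G z ^ j"
      using G0 by (simp add: u_def power_divide field_simps)
    then have "cmod (u z ^ j - G z) = cmod (G z ^ (j+1) - H z ^ j) * (1 / cmod (G z)) ^ j"
      by (simp add: norm_divide norm_power power_divide norm_minus_commute)
    also have "\<dots> \<le> C * \<mu> ^ (7 * j * (j+1)) * (1 / g) ^ j"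
      by (intro mult_mono GH power_mono divide_left_mono) (use that lam C G0 in auto)
    finally show ?thesis .
  qed
  have C2: "C2 \<ge> 1" using C by (simp add: C2_def add_increasing2)
  have ub: "cmod (u z) \<le> C2" if z: "s - w \<le> cmod z" "cmod z \<le> s + w" for z
  proof (rule norm_le_of_power_le[OF _ C2 j])
    have "cmod (u z ^ j - G z) \<le> C * \<mu> ^ (7 * j * (j+1)) * (1 / (\<rho>/2)) ^ j"
      by (rule uj[OF inb[OF z(2)]]) (use low[OF z] rho in auto)
    also have "\<dots> = (C * \<mu> ^ (7 * j * (j+1)) * (1 / \<rho>) ^ j) * 2 ^ j"
      by (simp add: power_divide)
    also have "\<dots> \<le> (C * \<mu>) * 2 ^ j" by (rule mult_right_mono[OF err_j]) simp
    also have "\<dots> \<le> C * 2 ^ j" using lam C by simp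
    finally have "cmod (u z ^ j - G z) \<le> C * 2 ^ j" .
    then have "cmod (u z ^ j) \<le> C + C * 2 ^ j"
      using G(2)[OF inb[OF z(2)]] norm_triangle_sub[of "u z ^ j" "G z"] by linarith
    then show "cmod (u z) ^ j \<le> C2" by (simp add: C2_def norm_power)
  qed
  have Cineq: "C \<ge> 0" "C2 \<ge> 0" "C7 \<ge> 0" using C C2 by (auto simp: C7_def)
  have Hbd: "cmod (H z) * r \<le> ((1 + C) * \<sigma>) * ((cmod (G z))\<^sup>2 + r\<^sup>2)" if "z \<in> ball 0 1" for z
    unfolding r_def
  proof (rule quasi_root_bound[OF j])
    have "cmod (H z ^ j) \<le> cmod (G z ^ (j+1)) + cmod (G z ^ (j+1) - H z ^ j)"
      using norm_triangle_ineq4[of "G z ^ (j+1)" "G z ^ (j+1) - H z ^ j"] by simp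
    then show "cmod (H z) ^ j \<le> cmod (G z) ^ (j+1) + C * (\<sigma> ^ j) ^ (j+1)"
      using GH[OF that] unfolding K by (simp only: norm_power r_def)
  qed (use sig C in auto)
  define a where "a = s - w"
  define b where "b = s + w"
  have ab: "0 < a" "a < s" "s < b" "a \<le> 1" using s w by (auto simp: a_def b_def)
  define F where "F z = contour_integral (circlepath 0 b) (\<lambda>\<zeta>. u \<zeta> / (\<zeta> - z)) / (2 * of_real pi * \<i>)" for z
  have contu: "continuous_on (path_image (circlepath 0 c)) u" if "c \<in> {a, b}" for c
    by (rule continuous_on_subset[OF holomorphic_on_imp_continuous_on[OF u]])
       (use that ab w annS in \<open>auto simp: a_def b_def\<close>)
  have holF: "F holomorphic_on ball 0 b"
  proof -
    have "(\<lambda>\<zeta>. u \<zeta> / (\<zeta> - z) ^ 1) contour_integrable_on circlepath 0 b" if "z \<in> ball 0 b" for z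
      by (intro contour_integrable_continuous_circlepath continuous_intros contu) (use that ab in auto)
    from Cauchy_next_derivative_circlepath(2)[OF contu this[THEN has_contour_integral_integral]]
    have "(\<lambda>z. contour_integral (circlepath 0 b) (\<lambda>\<zeta>. u \<zeta> / (\<zeta> - z) ^ 1)) holomorphic_on ball 0 b"
      unfolding holomorphic_on_open[OF open_ball] by blast
    then show ?thesis unfolding F_def by (intro holomorphic_intros) auto
  qed
  have Fu: "cmod (F z - u z) \<le> C7 * \<mu>" if z: "cmod z = s" for z
  proof -
    have "contour_integral (circlepath 0 b) (\<lambda>\<zeta>. u \<zeta> / (\<zeta> - z)) - contour_integral (circlepath 0 a) (\<lambda>\<zeta>. u \<zeta> / (\<zeta> - z)) = 2 * pi * \<i> * u z"
      by (rule cauchy_annulus[OF u openS]) (use z ab annS in \<open>auto simp: a_def b_def\<close>)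
    then have FR: "F z - u z = contour_integral (circlepath 0 a) (\<lambda>\<zeta>. u \<zeta> / (\<zeta> - z)) / (2 * of_real pi * \<i>)"
      by (simp add: F_def field_simps)
    define k where "k \<zeta> = 1 / (\<zeta> - z)" for \<zeta>
    \<comment> \<open>The regularised version of \<open>u\<close> times the Cauchy kernel, defined
      also at the zeros of \<open>G\<close>. On the inner circle both differ by the factor
      \<open>r^2 / (|G|^2 + r^2)\<close>, which is small because \<open>|G| \<ge> \<rho> / 2\<close>
      there.\<close>
    define v where "v \<zeta> = H \<zeta> * k \<zeta> * cnj (G \<zeta>) / (G \<zeta> * cnj (G \<zeta>) + of_real (r\<^sup>2))" for \<zeta>
    have k: "cmod (k \<zeta>) \<le> 1 / w" if "cmod \<zeta> \<le> a" for \<zeta>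
    proof -
      have "w \<le> cmod (\<zeta> - z)" using that z norm_triangle_ineq2[of z \<zeta>] by (simp add: a_def norm_minus_commute)
      then show ?thesis using w frac_le[of 1 1 w "cmod (\<zeta> - z)"] by (simp add: k_def norm_divide)
    qed
    have V: "cmod (integral {0..2*pi} (\<lambda>\<theta>. v (of_real a * cis \<theta>) * (of_real a * cis \<theta>)))
       \<le> 1 / w * ((1 + C) * \<sigma>) * (2 * pi * (1 + 8 * C / (\<rho>/2)))"
      unfolding v_def
    proof (rule green_quotient_bound[of G s H k a r])
      show "k holomorphic_on ball 0 s" unfolding k_def using z by (intro holomorphic_intros) auto
      show "cmod (k \<zeta>) \<le> 1 / w" if "cmod \<zeta> \<le> a" for \<zeta> using k[OF that] .
      show "cmod (H \<zeta>) * r \<le> (1 + C) * \<sigma> * ((cmod (G \<zeta>))\<^sup>2 + r\<^sup>2)" if "cmod \<zeta> \<le> a" for \<zeta>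
        by (rule Hbd[OF inb]) (use that w in \<open>auto simp: a_def\<close>)
      show "\<rho> / 2 \<le> cmod (G \<zeta>)" if "cmod \<zeta> = a" for \<zeta> by (rule low) (use that w in \<open>auto simp: a_def\<close>)
      show "cmod (deriv G \<zeta>) \<le> 8 * C" if "cmod \<zeta> = a" for \<zeta>
        by (rule holomorphic_lipschitz(1)[OF G in13]) (use that w in \<open>auto simp: a_def\<close>)
    qed (use ab r sig C w rho s in \<open>auto intro: holomorphic_on_subset[OF G(1)] holomorphic_on_subset[OF H(1)]\<close>)
    have uv: "cmod (u \<zeta> * k \<zeta> - v \<zeta>) \<le> 1 / w * (C2 * (4 * \<sigma> / \<rho>\<^sup>2))" if \<zeta>: "cmod \<zeta> = a" for \<zeta>
    proof -
      define t where "t = (cmod (G \<zeta>))\<^sup>2 + r\<^sup>2"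
      have lowz: "\<rho> / 2 \<le> cmod (G \<zeta>)" by (rule low) (use \<zeta> w in \<open>auto simp: a_def\<close>)
      have G0: "G \<zeta> \<noteq> 0" using lowz rho by auto
      have t: "t \<ge> (\<rho>/2)\<^sup>2" unfolding t_def using power_mono[OF lowz, of 2] rho by (simp add: add_increasing2)
      then have t0: "t > 0" using rho by (meson half_gt_zero less_le_trans zero_less_power)
      have T: "G \<zeta> * cnj (G \<zeta>) + of_real (r\<^sup>2) = of_real t"
        by (simp only: t_def of_real_add complex_norm_square)
      then have GG: "G \<zeta> * cnj (G \<zeta>) = of_real t - of_real (r\<^sup>2)" by (simp add: eq_diff_eq)
      have tn: "(of_real t :: complex) \<noteq> 0" using t0 by simp
      have "u \<zeta> * k \<zeta> - v \<zeta> = k \<zeta> * u \<zeta> * (1 - G \<zeta> * cnj (G \<zeta>) / of_real t)"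
        unfolding v_def T u_def using G0 tn by (simp add: field_simps)
      also have "1 - G \<zeta> * cnj (G \<zeta>) / of_real t = of_real (r\<^sup>2 / t)"
        unfolding GG using tn by (simp add: field_simps)
      finally have "cmod (u \<zeta> * k \<zeta> - v \<zeta>) = cmod (k \<zeta>) * (cmod (u \<zeta>) * (r\<^sup>2 / t))"
        using t0 by (simp add: norm_mult norm_divide norm_power)
      also have "\<dots> \<le> 1 / w * (C2 * (4 * \<sigma> / \<rho>\<^sup>2))"
      proof (intro mult_mono k ub)
        have "r\<^sup>2 / t \<le> \<sigma> / (\<rho>/2)\<^sup>2" using r_sig t rho t0 sig by (intro frac_le) auto
        then show "r\<^sup>2 / t \<le> 4 * \<sigma> / \<rho>\<^sup>2" by (simp add: power_divide mult.commute)
      qed (use \<zeta> w C2 t0 in \<open>auto simp: a_def\<close>)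
      finally show ?thesis .
    qed
    have cont_uk: "continuous_on {0..2*pi} (\<lambda>\<theta>. u (of_real a * cis \<theta>) * k (of_real a * cis \<theta>) * (of_real a * cis \<theta>))"
    proof -
      have "continuous_on (path_image (circlepath 0 a)) (\<lambda>\<zeta>. u \<zeta> * k \<zeta> * \<zeta>)"
        unfolding k_def by (intro continuous_intros contu) (use z ab in auto)
      then show ?thesis by (rule continuous_on_compose2) (use ab in \<open>auto intro!: continuous_intros simp: norm_mult\<close>)
    qed
    have cont_v: "continuous_on {0..2*pi} (\<lambda>\<theta>. v (of_real a * cis \<theta>) * (of_real a * cis \<theta>))"
    proof -
      have sub: "path_image (circlepath 0 a) \<subseteq> ball 0 1" using ab s w inb by (auto simp: a_def)
      have t: "G \<zeta> * cnj (G \<zeta>) + of_real (r\<^sup>2) \<noteq> 0" for \<zeta>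
      proof -
        have "G \<zeta> * cnj (G \<zeta>) + of_real (r\<^sup>2) = of_real ((cmod (G \<zeta>))\<^sup>2 + r\<^sup>2)"
          by (simp only: of_real_add complex_norm_square)
        moreover have "(cmod (G \<zeta>))\<^sup>2 + r\<^sup>2 > 0" using r by (simp add: add_nonneg_pos)
        ultimately show ?thesis by (metis less_irrefl of_real_eq_0_iff)
      qed
      have "continuous_on (path_image (circlepath 0 a)) (\<lambda>\<zeta>. v \<zeta> * \<zeta>)"
        unfolding v_def k_def
        by (intro continuous_intros continuous_on_subset[OF holomorphic_on_imp_continuous_on[OF G(1)] sub]
            continuous_on_subset[OF holomorphic_on_imp_continuous_on[OF H(1)] sub]) (use z ab t in auto)
      then show ?thesis by (rule continuous_on_compose2) (use ab in \<open>auto intro!: continuous_intros simp: norm_mult\<close>)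
    qed
    define Iu where "Iu = integral {0..2*pi} (\<lambda>\<theta>. u (of_real a * cis \<theta>) * k (of_real a * cis \<theta>) * (of_real a * cis \<theta>))"
    define Iv where "Iv = integral {0..2*pi} (\<lambda>\<theta>. v (of_real a * cis \<theta>) * (of_real a * cis \<theta>))"
    have "Iu - Iv = integral {0..2*pi} (\<lambda>\<theta>. u (of_real a * cis \<theta>) * k (of_real a * cis \<theta>) * (of_real a * cis \<theta>) - v (of_real a * cis \<theta>) * (of_real a * cis \<theta>))"
      unfolding Iu_def Iv_def
      by (rule integral_diff[symmetric]) (rule integrable_continuous_interval[OF cont_uk], rule integrable_continuous_interval[OF cont_v])
    also have "cmod \<dots> \<le> integral {0..2*pi} (\<lambda>\<theta>. 1 / w * (C2 * (4 * \<sigma> / \<rho>\<^sup>2)))"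
    proof (rule integral_norm_bound_integral)
      show "(\<lambda>\<theta>. u (of_real a * cis \<theta>) * k (of_real a * cis \<theta>) * (of_real a * cis \<theta>) - v (of_real a * cis \<theta>) * (of_real a * cis \<theta>)) integrable_on {0..2*pi}"
        by (rule integrable_continuous_interval[OF continuous_on_diff[OF cont_uk cont_v]])
      fix \<theta>
      have z: "cmod (of_real a * cis \<theta>) = a" using ab by (simp add: norm_mult)
      have "u (of_real a * cis \<theta>) * k (of_real a * cis \<theta>) * (of_real a * cis \<theta>) - v (of_real a * cis \<theta>) * (of_real a * cis \<theta>)
         = (u (of_real a * cis \<theta>) * k (of_real a * cis \<theta>) - v (of_real a * cis \<theta>)) * (of_real a * cis \<theta>)"
        by (simp only: left_diff_distrib)
      then have "cmod (u (of_real a * cis \<theta>) * k (of_real a * cis \<theta>) * (of_real a * cis \<theta>) - v (of_real a * cis \<theta>) * (of_real a * cis \<theta>))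
         = cmod (u (of_real a * cis \<theta>) * k (of_real a * cis \<theta>) - v (of_real a * cis \<theta>)) * a"
        by (simp only: norm_mult[of _ "of_real a * cis \<theta>"] z)
      also have "\<dots> \<le> 1 / w * (C2 * (4 * \<sigma> / \<rho>\<^sup>2)) * 1"
        by (rule mult_mono[OF uv[OF z]]) (use ab w Cineq sig in auto)
      finally show "cmod (u (of_real a * cis \<theta>) * k (of_real a * cis \<theta>) * (of_real a * cis \<theta>) - v (of_real a * cis \<theta>) * (of_real a * cis \<theta>))
         \<le> 1 / w * (C2 * (4 * \<sigma> / \<rho>\<^sup>2))" by simp
    qed auto
    finally have B: "cmod (Iu - Iv) \<le> 2 * pi * (1 / w * (C2 * (4 * \<sigma> / \<rho>\<^sup>2)))" by (simp add: mult_ac)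
    have "contour_integral (circlepath 0 a) (\<lambda>\<zeta>. u \<zeta> / (\<zeta> - z)) = \<i> * Iu"
      unfolding contour_integral_circlepath_cis Iu_def k_def by simp
    then have "cmod (F z - u z) = cmod Iu / (2 * pi)"
      unfolding FR by (simp add: norm_divide norm_mult)
    also have "cmod Iu \<le> cmod Iv + cmod (Iu - Iv)" by (rule norm_triangle_sub)
    also have "\<dots> \<le> 1 / w * ((1 + C) * \<sigma>) * (2 * pi * (1 + 8 * C / (\<rho>/2))) + 2 * pi * (1 / w * (C2 * (4 * \<sigma> / \<rho>\<^sup>2)))"
      using V B unfolding Iv_def by linarith
    also have "\<dots> = 2 * pi * (16 * C * \<sigma> / \<rho>^3 * ((1 + C) * (\<rho>\<^sup>2 + 16 * C * \<rho>) + 4 * C2))"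
      using rho C by (simp add: w_def field_simps power2_eq_square power3_eq_cube)
    also have "\<dots> \<le> 2 * pi * (16 * C * \<sigma> / \<rho>^3 * ((1 + C) * (1 + 16 * C) + 4 * C2))"
    proof -
      have "\<rho>\<^sup>2 \<le> 1" "16 * C * \<rho> \<le> 16 * C" using rho C by (auto simp: power_le_one)
      then show ?thesis using rho C sig by (intro mult_left_mono add_mono) auto
    qed
    also have "\<dots> = 2 * pi * (C7 * \<mu>)"
    proof -
      have "\<mu> ^ Suc 6 = \<mu> * (\<mu>\<^sup>2) ^ 3" unfolding power_Suc power_mult[symmetric] by simp
      then have "\<sigma> = \<mu> * \<rho> ^ 3" by (simp add: \<sigma>_def \<rho>_def)
      then have "16 * C * \<sigma> / \<rho> ^ 3 = 16 * C * \<mu>" using rho by simp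
      then show ?thesis unfolding C7_def by (simp add: mult_ac)
    qed
    finally show ?thesis using pi_gt_zero by (simp add: divide_right_mono field_simps)
  qed
  have Fb: "cmod (F z) \<le> C2 + C7" if z: "cmod z = s" for z
  proof -
    have "C7 * \<mu> \<le> C7" using lam Cineq by (simp add: mult_left_le)
    moreover have "cmod (u z) \<le> C2" by (rule ub) (use z w in auto)
    ultimately show ?thesis using Fu[OF z] norm_triangle_sub[of "F z" "u z"] by linarith
  qed
  have ujs: "cmod (u z ^ j - G z) \<le> C * \<mu>" if z: "cmod z = s" for z
    using uj[OF inb, of z \<rho>] z w rho Gs[OF z] err_j by (force simp: \<rho>_def)
  have us: "cmod (u z) \<le> C2" if z: "cmod z = s" for z by (rule ub) (use z w in auto)
  \<comment> \<open>The outer contour has radius \<open>b > s\<close>, so \<open>F\<close> is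
    holomorphic across the circle of radius \<open>s\<close> and the maximum principle applies to
    the closed disc.\<close>
  have max: "cmod (f z) \<le> B" if "f holomorphic_on ball 0 b" "\<And>z. cmod z = s \<Longrightarrow> cmod (f z) \<le> B" "z \<in> ball 0 s" for f z B
  proof (rule maximum_modulus_frontier[of f "ball 0 s"])
    show "continuous_on (closure (ball 0 s)) f"
      by (rule continuous_on_subset[OF holomorphic_on_imp_continuous_on[OF that(1)]]) (use ab in auto)
  qed (use that ab in \<open>auto intro: holomorphic_on_subset\<close>)
  have "b \<le> 1" using s w by (auto simp: b_def)
  then have sub: "ball 0 b \<subseteq> ball (0::complex) 1" by auto
  show ?thesis
  proof (rule that[of F])
    show "F holomorphic_on ball 0 s" using holF by (rule holomorphic_on_subset) (use ab in auto)
    show "cmod (F z) \<le> C2 + C7" if "z \<in> ball 0 s" for z by (rule max[OF holF Fb that])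
    show "cmod (F z ^ j - G z) \<le> (real j * (C2 + C7) ^ (j-1) * C7 + C) * \<mu>" if "z \<in> ball 0 s" for z
    proof (rule max[OF _ _ that])
      show "(\<lambda>z. F z ^ j - G z) holomorphic_on ball 0 b"
        by (intro holomorphic_intros holF holomorphic_on_subset[OF G(1) sub])
      fix z :: complex assume z: "cmod z = s"
      have "cmod (F z ^ j - u z ^ j) \<le> real j * (C2 + C7) ^ (j-1) * cmod (F z - u z)"
        by (rule norm_power_diff_bound) (use Fb[OF z] us[OF z] Cineq in auto)
      also have "\<dots> \<le> real j * (C2 + C7) ^ (j-1) * (C7 * \<mu>)"
        by (rule mult_left_mono[OF Fu[OF z]]) (use Cineq in auto)
      finally show "cmod (F z ^ j - G z) \<le> (real j * (C2 + C7) ^ (j-1) * C7 + C) * \<mu>"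
        using ujs[OF z] norm_triangle_ineq[of "F z ^ j - u z ^ j" "u z ^ j - G z"] by (simp add: algebra_simps)
    qed
    show "cmod (F z ^ (j+1) - H z) \<le> (real (j+1) * (C2 + C7) ^ j * C7 + C2 * C) * \<mu>" if "z \<in> ball 0 s" for z
    proof (rule max[OF _ _ that])
      show "(\<lambda>z. F z ^ (j+1) - H z) holomorphic_on ball 0 b"
        by (intro holomorphic_intros holF holomorphic_on_subset[OF H(1) sub])
      fix z :: complex assume z: "cmod z = s"
      have G0: "G z \<noteq> 0" using Gs[OF z] lam by (auto simp: not_le)
      have "cmod (F z ^ (j+1) - u z ^ (j+1)) \<le> real (j+1) * (C2 + C7) ^ (j+1-1) * cmod (F z - u z)"
        by (rule norm_power_diff_bound) (use Fb[OF z] us[OF z] Cineq in auto)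
      also have "\<dots> \<le> real (j+1) * (C2 + C7) ^ (j+1-1) * (C7 * \<mu>)"
        by (rule mult_left_mono[OF Fu[OF z]]) (use Cineq in auto)
      finally have 1: "cmod (F z ^ (j+1) - u z ^ (j+1)) \<le> real (j+1) * (C2 + C7) ^ j * (C7 * \<mu>)" by simp
      have "u z ^ (j+1) - H z = u z * (u z ^ j - G z)" using G0 by (simp add: u_def field_simps)
      then have "cmod (u z ^ (j+1) - H z) \<le> C2 * (C * \<mu>)"
        by (simp only: norm_mult) (intro mult_mono us[OF z] ujs[OF z], use Cineq in auto)
      with 1 show "cmod (F z ^ (j+1) - H z) \<le> (real (j+1) * (C2 + C7) ^ j * C7 + C2 * C) * \<mu>"
        using norm_triangle_ineq[of "F z ^ (j+1) - u z ^ (j+1)" "u z ^ (j+1) - H z"] by (simp add: algebra_simps)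
    qed
  qed
qed

section \<open>Weight sequences\<close>

lemma root_at_top_imp_power_le:
  fixes m :: "nat \<Rightarrow> real"
  assumes pos: "\<And>k. m k > 0" and lim: "filterlim (\<lambda>k. root k (m k)) at_top sequentially" and B: "B > 0"
  obtains c where "c > 0" "\<And>k. B ^ k \<le> c * m k"
proof -
  obtain k0 where k0: "\<And>k. k \<ge> k0 \<Longrightarrow> B \<le> root k (m k)"
    using lim unfolding filterlim_at_top eventually_sequentially by blast
  define c where "c = 1 + (\<Sum>k\<le>k0. B ^ k / m k)"
  have nn: "0 \<le> B ^ k / m k" for k using B pos[of k] by simp
  show ?thesis
  proof (rule that[of c])
    show c: "c > 0" unfolding c_def by (intro add_pos_nonneg sum_nonneg nn) simp
    fix k
    show "B ^ k \<le> c * m k"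
    proof (cases "k \<le> k0")
      case True
      then have "B ^ k / m k \<le> (\<Sum>k\<le>k0. B ^ k / m k)" by (intro member_le_sum nn) auto
      then have "B ^ k / m k \<le> c" by (simp add: c_def)
      then show ?thesis using pos[of k] by (simp add: pos_divide_le_eq)
    next
      case False
      then have "B ^ k \<le> root k (m k) ^ k" using k0[of k] B by (intro power_mono) auto
      also have "\<dots> = m k" using False pos[of k] by simp
      also have "\<dots> \<le> c * m k"
        using pos[of k] sum_nonneg[of "{..k0}", OF nn] by (simp add: c_def algebra_simps)
      finally show ?thesis .
    qed
  qed
qed

text \<open>By leastness, all quotients \<open>m (Suc l) / m l\<close> before this index are below
  \<open>1 / \<tau>\<close>. As \<open>m\<close> is not assumed log-convex, nothing is claimed
  beyond it.\<close>

lemma Gamma_lower_decreasing: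
  fixes m :: "nat \<Rightarrow> real"
  assumes pos: "\<And>k. m k > 0" and lim: "filterlim (\<lambda>k. root k (m k)) at_top sequentially" and t: "\<tau> > 0"
    and ik: "i \<le> k" "k \<le> Gamma_lower m \<tau>"
  shows "m k * \<tau> ^ k \<le> m i * \<tau> ^ i"
proof -
  have step: "m (Suc l) * \<tau> ^ Suc l \<le> m l * \<tau> ^ l" if "l < Gamma_lower m \<tau>" for l
  proof -
    have "\<not> m (Suc l) / m l \<ge> 1 / \<tau>" using that not_less_Least unfolding Gamma_lower_def by blast
    then have "m (Suc l) * \<tau> \<le> m l" using pos[of l] t by (simp add: field_simps)
    then show ?thesis using t mult_right_mono[of "m (Suc l) * \<tau>" "m l" "\<tau> ^ l"] by (simp add: mult_ac)
  qed
  from ik show ?thesis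
  proof (induction rule: dec_induct)
    case (step n)
    then show ?case using \<open>\<And>l. l < Gamma_lower m \<tau> \<Longrightarrow> _\<close>[of n] by force
  qed simp
qed

text \<open>Comparison with the powers of \<open>2 / t\<close> shows that \<open>n k * t^k\<close>
  is at least \<open>n 0\<close> from some index on. Hence the infimum is a minimum over finitely
  many indices, and \<open>Gamma_upper\<close> is the first index that attains it.\<close>

lemma Gamma_upper_props:
  fixes n :: "nat \<Rightarrow> real"
  assumes pos: "\<And>k. n k > 0" and lim: "filterlim (\<lambda>k. root k (n k)) at_top sequentially" and t: "t > 0"
  shows "\<And>k. n (Gamma_upper n t) * t ^ Gamma_upper n t \<le> n k * t ^ k"
    and "\<And>k. k < Gamma_upper n t \<Longrightarrow> n (Gamma_upper n t) * t ^ Gamma_upper n t < n k * t ^ k"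
proof -
  obtain c where c: "c > 0" "\<And>k. (2 / t) ^ k \<le> c * n k"
    using root_at_top_imp_power_le[OF pos lim, of "2/t"] t by auto
  obtain K where K: "2 ^ K > c * n 0" using real_arch_pow[of 2 "c * n 0"] by auto
  have big: "n 0 * t ^ 0 \<le> n k * t ^ k" if "k \<ge> K" for k
  proof -
    have "c * n 0 \<le> 2 ^ k" using K power_increasing[OF that, of "2::real"] by linarith
    also have "\<dots> = (2 / t) ^ k * t ^ k" using t by (simp add: power_divide)
    also have "\<dots> \<le> c * n k * t ^ k" using c(2)[of k] t by (intro mult_right_mono) auto
    finally show ?thesis using c(1) by (simp add: mult.assoc)
  qed
  define f where "f k = n k * t ^ k" for k
  obtain q where q: "q \<le> K" "f q = Min (f ` {..K})"
    using Min_in[of "f ` {..K}"] by fastforce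
  have q_min: "f q \<le> f k" for k
  proof (cases "k \<le> K")
    case True then show ?thesis unfolding q(2) by (intro Min_le) auto
  next
    case False
    then have "f 0 \<le> f k" using big[of k] by (simp add: f_def)
    moreover have "f q \<le> f 0" unfolding q(2) by (intro Min_le) auto
    ultimately show ?thesis by linarith
  qed
  have "h_fun n t = f q"
    unfolding h_fun_def f_def[symmetric]
    by (rule antisym) (use q_min in \<open>auto intro!: cINF_lower cINF_greatest bdd_belowI[of _ "f q"]\<close>)
  then have "\<exists>k. h_fun n t = n k * t ^ k" by (auto simp: f_def)
  from LeastI_ex[OF this] have L: "h_fun n t = f (Gamma_upper n t)"
    unfolding Gamma_upper_def f_def .
  show 1: "n (Gamma_upper n t) * t ^ Gamma_upper n t \<le> n k * t ^ k" for k
    using q_min[of k] L \<open>h_fun n t = f q\<close> by (simp add: f_def)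
  show "n (Gamma_upper n t) * t ^ Gamma_upper n t < n k * t ^ k" if "k < Gamma_upper n t" for k
  proof -
    have "h_fun n t \<noteq> n k * t ^ k" using that not_less_Least unfolding Gamma_upper_def by blast
    with 1[of k] L show ?thesis by (simp add: f_def)
  qed
qed

lemma Gamma_upper_eqI:
  fixes n :: "nat \<Rightarrow> real"
  assumes pos: "\<And>k. n k > 0" and lim: "filterlim (\<lambda>k. root k (n k)) at_top sequentially" and t: "t > 0"
    and q: "\<And>k. n q * t ^ q \<le> n k * t ^ k" "\<And>k. k < q \<Longrightarrow> n q * t ^ q < n k * t ^ k"
  shows "Gamma_upper n t = q"
proof (rule linorder_cases)
  assume "Gamma_upper n t < q"
  then show ?thesis using q(2)[of "Gamma_upper n t"] Gamma_upper_props(1)[OF pos lim t, of q] by simp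
next
  assume "q < Gamma_upper n t"
  then show ?thesis using Gamma_upper_props(2)[OF pos lim t, of q] q(1)[of "Gamma_upper n t"] by simp
qed

text \<open>The regularity condition on \<open>Gamma_upper\<close> and \<open>Gamma_lower\<close> contains the comparison
  \<open>m \<le> C\<^bsup>q\<^esup> n\<close> at all indices \<open>q\<close> where the log-convex minorant of \<open>n\<close> touches \<open>n\<close>.\<close>

lemma Gamma_condition_imp_le:
  fixes m n :: "nat \<Rightarrow> real"
  assumes m: "\<And>k. m k > 0" "filterlim (\<lambda>k. root k (m k)) at_top sequentially"
    and n: "\<And>k. n k > 0" "filterlim (\<lambda>k. root k (n k)) at_top sequentially"
    and 0: "m 0 = n 0" and C: "C > 0"
    and G: "\<And>t. t > 0 \<Longrightarrow> Gamma_upper n (C * t) \<le> Gamma_lower m t"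
    and t: "t > 0"
  shows "m (Gamma_upper n t) \<le> C ^ Gamma_upper n t * n (Gamma_upper n t)"
  using t
proof (induction "Gamma_upper n t" arbitrary: t rule: less_induct)
  case less
  define q where "q = Gamma_upper n t"
  note U = Gamma_upper_props[OF n less.prems, folded q_def]
  show ?case
  proof (cases "q = 0")
    case True
    then show ?thesis using 0 by (simp flip: q_def)
  next
    case False
    \<comment> \<open>\<open>g i\<close> is the parameter at which the index \<open>i\<close> ties
      with \<open>q\<close>, and \<open>s\<close> is the smallest of these. Strictly between
      \<open>t\<close> and \<open>s\<close> the first minimiser is still \<open>q\<close>. At
      \<open>s\<close> it drops to a smaller index \<open>i\<close>, to which the induction
      hypothesis applies.\<close>
    define g where "g i = root (q - i) (n i / n q)" for i
    have g_pow: "g i ^ (q - i) = n i / n q" and g_pos: "g i > 0" if "i < q" for i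
      using that n(1)[of i] n(1)[of q] by (auto simp: g_def)
    define s where "s = Min (g ` {..<q})"
    have "s \<in> g ` {..<q}" unfolding s_def using False by (intro Min_in) auto
    then obtain i0 where i0: "i0 < q" "s = g i0" by auto
    have s0: "s > 0" using i0 g_pos by simp
    have le: "n q * x ^ q \<le> n i * x ^ i \<longleftrightarrow> x ^ (q - i) \<le> n i / n q" if "i < q" "x > 0" for i x
    proof -
      have "x ^ q = x ^ (q - i) * x ^ i" using that by (simp flip: power_add)
      then have "n q * x ^ q \<le> n i * x ^ i \<longleftrightarrow> (n q * x ^ (q - i)) * x ^ i \<le> n i * x ^ i" by (simp add: mult_ac)
      also have "\<dots> \<longleftrightarrow> n q * x ^ (q - i) \<le> n i" using that by simp
      finally show ?thesis using n(1)[of q] by (simp add: field_simps)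
    qed
    have less: "n q * x ^ q < n i * x ^ i \<longleftrightarrow> x ^ (q - i) < n i / n q" if "i < q" "x > 0" for i x
    proof -
      have "x ^ q = x ^ (q - i) * x ^ i" using that by (simp flip: power_add)
      then have "n q * x ^ q < n i * x ^ i \<longleftrightarrow> (n q * x ^ (q - i)) * x ^ i < n i * x ^ i" by (simp add: mult_ac)
      also have "\<dots> \<longleftrightarrow> n q * x ^ (q - i) < n i" using that by simp
      finally show ?thesis using n(1)[of q] by (simp add: field_simps)
    qed
    have "t ^ (q - i0) < s ^ (q - i0)"
      using U(2)[OF i0(1)] less[OF i0(1) less.prems] g_pow[OF i0(1)] i0(2) by simp
    then have ts: "t < s" by (rule power_less_imp_less_base) (use s0 in simp)
    have s_le: "s ^ (q - i) \<le> n i / n q" if "i < q" for i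
    proof -
      have "s \<le> g i" unfolding s_def using that by (intro Min_le) auto
      then show ?thesis using g_pow[OF that] power_mono[of s "g i" "q - i"] s0 by simp
    qed
    have above: "n q * x ^ q \<le> n k * x ^ k" if "k \<ge> q" "x \<ge> t" for k x
    proof -
      have "n q * t ^ q \<le> n k * (t ^ (k - q) * t ^ q)" using U(1)[of k] that(1) by (simp flip: power_add)
      then have "n q \<le> n k * t ^ (k - q)" using \<open>t > 0\<close> by (simp flip: mult.assoc)
      also have "\<dots> \<le> n k * x ^ (k - q)" using n(1)[of k] that \<open>t > 0\<close> by (intro mult_left_mono power_mono) auto
      finally have "n q * x ^ q \<le> n k * x ^ (k - q) * x ^ q" using that \<open>t > 0\<close> by (intro mult_right_mono) auto
      then show ?thesis using that by (simp add: mult.assoc flip: power_add)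
    qed
    have q_min: "n q * s ^ q \<le> n k * s ^ k" for k
      using above[of k s] le[of k s] s_le[of k] s0 ts by (cases "k < q") auto
    define i where "i = Gamma_upper n s"
    have i_eq: "n i * s ^ i \<le> n q * s ^ q"
      unfolding i_def by (rule Gamma_upper_props(1)[OF n s0])
    have "n q * s ^ q = n i0 * s ^ i0"
    proof -
      have "s ^ q = s ^ (q - i0) * s ^ i0" using i0 by (simp flip: power_add)
      then show ?thesis using g_pow[OF i0(1)] i0(2) n(1)[of q] by simp
    qed
    then have "i \<le> i0"
      using Gamma_upper_props(2)[OF n s0, of i0] i_eq Gamma_upper_props(1)[OF n s0, of i0] q_min[of i]
      unfolding i_def by (metis less_irrefl not_le_imp_less order_less_le_trans)
    then have iq: "i < q" using i0 by simp
    have ev: "m q * (x / C) ^ q \<le> m i * (x / C) ^ i" if x: "t < x" "x < s" for x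
    proof -
      have x0: "x > 0" using x less.prems by simp
      have "Gamma_upper n x = q"
      proof (rule Gamma_upper_eqI[OF n x0])
        fix k
        have lt: "n q * x ^ q < n k * x ^ k" if "k < q"
          using less[OF that x0] s_le[OF that] power_strict_mono[of x s "q - k"] x x0 that by simp
        then show "k < q \<Longrightarrow> n q * x ^ q < n k * x ^ k" .
        show "n q * x ^ q \<le> n k * x ^ k" using lt above[of k x] x by (cases "k < q") auto
      qed
      then have "q \<le> Gamma_lower m (x / C)" using G[of "x / C"] x0 C by simp
      then show ?thesis using Gamma_lower_decreasing[OF m, of "x / C" i q] x0 C iq by simp
    qed
    \<comment> \<open>The condition \<open>G\<close> at the parameter \<open>s\<close> only reaches
      the index \<open>i\<close>. The comparison of \<open>m q\<close> with \<open>m i\<close> is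
      therefore made for \<open>x < s\<close> and carried over by a limit from the left.\<close>
    have "m q * (s / C) ^ q \<le> m i * (s / C) ^ i"
    proof (rule tendsto_le)
      show "((\<lambda>x. m i * (x / C) ^ i) \<longlongrightarrow> m i * (s / C) ^ i) (at_left s)"
        using C by (intro tendsto_intros) auto
      show "((\<lambda>x. m q * (x / C) ^ q) \<longlongrightarrow> m q * (s / C) ^ q) (at_left s)"
        using C by (intro tendsto_intros) auto
      show "\<forall>\<^sub>F x in at_left s. m q * (x / C) ^ q \<le> m i * (x / C) ^ i"
        using eventually_at_left[OF ts] ev ts by blast
    qed simp
    also have "\<dots> \<le> C ^ i * n i * (s / C) ^ i"
      using less.hyps[of s] iq s0 C by (intro mult_right_mono) (auto simp: q_def i_def)
    also have "\<dots> = n i * s ^ i" using C by (simp add: power_divide)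
    also have "\<dots> \<le> n q * s ^ q" by (rule i_eq)
    finally have "m q * s ^ q \<le> C ^ q * n q * s ^ q" using C by (simp add: power_divide field_simps)
    then show ?thesis using s0 by (simp flip: q_def)
  qed
qed

text \<open>The comparison passes through the index \<open>q\<close> that minimises
  \<open>n k * (C t)^k\<close>. Since \<open>q\<close> does not exceed
  \<open>Gamma_lower m t\<close>, monotonicity bounds the left side by \<open>m q * t^q\<close>.
  There \<open>m q \<le> C^q * n q\<close>, and the minimality of \<open>q\<close> gives every
  \<open>k\<close>. In effect the Taylor remainder of the best order is at most
  \<open>h_fun n (C t)\<close>.\<close>

lemma Gamma_condition_h_bound:
  fixes m n :: "nat \<Rightarrow> real"
  assumes m: "\<And>k. m k > 0" "filterlim (\<lambda>k. root k (m k)) at_top sequentially"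
    and n: "\<And>k. n k > 0" "filterlim (\<lambda>k. root k (n k)) at_top sequentially"
    and 0: "m 0 = n 0" and C: "C > 0"
    and G: "\<And>t. t > 0 \<Longrightarrow> Gamma_upper n (C * t) \<le> Gamma_lower m t"
    and t: "t > 0"
  shows "m (Gamma_lower m t) * t ^ Gamma_lower m t \<le> n k * (C * t) ^ k"
proof -
  define q where "q = Gamma_upper n (C * t)"
  have Ct: "C * t > 0" using C t by simp
  have "m (Gamma_lower m t) * t ^ Gamma_lower m t \<le> m q * t ^ q"
    unfolding q_def by (rule Gamma_lower_decreasing[OF m t G[OF t]]) simp
  also have "\<dots> \<le> C ^ q * n q * t ^ q"
    unfolding q_def by (rule mult_right_mono[OF Gamma_condition_imp_le[OF m n 0 C G Ct]]) (use t in simp_all)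
  also have "\<dots> = n q * (C * t) ^ q" by (simp add: power_mult_distrib)
  also have "\<dots> \<le> n k * (C * t) ^ k" unfolding q_def by (rule Gamma_upper_props(1)[OF n Ct])
  finally show ?thesis .
qed

text \<open>Moderate growth survives the division by factorials because
  \<open>j! k! \<le> (j+k)!\<close>. The pair of zero indices is excluded from the supremum and is
  covered by the normalisation at 0.\<close>

lemma mg_finite_imp_reduced_le:
  assumes M: "weight_sequence M" and N: "weight_sequence N" and mg: "mg M N < \<infinity>"
  obtains C where "C \<ge> 1" "\<And>j k. reduced M (j + k) \<le> C ^ (j + k) * (reduced N j * reduced N k)"
proof -
  have pos: "M k > 0" "N k > 0" and 0: "M 0 = 1" "N 0 = 1" for k
    using M N by (auto simp: weight_sequence_def)
  obtain c where c: "mg M N = ennreal c" "c \<ge> 0" using mg by (cases "mg M N") auto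
  define C where "C = max 1 c"
  have le: "M (j + k) \<le> C ^ (j + k) * (N j * N k)" for j k
  proof (cases "j + k \<ge> 1")
    case True
    have "ennreal (root (j + k) (M (j + k) / (N j * N k))) \<le> mg M N"
      unfolding mg_def by (rule SUP_upper2[of "(j, k)"]) (use True in auto)
    then have "root (j + k) (M (j + k) / (N j * N k)) \<le> C" using c by (simp add: C_def)
    then have "root (j + k) (M (j + k) / (N j * N k)) ^ (j + k) \<le> C ^ (j + k)"
      by (rule power_mono) (intro real_root_ge_zero divide_nonneg_nonneg mult_nonneg_nonneg less_imp_le pos)
    moreover have "root (j + k) (M (j + k) / (N j * N k)) ^ (j + k) = M (j + k) / (N j * N k)"
      using True pos by (intro real_root_pow_pos) auto
    ultimately have "M (j + k) / (N j * N k) \<le> C ^ (j + k)" by simp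
    then show ?thesis using pos by (simp add: pos_divide_le_eq)
  next
    case False
    then have "j = 0" "k = 0" by auto
    then show ?thesis using 0 by simp
  qed
  show ?thesis
  proof (rule that[of C])
    show "C \<ge> 1" by (simp add: C_def)
    fix j k
    have "fact j * fact k \<le> (fact (j + k) :: nat)" by (intro dvd_imp_le fact_fact_dvd_fact) simp
    then have f: "fact j * fact k \<le> (fact (j + k) :: real)" by (metis of_nat_fact of_nat_le_iff of_nat_mult)
    have "reduced M (j + k) \<le> C ^ (j + k) * (N j * N k) / fact (j + k)"
      unfolding reduced_def by (intro divide_right_mono le) simp
    also have "\<dots> \<le> C ^ (j + k) * (N j * N k) / (fact j * fact k)"
      using f pos \<open>C \<ge> 1\<close> by (intro divide_left_mono) (auto simp: less_imp_le)
    finally show "reduced M (j + k) \<le> C ^ (j + k) * (reduced N j * reduced N k)"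
      by (simp add: reduced_def)
  qed
qed

text \<open>The index is split into two equal halves. One use of moderate growth thus trades a
  doubling of the index for a squaring of the bound, and only the base of the geometric factor
  grows.\<close>

lemma reduced_doubling:
  assumes M: "weight_sequence M" and N: "weight_sequence N" and mg: "mg M N < \<infinity>"
    and C: "C \<ge> 1" "\<And>k. reduced N (2 ^ i * k) \<le> (C ^ k * l k) ^ 2 ^ i"
  shows "\<exists>C\<ge>1. \<forall>k. reduced M (2 ^ Suc i * k) \<le> (C ^ k * l k) ^ 2 ^ Suc i"
proof -
  obtain D where D: "D \<ge> 1" "\<And>j k. reduced M (j + k) \<le> D ^ (j + k) * (reduced N j * reduced N k)"
    using mg_finite_imp_reduced_le[OF M N mg] by blast
  have pos: "reduced N k > 0" for k using N by (simp add: weight_sequence_def reduced_def)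
  show ?thesis
  proof (intro exI[of _ "D * C"] conjI allI)
    show "D * C \<ge> 1" using C D mult_mono[of 1 D 1 C] by simp
    fix k
    define X where "X = C ^ k * l k"
    have "reduced M (2 ^ Suc i * k) = reduced M (2 ^ i * k + 2 ^ i * k)" by (simp add: mult_2 add_mult_distrib)
    also have "\<dots> \<le> D ^ (2 ^ i * k + 2 ^ i * k) * (reduced N (2 ^ i * k) * reduced N (2 ^ i * k))" by (rule D)
    also have "\<dots> \<le> D ^ (2 ^ i * k + 2 ^ i * k) * (X ^ 2 ^ i * X ^ 2 ^ i)"
      using D C(2)[of k] pos[of "2 ^ i * k"] unfolding X_def by (intro mult_left_mono mult_mono) auto
    also have "\<dots> = (D ^ k * X) ^ 2 ^ Suc i"
      by (simp add: power_mult_distrib mult_2 power_add mult.commute flip: power_mult)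
    finally show "reduced M (2 ^ Suc i * k) \<le> ((D * C) ^ k * l k) ^ 2 ^ Suc i"
      by (simp add: X_def power_mult_distrib mult_ac)
  qed
qed

text \<open>The remainder bound is read at the index \<open>2^i * k\<close>, and \<open>i\<close>
  uses of moderate growth turn this multiple into an exponent. So a root of fixed order of the
  remainder is still controlled by a sequence of the matrix. The regularity condition is applied
  first, and then the sequence changes once per doubling.\<close>

lemma R_admissible_h_bound:
  assumes R: "R_admissible \<MM>" and M: "M \<in> \<MM>"
  shows "\<exists>L\<in>\<MM>. \<exists>C\<ge>1. \<forall>t>0. \<forall>k. reduced M (Gamma_lower (reduced M) t) * t ^ Gamma_lower (reduced M) t
    \<le> (reduced L k * (C * t) ^ k) ^ 2 ^ i"
proof -
  have ws: "weight_sequence N" if "N \<in> \<MM>" for N using R that by (auto simp: R_admissible_def weight_matrix_def)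
  have lim: "filterlim (\<lambda>k. root k (reduced N k)) at_top sequentially" if "N \<in> \<MM>" for N
    using R that by (auto simp: R_admissible_def)
  have pos: "reduced N k > 0" and 0: "reduced N 0 = 1" if "N \<in> \<MM>" for N k
    using ws[OF that] by (auto simp: reduced_def weight_sequence_def)
  obtain N C where N: "N \<in> \<MM>" "C \<ge> 1" "\<And>t. t > 0 \<Longrightarrow> Gamma_upper (reduced N) (C * t) \<le> Gamma_lower (reduced M) t"
    using R M unfolding R_admissible_def by meson
  have "\<exists>L\<in>\<MM>. \<exists>C\<ge>1. \<forall>k. reduced N (2 ^ i * k) \<le> (C ^ k * reduced L k) ^ 2 ^ i" if "N \<in> \<MM>" for N
    using that
  proof (induction i arbitrary: N)
    case 0
    then show ?case by (intro bexI[of _ N] exI[of _ 1]) auto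
  next
    case (Suc i)
    obtain N' where N': "N' \<in> \<MM>" "mg N N' < \<infinity>" using R Suc.prems unfolding R_admissible_def by meson
    from Suc.IH[OF N'(1)] reduced_doubling[OF ws[OF Suc.prems] ws[OF N'(1)] N'(2)] show ?case by meson
  qed
  from this[OF N(1)] obtain L D where L: "L \<in> \<MM>" "D \<ge> 1" "\<And>k. reduced N (2 ^ i * k) \<le> (D ^ k * reduced L k) ^ 2 ^ i"
    by auto
  show ?thesis
  proof (intro bexI[OF _ L(1)] exI[of _ "D * C"] conjI allI impI)
    show "D * C \<ge> 1" using L N mult_mono[of 1 D 1 C] by simp
    fix t :: real and k assume t: "t > 0"
    have "reduced M (Gamma_lower (reduced M) t) * t ^ Gamma_lower (reduced M) t \<le> reduced N (2 ^ i * k) * (C * t) ^ (2 ^ i * k)"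
      by (rule Gamma_condition_h_bound[OF pos[OF M] lim[OF M] pos[OF N(1)] lim[OF N(1)] _ _ N(3) t]) (use 0 M N in auto)
    also have "\<dots> \<le> (D ^ k * reduced L k) ^ 2 ^ i * (C * t) ^ (2 ^ i * k)"
      using N t by (intro mult_right_mono L) auto
    also have "\<dots> = (reduced L k * (D * C * t) ^ k) ^ 2 ^ i"
      by (simp add: power_mult_distrib mult_ac flip: power_mult)
    finally show "reduced M (Gamma_lower (reduced M) t) * t ^ Gamma_lower (reduced M) t \<le> (reduced L k * (D * C * t) ^ k) ^ 2 ^ i" .
  qed
qed

text \<open>The choices run in the opposite direction: \<open>L\<close> is prescribed, the doublings
  lead from \<open>L\<close> to \<open>N\<close>, and the regularity condition produces
  \<open>M\<close> last.\<close>

lemma B_admissible_h_bound: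
  assumes B: "B_admissible \<MM>" and L: "L \<in> \<MM>"
  shows "\<exists>M\<in>\<MM>. \<exists>C\<ge>1. \<forall>t>0. \<forall>k. reduced M (Gamma_lower (reduced M) t) * t ^ Gamma_lower (reduced M) t
    \<le> (reduced L k * (C * t) ^ k) ^ 2 ^ i"
proof -
  have ws: "weight_sequence N" if "N \<in> \<MM>" for N using B that by (auto simp: B_admissible_def weight_matrix_def)
  have lim: "filterlim (\<lambda>k. root k (reduced N k)) at_top sequentially" if "N \<in> \<MM>" for N
    using B that by (auto simp: B_admissible_def)
  have pos: "reduced N k > 0" and 0: "reduced N 0 = 1" if "N \<in> \<MM>" for N k
    using ws[OF that] by (auto simp: reduced_def weight_sequence_def)
  have "\<exists>N\<in>\<MM>. \<exists>C\<ge>1. \<forall>k. reduced N (2 ^ i * k) \<le> (C ^ k * reduced L k) ^ 2 ^ i"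
  proof (induction i)
    case 0
    then show ?case using L by (intro bexI[of _ L] exI[of _ 1]) auto
  next
    case (Suc i)
    then obtain N' C where N': "N' \<in> \<MM>" "C \<ge> 1" "\<And>k. reduced N' (2 ^ i * k) \<le> (C ^ k * reduced L k) ^ 2 ^ i" by auto
    obtain N where N: "N \<in> \<MM>" "mg N N' < \<infinity>" using B N'(1) unfolding B_admissible_def by meson
    from reduced_doubling[OF ws[OF N(1)] ws[OF N'(1)] N(2) N'(2,3)] N(1) show ?case by meson
  qed
  then obtain N D where N: "N \<in> \<MM>" "D \<ge> 1" "\<And>k. reduced N (2 ^ i * k) \<le> (D ^ k * reduced L k) ^ 2 ^ i"
    by auto
  obtain M C where M: "M \<in> \<MM>" "C \<ge> 1" "\<And>t. t > 0 \<Longrightarrow> Gamma_upper (reduced N) (C * t) \<le> Gamma_lower (reduced M) t"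
    using B N(1) unfolding B_admissible_def by meson
  show ?thesis
  proof (intro bexI[OF _ M(1)] exI[of _ "D * C"] conjI allI impI)
    show "D * C \<ge> 1" using M N mult_mono[of 1 D 1 C] by simp
    fix t :: real and k assume t: "t > 0"
    have "reduced M (Gamma_lower (reduced M) t) * t ^ Gamma_lower (reduced M) t \<le> reduced N (2 ^ i * k) * (C * t) ^ (2 ^ i * k)"
      by (rule Gamma_condition_h_bound[OF pos[OF M(1)] lim[OF M(1)] pos[OF N(1)] lim[OF N(1)] _ _ M(3) t]) (use 0 M N in auto)
    also have "\<dots> \<le> (D ^ k * reduced L k) ^ 2 ^ i * (C * t) ^ (2 ^ i * k)"
      using M t by (intro mult_right_mono N) auto
    also have "\<dots> = (reduced L k * (D * C * t) ^ k) ^ 2 ^ i"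
      by (simp add: power_mult_distrib mult_ac flip: power_mult)
    finally show "reduced M (Gamma_lower (reduced M) t) * t ^ Gamma_lower (reduced M) t \<le> (reduced L k * (D * C * t) ^ k) ^ 2 ^ i" .
  qed
qed

section \<open>Approximation along a line\<close>

lemma poly_holomorphic_on: "poly p holomorphic_on S"
  unfolding holomorphic_on_def field_differentiable_def
  by (intro ballI exI) (rule has_field_derivative_at_within[OF poly_DERIV])

text \<open>A dichotomy. If \<open>|G|\<close> reaches \<open>2 \<mu>\<close> somewhere in the unit
  disc, a good circle exists and the quotient construction applies. Otherwise \<open>G\<close> is of
  order \<open>\<mu>\<close>, the relation between \<open>G\<close> and \<open>H\<close> forces
  \<open>H\<close> to be of order \<open>\<mu>\<close> too, and the zero function is an approximate
  root. The constant depends only on \<open>j\<close> and \<open>C\<close>, not on the degree, which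
  enters only through \<open>84^p * \<mu> \<le> 1\<close>.\<close>

lemma quasi_root_poly:
  assumes j: "j > 0" and C: "C \<ge> 1"
  obtains C' where "C' \<ge> 1"
    "\<And>G H \<mu> p. degree G \<le> p \<Longrightarrow> 0 < \<mu> \<Longrightarrow> 84 ^ p * \<mu> \<le> 1 \<Longrightarrow>
      (\<And>z. z \<in> ball 0 1 \<Longrightarrow> cmod (poly G z) \<le> C) \<Longrightarrow> (\<And>z. z \<in> ball 0 1 \<Longrightarrow> cmod (poly H z) \<le> C) \<Longrightarrow>
      (\<And>z. z \<in> ball 0 1 \<Longrightarrow> cmod (poly G z ^ (j+1) - poly H z ^ j) \<le> C * \<mu> ^ (7 * j * (j+1))) \<Longrightarrow>
      \<exists>F. F holomorphic_on ball 0 (1/2) \<and> (\<forall>z\<in>ball 0 (1/2). cmod (F z) \<le> C' \<and>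
        cmod (F z ^ j - poly G z) \<le> C' * \<mu> \<and> cmod (F z ^ (j+1) - poly H z) \<le> C' * \<mu>)"
proof -
  define C2 where "C2 = 1 + C + C * 2 ^ j"
  define C7 where "C7 = 16 * C * ((1 + C) * (1 + 16 * C) + 4 * C2)"
  define Ca where "Ca = real j * (C2 + C7) ^ (j-1) * C7 + C"
  define Cb where "Cb = real (j+1) * (C2 + C7) ^ j * C7 + C2 * C"
  define C' where "C' = C2 + C7 + Ca + Cb + 2 + (2 ^ (j+1) + C)"
  have nn: "C2 \<ge> 0" "C7 \<ge> 0" "Ca \<ge> 0" "Cb \<ge> 0" using C by (auto simp: C2_def C7_def Ca_def Cb_def)
  have ge: "C2 + C7 \<le> C'" "Ca \<le> C'" "Cb \<le> C'" "2 \<le> C'" "2 ^ (j+1) + C \<le> C'"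
    using nn C by (auto simp: C'_def add_nonneg_nonneg)
  show ?thesis
  proof (rule that[of C'])
    show "C' \<ge> 1" using ge by linarith
    fix G H :: "complex poly" and \<mu> :: real and p
    assume deg: "degree G \<le> p" and mu: "0 < \<mu>" "84 ^ p * \<mu> \<le> 1"
      and G: "\<And>z. z \<in> ball 0 1 \<Longrightarrow> cmod (poly G z) \<le> C" and H: "\<And>z. z \<in> ball 0 1 \<Longrightarrow> cmod (poly H z) \<le> C"
      and GH: "\<And>z. z \<in> ball 0 1 \<Longrightarrow> cmod (poly G z ^ (j+1) - poly H z ^ j) \<le> C * \<mu> ^ (7 * j * (j+1))"
    have mu1: "\<mu> \<le> 1"
    proof -
      have "1 * \<mu> \<le> 84 ^ p * \<mu>" using mu by (intro mult_right_mono) auto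
      then show ?thesis using mu by linarith
    qed
    show "\<exists>F. F holomorphic_on ball 0 (1/2) \<and> (\<forall>z\<in>ball 0 (1/2). cmod (F z) \<le> C' \<and>
        cmod (F z ^ j - poly G z) \<le> C' * \<mu> \<and> cmod (F z ^ (j+1) - poly H z) \<le> C' * \<mu>)"
    proof (cases "\<exists>w. cmod w \<le> 1 \<and> 2 * \<mu> \<le> cmod (poly G w)")
      case True
      then obtain w where w: "cmod w \<le> 1" "2 * \<mu> \<le> cmod (poly G w)" by auto
      obtain s where s: "s \<in> {1/2..3/4}" "\<And>z. cmod z = s \<Longrightarrow> cmod (poly G w) \<le> 2 * 84 ^ p * cmod (poly G z)"
        using poly_good_circle[OF deg w(1)] by blast
      \<comment> \<open>The loss \<open>84^p\<close> of the good circle is paid with one factor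
        \<open>\<mu>\<close>, which turns the lower bound \<open>\<mu> / 84^p\<close> into
        \<open>\<mu>^2\<close>.\<close>
      have low: "\<mu>\<^sup>2 \<le> cmod (poly G z)" if "cmod z = s" for z
      proof -
        have "\<mu> \<le> 84 ^ p * cmod (poly G z)" using s(2)[OF that] w(2) by simp
        then have "\<mu> * \<mu> \<le> \<mu> * (84 ^ p * cmod (poly G z))" using mu by (intro mult_left_mono) auto
        also have "\<dots> = (84 ^ p * \<mu>) * cmod (poly G z)" by (simp add: mult_ac)
        also have "\<dots> \<le> 1 * cmod (poly G z)" using mu by (intro mult_right_mono) auto
        finally show ?thesis by (simp add: power2_eq_square)
      qed
      obtain F where F: "F holomorphic_on ball 0 s"
        "\<And>z. z \<in> ball 0 s \<Longrightarrow> cmod (F z) \<le> C2 + C7"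
        "\<And>z. z \<in> ball 0 s \<Longrightarrow> cmod (F z ^ j - poly G z) \<le> Ca * \<mu>"
        "\<And>z. z \<in> ball 0 s \<Longrightarrow> cmod (F z ^ (j+1) - poly H z) \<le> Cb * \<mu>"
        using quasi_root_circle[OF j C mu(1) mu1 poly_holomorphic_on G poly_holomorphic_on H GH s(1) low, folded C2_def, folded C7_def, folded Ca_def Cb_def]
        by blast
      have sub: "z \<in> ball 0 s" if "z \<in> ball 0 (1/2)" for z :: complex using that s by auto
      show ?thesis
      proof (intro exI[of _ F] conjI ballI)
        show "F holomorphic_on ball 0 (1/2)" by (rule holomorphic_on_subset[OF F(1)]) (use sub in blast)
        fix z :: complex assume "z \<in> ball 0 (1/2)"
        note F = F(2-)[OF sub[OF this]]
        show "cmod (F z) \<le> C'" using F(1) ge by linarith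
        show "cmod (F z ^ j - poly G z) \<le> C' * \<mu>" using F(2) mult_right_mono[OF ge(2), of \<mu>] mu by linarith
        show "cmod (F z ^ (j+1) - poly H z) \<le> C' * \<mu>" using F(3) mult_right_mono[OF ge(3), of \<mu>] mu by linarith
      qed
    next
      case False
      then have G2: "cmod (poly G z) \<le> 2 * \<mu>" if "cmod z \<le> 1" for z using that by force
      have H2: "cmod (poly H z) \<le> C' * \<mu>" if z: "z \<in> ball 0 1" for z
      proof -
        have "cmod (poly H z ^ j) \<le> cmod (poly G z ^ (j+1)) + cmod (poly G z ^ (j+1) - poly H z ^ j)"
          using norm_triangle_ineq4[of "poly G z ^ (j+1)" "poly G z ^ (j+1) - poly H z ^ j"] by simp
        also have "\<dots> \<le> (2 * \<mu>) ^ (j+1) + C * \<mu> ^ (7 * j * (j+1))"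
          unfolding norm_power[of _ "j+1"] by (intro add_mono power_mono G2 GH z) (use z in auto)
        also have "\<dots> \<le> 2 ^ (j+1) * \<mu> ^ j + C * \<mu> ^ j"
          unfolding power_mult_distrib
        proof (intro add_mono mult_left_mono power_decreasing)
          have "j \<le> 7 * j" by simp
          also have "\<dots> \<le> 7 * j * (j+1)" by simp
          finally show "j \<le> 7 * j * (j+1)" .
        qed (use mu mu1 C in auto)
        finally have "cmod (poly H z / of_real \<mu>) ^ j \<le> 2 ^ (j+1) + C"
          using mu by (simp add: norm_divide norm_power power_divide field_simps)
        then have "cmod (poly H z / of_real \<mu>) \<le> 2 ^ (j+1) + C"
          by (rule norm_le_of_power_le) (use C j in \<open>auto simp: add_increasing\<close>)
        then have "cmod (poly H z / of_real \<mu>) \<le> C'" using ge by linarith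
        then show ?thesis using mu by (simp add: norm_divide pos_divide_le_eq)
      qed
      show ?thesis
      proof (intro exI[of _ "\<lambda>_. 0"] conjI ballI)
        fix z :: complex assume z: "z \<in> ball 0 (1/2)"
        have "2 * \<mu> \<le> C' * \<mu>" using ge mu by (intro mult_right_mono) auto
        then show "cmod (0 ^ j - poly G z) \<le> C' * \<mu>" using G2[of z] z j by (auto simp: power_0_left)
        show "cmod (0 ^ (j+1) - poly H z) \<le> C' * \<mu>" using H2[of z] z by auto
        show "cmod 0 \<le> C'" using ge by simp
      qed auto
    qed
  qed
qed

text \<open>Vector-valued functions have no Lagrange form of the remainder. Instead, the derivative
  of the remainder is the remainder of the shifted family, and the mean value inequality integrates
  the inductive bound.\<close>

lemma Taylor_remainder_pos:
  fixes g :: "nat \<Rightarrow> real \<Rightarrow> 'a::real_normed_vector"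
  assumes "\<And>k s. 0 \<le> s \<Longrightarrow> s \<le> e \<Longrightarrow> (g k has_vector_derivative g (Suc k) s) (at s)"
    and "\<And>s. 0 \<le> s \<Longrightarrow> s \<le> e \<Longrightarrow> norm (g p s) \<le> B" and "0 \<le> s" "s \<le> e"
  shows "norm (g 0 s - (\<Sum>k<p. (s ^ k / fact k) *\<^sub>R g k 0)) \<le> B * s ^ p / fact p"
  using assms
proof (induction p arbitrary: g s)
  case 0
  then show ?case by simp
next
  case (Suc p)
  have IH: "norm (g 1 x - (\<Sum>k<p. (x ^ k / fact k) *\<^sub>R g (Suc k) 0)) \<le> B * x ^ p / fact p"
    if "0 \<le> x" "x \<le> e" for x
    using Suc.IH[of "\<lambda>k. g (Suc k)" x] Suc.prems(1,2) that by simp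
  define R where "R x = g 0 x - (\<Sum>k<Suc p. (x ^ k / fact k) *\<^sub>R g k 0)" for x
  have R0: "R 0 = 0" unfolding R_def by (subst sum.lessThan_Suc_shift) simp
  have R': "(R has_vector_derivative (g 1 x - (\<Sum>k<p. (x ^ k / fact k) *\<^sub>R g (Suc k) 0))) (at x)"
    if "0 \<le> x" "x \<le> e" for x
  proof -
    have d: "((\<lambda>x. (x ^ Suc k / fact (Suc k)) *\<^sub>R g (Suc k) 0) has_vector_derivative (x ^ k / fact k) *\<^sub>R g (Suc k) 0) (at x)" for k
    proof -
      have "((\<lambda>x::real. x ^ Suc k / fact (Suc k)) has_real_derivative (x ^ k / fact k)) (at x)"
        by (auto intro!: derivative_eq_intros simp del: power_Suc)
      from has_vector_derivative_scaleR[OF this has_vector_derivative_const] show ?thesis by simp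
    qed
    have eq: "R = (\<lambda>x. g 0 x - (g 0 0 + (\<Sum>k<p. (x ^ Suc k / fact (Suc k)) *\<^sub>R g (Suc k) 0)))"
      unfolding R_def by (subst sum.lessThan_Suc_shift) simp
    have "((\<lambda>x. g 0 x - (g 0 0 + (\<Sum>k<p. (x ^ Suc k / fact (Suc k)) *\<^sub>R g (Suc k) 0))) has_vector_derivative
        (g (Suc 0) x - (0 + (\<Sum>k<p. (x ^ k / fact k) *\<^sub>R g (Suc k) 0)))) (at x)"
      by (intro has_vector_derivative_diff has_vector_derivative_add has_vector_derivative_const
          has_vector_derivative_sum d Suc.prems(1) that)
    then show ?thesis by (simp add: eq)
  qed
  show ?case
  proof (cases "s = 0")
    case True
    then show ?thesis using R0 by (simp add: R_def)
  next
    case False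
    have "norm (R s - R 0) \<le> B * s ^ Suc p / fact (Suc p) - B * 0 ^ Suc p / fact (Suc p)"
    proof (rule differentiable_bound_general[where f' = "\<lambda>x. g 1 x - (\<Sum>k<p. (x ^ k / fact k) *\<^sub>R g (Suc k) 0)"
          and \<phi>' = "\<lambda>x. B * x ^ p / fact p"])
      show "0 < s" using False Suc.prems by simp
      show "continuous_on {0..s} R"
        by (rule continuous_at_imp_continuous_on) (use R' Suc.prems has_vector_derivative_continuous in force)
      show "continuous_on {0..s} (\<lambda>a. B * a ^ Suc p / fact (Suc p))" by (intro continuous_intros) auto
      fix x assume x: "0 < x" "x < s"
      show "(R has_vector_derivative (g 1 x - (\<Sum>k<p. (x ^ k / fact k) *\<^sub>R g (Suc k) 0))) (at x)"
        by (rule R') (use x Suc.prems in auto)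
      have "((\<lambda>x. B * x ^ Suc p / fact (Suc p)) has_real_derivative B * x ^ p / fact p) (at x)"
        by (auto intro!: derivative_eq_intros simp del: power_Suc)
      then show "((\<lambda>x. B * x ^ Suc p / fact (Suc p)) has_vector_derivative B * x ^ p / fact p) (at x)"
        by (simp add: has_real_derivative_iff_has_vector_derivative)
      show "norm (g 1 x - (\<Sum>k<p. (x ^ k / fact k) *\<^sub>R g (Suc k) 0)) \<le> B * x ^ p / fact p"
        by (rule IH) (use x Suc.prems in auto)
    qed
    then have "norm (R s) \<le> B * s ^ Suc p / fact (Suc p)" by (simp add: R0)
    then show ?thesis by (simp only: R_def)
  qed
qed

lemma Taylor_remainder:
  fixes g :: "nat \<Rightarrow> real \<Rightarrow> 'a::real_normed_vector"
  assumes g: "\<And>k s. \<bar>s\<bar> \<le> e \<Longrightarrow> (g k has_vector_derivative g (Suc k) s) (at s)"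
    and B: "\<And>s. \<bar>s\<bar> \<le> e \<Longrightarrow> norm (g p s) \<le> B" and s: "\<bar>s\<bar> \<le> e"
  shows "norm (g 0 s - (\<Sum>k<p. (s ^ k / fact k) *\<^sub>R g k 0)) \<le> B * \<bar>s\<bar> ^ p / fact p"
proof (cases "s \<ge> 0")
  case True
  then show ?thesis using Taylor_remainder_pos[of e g p B s] assms by auto
next
  case False
  define g' where "g' k x = (-1) ^ k *\<^sub>R g k (- x)" for k x
  have "norm (g' 0 (- s) - (\<Sum>k<p. ((- s) ^ k / fact k) *\<^sub>R g' k 0)) \<le> B * (- s) ^ p / fact p"
  proof (rule Taylor_remainder_pos[of e])
    fix k x assume x: "0 \<le> x" "x \<le> e"
    have "((\<lambda>x. g k (- x)) has_vector_derivative (-1) *\<^sub>R g (Suc k) (- x)) (at x)"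
    proof -
      have "(uminus has_vector_derivative (-1)) (at x)"
        using has_vector_derivative_minus[OF has_vector_derivative_id] by simp
      from vector_diff_chain_at[OF this g[of "- x" k]] show ?thesis using x by (simp add: o_def)
    qed
    from has_vector_derivative_scaleR[OF DERIV_const[of "(-1)^k"] this]
    show "(g' k has_vector_derivative g' (Suc k) x) (at x)"
      by (simp add: g'_def[abs_def])
  qed (use B False s in \<open>auto simp: g'_def norm_power\<close>)
  moreover have "((- s) ^ k / fact k) *\<^sub>R g' k 0 = (s ^ k / fact k) *\<^sub>R g k 0" for k
  proof -
    have "(- s) ^ k * (- 1) ^ k = s ^ k" by (subst power_mult_distrib[symmetric]) simp
    then have "(- s) ^ k / fact k * (- 1) ^ k = s ^ k / fact k" by (simp only: times_divide_eq_left)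
    then show ?thesis by (simp only: g'_def scaleR_scaleR minus_zero)
  qed
  moreover have "g' 0 (- s) = g 0 s" "\<bar>s\<bar> = - s" using False by (simp_all add: g'_def)
  ultimately show ?thesis by (simp only:)
qed

text \<open>This is where both powers are needed. If \<open>|f| \<ge> \<nu>\<close>, the identity
  \<open>(f - F) f^j = F (F^j - f^j) - (F^(j+1) - f^(j+1))\<close> is divided by \<open>f^j\<close>,
  which consumes \<open>\<nu>^j\<close> of the \<open>\<nu>^(j+1)\<close>. If
  \<open>|f| < \<nu>\<close>, the first error alone forces \<open>F\<close> to be of order
  \<open>\<nu>\<close>.\<close>

lemma quasi_root_error:
  fixes F f :: complex
  assumes j: "j > 0" and nu: "0 < \<nu>" "\<nu> \<le> 1" and C: "C \<ge> 1" "cmod F \<le> C"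
    and 1: "cmod (F ^ j - f ^ j) \<le> C * \<nu> ^ (j+1)" and 2: "cmod (F ^ (j+1) - f ^ (j+1)) \<le> C * \<nu> ^ (j+1)"
  shows "cmod (f - F) \<le> (2 + C + C * C) * \<nu>"
proof (cases "cmod f \<ge> \<nu>")
  case True
  have "(f - F) * f ^ j = F * (F ^ j - f ^ j) - (F ^ (j+1) - f ^ (j+1))" by (simp add: algebra_simps)
  then have "cmod ((f - F) * f ^ j) \<le> cmod F * cmod (F ^ j - f ^ j) + cmod (F ^ (j+1) - f ^ (j+1))"
    by (metis norm_mult norm_triangle_ineq4)
  also have "\<dots> \<le> C * (C * \<nu> ^ (j+1)) + C * \<nu> ^ (j+1)"
    by (intro add_mono mult_mono 1 2 C) (use C in auto)
  also have "cmod ((f - F) * f ^ j) = cmod (f - F) * cmod f ^ j" by (simp add: norm_mult norm_power)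
  finally have "cmod (f - F) * cmod f ^ j \<le> (C * C + C) * \<nu> * \<nu> ^ j"
    by (simp add: algebra_simps)
  moreover have "cmod (f - F) * \<nu> ^ j \<le> cmod (f - F) * cmod f ^ j"
    using True nu by (intro mult_left_mono power_mono) auto
  ultimately have "cmod (f - F) * \<nu> ^ j \<le> (C * C + C) * \<nu> * \<nu> ^ j" by linarith
  then have "cmod (f - F) \<le> (C * C + C) * \<nu>" using nu by simp
  also have "\<dots> \<le> (2 + C + C * C) * \<nu>" using nu by (intro mult_right_mono) auto
  finally show ?thesis .
next
  case False
  have "cmod F ^ j \<le> cmod f ^ j + cmod (F ^ j - f ^ j)"
    using norm_triangle_sub[of "F ^ j" "f ^ j"] by (simp add: norm_power)
  also have "\<dots> \<le> \<nu> ^ j + C * \<nu> ^ (j+1)"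
    using False by (intro add_mono power_mono 1) auto
  also have "\<dots> \<le> \<nu> ^ j + C * \<nu> ^ j" using nu C by (intro add_mono mult_left_mono power_decreasing) auto
  finally have "cmod (F / of_real \<nu>) ^ j \<le> 1 + C"
    using nu by (simp add: norm_divide power_divide field_simps)
  then have "cmod (F / of_real \<nu>) \<le> 1 + C" by (rule norm_le_of_power_le) (use C j in auto)
  then have "cmod F \<le> (1 + C) * \<nu>" using nu by (simp add: norm_divide pos_divide_le_eq)
  then have "cmod (f - F) \<le> (2 + C) * \<nu>" using False norm_triangle_ineq4[of f F] by (simp add: algebra_simps)
  also have "\<dots> \<le> (2 + C + C * C) * \<nu>" using nu C by (intro mult_right_mono) auto
  finally show ?thesis .
qed

text \<open>The ratio between the scale at which the weights are evaluated and the length of the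
  segment. The factor \<open>6^(j+1)\<close> pays, per degree, for extrapolating
  \<open>G^(j+1) - H^j\<close>, whose degree is at most \<open>p (j+1)\<close>. The second factor
  pays for \<open>84^p\<close> raised to the power \<open>7 j (j+1)^2\<close> with which the final
  error is measured.\<close>

definition root_scale :: "nat \<Rightarrow> real" where
  "root_scale j = 6 ^ (j+1) * 84 ^ (7 * j * (j+1) * (j+1))"

text \<open>After rescaling the segment to unit length, the \<open>k\<close>-th Taylor coefficient
  is at most \<open>C0 * (m k * \<tau>^k) / A^k\<close> with \<open>A = root_scale j\<close>. So the
  Taylor polynomials are bounded by a geometric series, and the remainder is
  \<open>C0 * m p * \<tau>^p / A^p\<close>. The factor \<open>1 / A^p\<close> absorbs everything
  that is exponential in \<open>p\<close>. Thus \<open>C\<close> depends only on \<open>j\<close>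
  and \<open>C0\<close>, which is essential since \<open>p\<close> grows as the segment
  shrinks.\<close>

lemma holomorphic_approximation_on_line:
  assumes j: "j > 0" and C0: "C0 \<ge> 1"
  obtains C where "C \<ge> 1"
    "\<And>(m :: nat \<Rightarrow> real) p \<tau> \<rho> g h \<phi>. \<tau> > 0 \<Longrightarrow> \<rho> > 0 \<Longrightarrow> (\<And>k. m k > 0) \<Longrightarrow> (\<And>k. k \<le> p \<Longrightarrow> m k * \<tau> ^ k \<le> 1) \<Longrightarrow>
      (\<And>k s. \<bar>s\<bar> \<le> \<tau> / (root_scale j * \<rho>) \<Longrightarrow> (g k has_vector_derivative g (Suc k) s) (at s)) \<Longrightarrow>
      (\<And>k s. \<bar>s\<bar> \<le> \<tau> / (root_scale j * \<rho>) \<Longrightarrow> (h k has_vector_derivative h (Suc k) s) (at s)) \<Longrightarrow>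
      (\<And>k s. \<bar>s\<bar> \<le> \<tau> / (root_scale j * \<rho>) \<Longrightarrow> cmod (g k s) \<le> C0 * \<rho> ^ k * fact k * m k) \<Longrightarrow>
      (\<And>k s. \<bar>s\<bar> \<le> \<tau> / (root_scale j * \<rho>) \<Longrightarrow> cmod (h k s) \<le> C0 * \<rho> ^ k * fact k * m k) \<Longrightarrow>
      g 0 = (\<lambda>s. \<phi> s ^ j) \<Longrightarrow> h 0 = (\<lambda>s. \<phi> s ^ (j+1)) \<Longrightarrow>
      \<exists>F. F holomorphic_on ball 0 (\<tau> / (root_scale j * \<rho>) / 2) \<and> (\<forall>z\<in>ball 0 (\<tau> / (root_scale j * \<rho>) / 2). cmod (F z) \<le> C) \<and>
        (\<forall>s. \<bar>s\<bar> < \<tau> / (root_scale j * \<rho>) / 2 \<longrightarrow> cmod (\<phi> s - F (of_real s)) \<le> C * root (7 * j * (j+1) * (j+1)) (m p * \<tau> ^ p))"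
proof -
  define K where "K = 7 * j * (j+1) * (j+1)"
  define A where "A = root_scale j"
  have A: "A = 6 ^ (j+1) * 84 ^ K" by (simp only: A_def root_scale_def K_def)
  have K: "K > 0" using j by (simp add: K_def)
  have A2: "A \<ge> 2"
  proof -
    have "6 ^ 1 \<le> (6::real) ^ (j+1)" by (rule power_increasing) auto
    then have "6 * 1 \<le> (6::real) ^ (j+1) * 84 ^ K" by (intro mult_mono) auto
    then show ?thesis by (simp add: A)
  qed
  have A84: "84 ^ K \<le> A" "A > 0"
  proof -
    have "1 * 84 ^ K \<le> (6::real) ^ (j+1) * 84 ^ K" by (intro mult_right_mono one_le_power) auto
    then show "84 ^ K \<le> A" by (simp add: A)
    show "A > 0" using A2 by linarith
  qed
  define C1 where "C1 = (2 * real j + 1) * (2 * C0) ^ (j+1)"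
  have C1: "2 * C0 \<le> C1" "1 \<le> C1"
  proof -
    have "2 * C0 \<le> (2 * C0) ^ (j+1)" using self_le_power[of "2 * C0" "j+1"] C0 by simp
    also have "1 * (2 * C0) ^ (j+1) \<le> C1" unfolding C1_def using C0 by (intro mult_right_mono) auto
    finally show "2 * C0 \<le> C1" by simp
    then show "1 \<le> C1" using C0 by linarith
  qed
  obtain C' where C': "C' \<ge> 1"
    and root: "\<And>G H \<mu> p. degree G \<le> p \<Longrightarrow> 0 < \<mu> \<Longrightarrow> 84 ^ p * \<mu> \<le> 1 \<Longrightarrow>
      (\<And>z. z \<in> ball 0 1 \<Longrightarrow> cmod (poly G z) \<le> C1) \<Longrightarrow> (\<And>z. z \<in> ball 0 1 \<Longrightarrow> cmod (poly H z) \<le> C1) \<Longrightarrow>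
      (\<And>z. z \<in> ball 0 1 \<Longrightarrow> cmod (poly G z ^ (j+1) - poly H z ^ j) \<le> C1 * \<mu> ^ (7 * j * (j+1))) \<Longrightarrow>
      \<exists>F. F holomorphic_on ball 0 (1/2) \<and> (\<forall>z\<in>ball 0 (1/2). cmod (F z) \<le> C' \<and>
        cmod (F z ^ j - poly G z) \<le> C' * \<mu> \<and> cmod (F z ^ (j+1) - poly H z) \<le> C' * \<mu>)"
    using quasi_root_poly[OF j C1(2)] by blast
  define C'' where "C'' = C' + C0"
  define C where "C = 2 + C'' + C'' * C''"
  have C'': "C'' \<ge> 1" "C' \<le> C''" using C' C0 by (auto simp: C''_def)
  have "0 \<le> C'' * C''" by simp
  then have C: "C \<ge> 1" "C' \<le> C" unfolding C_def using C'' by linarith+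
  show ?thesis
  proof (rule that[unfolded K_def[symmetric] A_def[symmetric], OF C(1)])
    fix m :: "nat \<Rightarrow> real" and p \<tau> \<rho> g h \<phi>
    assume tau: "\<tau> > 0" and rho: "\<rho> > 0" and m: "\<And>k. m k > 0" "\<And>k. k \<le> p \<Longrightarrow> m k * \<tau> ^ k \<le> 1"
      and g': "\<And>k s. \<bar>s\<bar> \<le> \<tau> / (A * \<rho>) \<Longrightarrow> (g k has_vector_derivative g (Suc k) s) (at s)"
      and h': "\<And>k s. \<bar>s\<bar> \<le> \<tau> / (A * \<rho>) \<Longrightarrow> (h k has_vector_derivative h (Suc k) s) (at s)"
      and gb: "\<And>k s. \<bar>s\<bar> \<le> \<tau> / (A * \<rho>) \<Longrightarrow> cmod (g k s) \<le> C0 * \<rho> ^ k * fact k * m k"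
      and hb: "\<And>k s. \<bar>s\<bar> \<le> \<tau> / (A * \<rho>) \<Longrightarrow> cmod (h k s) \<le> C0 * \<rho> ^ k * fact k * m k"
      and g0: "g 0 = (\<lambda>s. \<phi> s ^ j)" and h0: "h 0 = (\<lambda>s. \<phi> s ^ (j+1))"
    define e where "e = \<tau> / (A * \<rho>)"
    have e: "e > 0" using tau rho A2 by (simp add: e_def)
    have re: "\<rho> * e = \<tau> / A" using rho by (simp add: e_def)
    define \<eta> where "\<eta> = m p * \<tau> ^ p"
    have eta: "0 < \<eta>" "\<eta> \<le> 1" using m tau by (auto simp: \<eta>_def)
    define \<nu> where "\<nu> = root K \<eta> / 84 ^ p"
    define \<mu> where "\<mu> = \<nu> ^ (j+1)"
    have rt: "0 < root K \<eta>" "root K \<eta> \<le> 1" using eta K by auto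
    have nu: "0 < \<nu>" "\<nu> \<le> root K \<eta>" "84 ^ p * \<nu> \<le> 1"
      using rt by (auto simp: \<nu>_def divide_le_eq mult_le_cancel_left1)
    have nu1: "\<nu> \<le> 1" using nu(2) rt by linarith
    have mu: "0 < \<mu>" "\<mu> \<le> \<nu>" using nu nu1 power_decreasing[of 1 "j+1" \<nu>] by (auto simp: \<mu>_def)
    have mu3: "84 ^ p * \<mu> \<le> 1" by (rule order_trans[OF mult_left_mono[OF mu(2)] nu(3)]) simp
    have nuK: "\<nu> ^ K = \<eta> / (84 ^ K) ^ p"
      using K eta by (simp add: \<nu>_def power_divide mult.commute flip: power_mult)
    have etaA: "\<eta> / A ^ p \<le> \<nu> ^ K"
      unfolding nuK using eta A84 by (intro divide_left_mono power_mono) auto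
    have etaA_mu: "\<eta> / A ^ p \<le> \<mu>"
    proof -
      have "\<nu> ^ K \<le> \<mu>" unfolding \<mu>_def by (rule power_decreasing) (use nu nu1 j in \<open>auto simp: K_def\<close>)
      then show ?thesis using etaA by linarith
    qed
    define T where "T d = (\<Sum>k<p. monom (of_real (e ^ k / fact k) * d k 0) k)" for d :: "nat \<Rightarrow> real \<Rightarrow> complex"
    have degT: "degree (T d) \<le> p" for d
      unfolding T_def by (rule degree_sum_le) (auto intro: order_trans[OF degree_monom_le])
    have polyT: "poly (T d) z = (\<Sum>k<p. of_real (e ^ k / fact k) * d k 0 * z ^ k)" for d z
      by (simp add: T_def poly_sum poly_monom)
    have Tb: "cmod (poly (T d) z) \<le> 2 * C0" if z: "cmod z \<le> 1"
      and d: "\<And>k s. \<bar>s\<bar> \<le> e \<Longrightarrow> cmod (d k s) \<le> C0 * \<rho> ^ k * fact k * m k" for d z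
    proof -
      have "cmod (poly (T d) z) \<le> (\<Sum>k<p. C0 * (1/2) ^ k)"
        unfolding polyT
      proof (rule sum_norm_le)
        fix k assume "k \<in> {..<p}"
        then have k: "m k * \<tau> ^ k \<le> 1" using m by simp
        have "cmod (of_real (e ^ k / fact k) * d k 0 * z ^ k) = e ^ k / fact k * cmod (d k 0) * cmod z ^ k"
          using e by (simp add: norm_mult norm_power norm_divide)
        also have "\<dots> \<le> e ^ k / fact k * (C0 * \<rho> ^ k * fact k * m k) * 1"
          by (intro mult_mono d power_le_one z mult_nonneg_nonneg) (use e C0 rho m(1)[THEN less_imp_le] in auto)
        also have "\<dots> = C0 * (\<rho> * e) ^ k * m k" by (simp add: power_mult_distrib)
        also have "\<dots> = C0 * (m k * \<tau> ^ k) * (1 / A) ^ k" unfolding re by (simp add: power_divide)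
        also have "\<dots> \<le> C0 * 1 * (1 / 2) ^ k"
          by (intro mult_mono power_mono divide_left_mono k) (use A2 C0 tau m(1)[THEN less_imp_le] in auto)
        finally show "cmod (of_real (e ^ k / fact k) * d k 0 * z ^ k) \<le> C0 * (1/2) ^ k" by simp
      qed
      also have "\<dots> = C0 * (2 - 2 * (1/2) ^ p)"
        by (simp only: sum_distrib_left[symmetric] sum_gp_strict) (simp add: field_simps)
      also have "\<dots> \<le> C0 * 2" using C0 by (intro mult_left_mono) auto
      finally show ?thesis by simp
    qed
    have Tr: "cmod (d 0 (e * t) - poly (T d) (of_real t)) \<le> C0 * (\<eta> / A ^ p)" if t: "\<bar>t\<bar> \<le> 1"
      and d: "\<And>k s. \<bar>s\<bar> \<le> e \<Longrightarrow> cmod (d k s) \<le> C0 * \<rho> ^ k * fact k * m k"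
      and d': "\<And>k s. \<bar>s\<bar> \<le> e \<Longrightarrow> (d k has_vector_derivative d (Suc k) s) (at s)" for d t
    proof -
      have et: "\<bar>e * t\<bar> \<le> e" using t e by (simp add: abs_mult mult_left_le)
      have "poly (T d) (of_real t) = (\<Sum>k<p. ((e * t) ^ k / fact k) *\<^sub>R d k 0)"
        unfolding polyT by (simp add: scaleR_conv_of_real power_mult_distrib mult_ac)
      then have "cmod (d 0 (e * t) - poly (T d) (of_real t)) \<le> C0 * \<rho> ^ p * fact p * m p * \<bar>e * t\<bar> ^ p / fact p"
        using Taylor_remainder[of e d p "C0 * \<rho> ^ p * fact p * m p" "e * t", OF d' d et] by simp
      also have "\<dots> = C0 * \<rho> ^ p * m p * \<bar>e * t\<bar> ^ p" by simp
      also have "\<dots> \<le> C0 * \<rho> ^ p * m p * e ^ p"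
        by (intro mult_left_mono power_mono et) (use C0 rho m(1)[THEN less_imp_le] in auto)
      also have "\<dots> = C0 * m p * (\<rho> * e) ^ p" by (simp add: power_mult_distrib mult_ac)
      also have "\<dots> = C0 * (\<eta> / A ^ p)" unfolding re by (simp add: \<eta>_def power_divide)
      finally show ?thesis .
    qed
    note gb = gb[folded e_def] and hb = hb[folded e_def] and g' = g'[folded e_def] and h' = h'[folded e_def]
    define G where "G = T g"
    define H where "H = T h"
    \<comment> \<open>On the real segment \<open>g^(j+1)\<close> and \<open>h^j\<close> coincide,
      both being a power of \<open>\<phi>\<close>. Only the two truncation errors remain.\<close>
    have real_err: "cmod (poly G (of_real t) ^ (j+1) - poly H (of_real t) ^ j) \<le> C1 * (\<eta> / A ^ p)" if "t \<in> {-1..1}" for t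
    proof -
      have t: "\<bar>t\<bar> \<le> 1" using that by auto
      have et: "\<bar>e * t\<bar> \<le> e" using t e by (simp add: abs_mult mult_left_le)
      have m0: "m 0 \<le> 1" using m(2)[of 0] by simp
      have b00: "C0 * m 0 \<le> C0" using m0 C0 by (simp add: mult_left_le)
      have "cmod (g 0 (e * t)) \<le> C0 * m 0" "cmod (h 0 (e * t)) \<le> C0 * m 0"
        using gb[OF et, of 0] hb[OF et, of 0] by simp_all
      then have b0: "cmod (g 0 (e * t)) \<le> 2 * C0" "cmod (h 0 (e * t)) \<le> 2 * C0"
        using b00 C0 by linarith+
      have tz: "cmod (of_real t) \<le> 1" using t by simp
      have "cmod (poly G (of_real t) ^ (j+1) - g 0 (e * t) ^ (j+1)) \<le> real (j+1) * (2 * C0) ^ (j + 1 - 1) * cmod (poly G (of_real t) - g 0 (e * t))"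
        unfolding G_def by (rule norm_power_diff_bound[OF Tb[OF tz gb] b0(1)]) (use C0 in auto)
      also have "\<dots> \<le> real (j+1) * (2 * C0) ^ (j + 1 - 1) * (C0 * (\<eta> / A ^ p))"
        using Tr[OF t gb g'] C0 by (intro mult_left_mono) (auto simp: G_def norm_minus_commute)
      finally have 1: "cmod (poly G (of_real t) ^ (j+1) - g 0 (e * t) ^ (j+1)) \<le> real (j+1) * (2 * C0) ^ j * (C0 * (\<eta> / A ^ p))" by simp
      have "cmod (poly H (of_real t) ^ j - h 0 (e * t) ^ j) \<le> real j * (2 * C0) ^ (j - 1) * cmod (poly H (of_real t) - h 0 (e * t))"
        unfolding H_def by (rule norm_power_diff_bound[OF Tb[OF tz hb] b0(2)]) (use C0 in auto)
      also have "\<dots> \<le> real j * (2 * C0) ^ j * (C0 * (\<eta> / A ^ p))"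
        using Tr[OF t hb h'] C0 by (intro mult_mono power_increasing mult_left_mono) (auto simp: H_def norm_minus_commute)
      finally have 2: "cmod (poly H (of_real t) ^ j - h 0 (e * t) ^ j) \<le> real j * (2 * C0) ^ j * (C0 * (\<eta> / A ^ p))" .
      have "g 0 (e * t) ^ (j+1) = h 0 (e * t) ^ j" unfolding g0 h0 by (simp only: power_mult[symmetric] mult.commute)
      then have "poly G (of_real t) ^ (j+1) - poly H (of_real t) ^ j
        = (poly G (of_real t) ^ (j+1) - g 0 (e * t) ^ (j+1)) - (poly H (of_real t) ^ j - h 0 (e * t) ^ j)"
        by simp
      also have "cmod \<dots> \<le> real (j+1) * (2 * C0) ^ j * (C0 * (\<eta> / A ^ p)) + real j * (2 * C0) ^ j * (C0 * (\<eta> / A ^ p))"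
        using norm_triangle_ineq4[of "poly G (of_real t) ^ (j+1) - g 0 (e * t) ^ (j+1)" "poly H (of_real t) ^ j - h 0 (e * t) ^ j"] 1 2
        by linarith
      also have "\<dots> = (2 * real j + 1) * ((2 * C0) ^ j * C0) * (\<eta> / A ^ p)"
        by (simp only: of_nat_add of_nat_1) (simp only: algebra_simps mult_2)
      also have "\<dots> \<le> C1 * (\<eta> / A ^ p)"
        unfolding C1_def using C0 eta A2 by (intro mult_right_mono mult_left_mono) auto
      finally show ?thesis .
    qed
    have degP: "degree (G ^ (j+1) - H ^ j) \<le> p * (j+1)"
    proof (rule degree_diff_le)
      show "degree (G ^ (j+1)) \<le> p * (j+1)"
        using degree_power_le[of G "j+1"] mult_right_mono[OF degT, of "j+1" g] by (simp only: G_def) linarith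
      have "degree (H ^ j) \<le> p * j"
        using degree_power_le[of H j] mult_right_mono[OF degT, of j h] by (simp only: H_def) linarith
      then show "degree (H ^ j) \<le> p * (j+1)" by simp
    qed
    \<comment> \<open>The extrapolation loss \<open>6^(p (j+1))\<close> cancels exactly against the
      first factor of \<open>A^p\<close>. What is left is
      \<open>\<eta> / (84^K)^p = \<nu>^K\<close>, the required power of
      \<open>\<mu>\<close>.\<close>
    have disc_err: "cmod (poly G z ^ (j+1) - poly H z ^ j) \<le> C1 * \<mu> ^ (7 * j * (j+1))" if z: "z \<in> ball 0 1" for z
    proof -
      have "cmod (poly (G ^ (j+1) - H ^ j) z) \<le> (6 * 1) ^ (p * (j+1)) * (C1 * (\<eta> / A ^ p))"
        by (rule poly_extrapolate[OF degP]) (use real_err z in \<open>auto simp: poly_power simp del: power_Suc\<close>)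
      also have "\<dots> = C1 * (\<eta> / (84 ^ K) ^ p)"
        by (simp add: A power_mult_distrib mult.commute[of p] power_mult del: power_Suc mult_Suc mult_Suc_right)
      also have "\<dots> = C1 * \<mu> ^ (7 * j * (j+1))"
        unfolding nuK[symmetric] by (simp only: \<mu>_def K_def power_mult[symmetric] mult_ac)
      finally show ?thesis by (simp add: poly_power)
    qed
    obtain F where F: "F holomorphic_on ball 0 (1/2)"
      and Fb: "\<And>z. z \<in> ball 0 (1/2) \<Longrightarrow> cmod (F z) \<le> C'"
      and F1: "\<And>z. z \<in> ball 0 (1/2) \<Longrightarrow> cmod (F z ^ j - poly G z) \<le> C' * \<mu>"
      and F2: "\<And>z. z \<in> ball 0 (1/2) \<Longrightarrow> cmod (F z ^ (j+1) - poly H z) \<le> C' * \<mu>"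
    proof -
      have "cmod (poly G z) \<le> C1" "cmod (poly H z) \<le> C1" if "z \<in> ball 0 1" for z
        using Tb[of z g] Tb[of z h] gb hb that C1 unfolding G_def H_def by force+
      from root[OF degT[of g, folded G_def] mu(1) mu3 this disc_err] show ?thesis using that by blast
    qed
    have in_half: "z / of_real e \<in> ball 0 (1/2)" if "z \<in> ball 0 (e / 2)" for z :: complex
      using that e by (simp add: norm_divide field_simps)
    show "\<exists>F. F holomorphic_on ball 0 (\<tau> / (A * \<rho>) / 2) \<and> (\<forall>z\<in>ball 0 (\<tau> / (A * \<rho>) / 2). cmod (F z) \<le> C) \<and>
        (\<forall>s. \<bar>s\<bar> < \<tau> / (A * \<rho>) / 2 \<longrightarrow> cmod (\<phi> s - F (of_real s)) \<le> C * root K (m p * \<tau> ^ p))"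
      unfolding e_def[symmetric] \<eta>_def[symmetric]
    proof (intro exI[of _ "\<lambda>z. F (z / of_real e)"] conjI ballI allI impI)
      show "(\<lambda>z. F (z / of_real e)) holomorphic_on ball 0 (e / 2)"
      proof (rule holomorphic_on_compose_gen[of "\<lambda>z. z / of_real e" _ F "ball 0 (1/2)", unfolded o_def])
        show "(\<lambda>z. z / of_real e) holomorphic_on ball 0 (e / 2)" using e by (intro holomorphic_intros) auto
      qed (use F in_half in auto)
      show "cmod (F (z / of_real e)) \<le> C" if "z \<in> ball 0 (e / 2)" for z
        using Fb[OF in_half[OF that]] C by linarith
      fix s assume s: "\<bar>s\<bar> < e / 2"
      define t where "t = s / e"
      have st: "s = e * t" and t: "\<bar>t\<bar> \<le> 1" using s e by (auto simp: t_def abs_le_iff divide_le_eq)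
      have "\<bar>t\<bar> < 1/2" using s e by (simp add: t_def abs_divide pos_divide_less_eq)
      then have tz: "(of_real t :: complex) \<in> ball 0 (1/2)" by simp
      have "cmod (F (of_real t) ^ j - \<phi> s ^ j) \<le> C'' * \<mu>"
      proof -
        have "cmod (F (of_real t) ^ j - \<phi> s ^ j) \<le> cmod (F (of_real t) ^ j - poly G (of_real t)) + cmod (\<phi> s ^ j - poly G (of_real t))"
          using norm_triangle_ineq4[of "F (of_real t) ^ j - poly G (of_real t)" "\<phi> s ^ j - poly G (of_real t)"] by simp
        also have "\<dots> \<le> C' * \<mu> + C0 * (\<eta> / A ^ p)"
          using F1[OF tz] Tr[OF t gb g'] unfolding g0 G_def st by linarith
        also have "\<dots> \<le> C' * \<mu> + C0 * \<mu>" using etaA_mu C0 by (intro add_left_mono mult_left_mono) auto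
        finally show ?thesis by (simp add: C''_def algebra_simps)
      qed
      moreover have "cmod (F (of_real t) ^ (j+1) - \<phi> s ^ (j+1)) \<le> C'' * \<mu>"
      proof -
        have "cmod (F (of_real t) ^ (j+1) - \<phi> s ^ (j+1)) \<le> cmod (F (of_real t) ^ (j+1) - poly H (of_real t)) + cmod (\<phi> s ^ (j+1) - poly H (of_real t))"
          using norm_triangle_ineq4[of "F (of_real t) ^ (j+1) - poly H (of_real t)" "\<phi> s ^ (j+1) - poly H (of_real t)"] by simp
        also have "\<dots> \<le> C' * \<mu> + C0 * (\<eta> / A ^ p)"
          using F2[OF tz] Tr[OF t hb h'] unfolding h0 H_def st by linarith
        also have "\<dots> \<le> C' * \<mu> + C0 * \<mu>" using etaA_mu C0 by (intro add_left_mono mult_left_mono) auto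
        finally show ?thesis by (simp add: C''_def algebra_simps)
      qed
      moreover have "cmod (F (of_real t)) \<le> C''" using Fb[OF tz] C'' by linarith
      ultimately have "cmod (\<phi> s - F (of_real t)) \<le> C * \<nu>"
        unfolding C_def \<mu>_def by (intro quasi_root_error[OF j nu(1) nu1 C''(1)])
      also have "\<dots> \<le> C * root K \<eta>" using nu C by (intro mult_left_mono) auto
      finally show "cmod (\<phi> s - F (of_real s / of_real e)) \<le> C * root K \<eta>" by (simp add: t_def)
    qed
  qed
qed

section \<open>Functions that are small on the real axis\<close>

lemma holomorphic_deriv_bound:
  assumes hol: "D holomorphic_on ball z e" and e: "e > 0" and bd: "\<And>w. w \<in> ball z e \<Longrightarrow> cmod (D w) \<le> C"
  shows "cmod ((deriv ^^ n) D z) \<le> fact n * C * (2 / e) ^ n"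
proof -
  have "cmod ((deriv ^^ n) D z) \<le> fact n * C / (e / 2) ^ n"
  proof (rule Cauchy_inequality)
    show "D holomorphic_on ball z (e / 2)" by (rule holomorphic_on_subset[OF hol]) (use e in auto)
    show "continuous_on (cball z (e / 2)) D"
      by (rule continuous_on_subset[OF holomorphic_on_imp_continuous_on[OF hol]]) (use e in auto)
    show "cmod (D w) \<le> C" if "cmod (z - w) = e / 2" for w using that e by (intro bd) (auto simp: dist_norm)
  qed (use e in auto)
  then show ?thesis by (simp add: power_divide)
qed

text \<open>Cauchy's estimate is taken at half the radius, as the bound holds on the open disc only.
  This gives the ratio \<open>2 |z| / e \<le> 1/2\<close>, so the tail is at most twice its first
  term.\<close>

lemma holomorphic_Taylor_tail:
  assumes hol: "D holomorphic_on ball 0 e" and e: "e > 0" and bd: "\<And>w. w \<in> ball 0 e \<Longrightarrow> cmod (D w) \<le> C"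
    and z: "cmod z \<le> e / 4"
  shows "cmod (D z - poly (\<Sum>n\<le>q. monom ((deriv ^^ n) D 0 / fact n) n) z) \<le> 2 * C * (2 * cmod z / e) ^ Suc q"
proof -
  define a where "a n = (deriv ^^ n) D 0 / fact n" for n
  define x where "x = 2 * cmod z / e"
  have x: "0 \<le> x" "x \<le> 1/2" using z e by (auto simp: x_def field_simps)
  have C: "C \<ge> 0" using bd[of 0] e order_trans[OF norm_ge_zero] by auto
  have an: "cmod (a n * z ^ n) \<le> C * x ^ n" for n
  proof -
    have "cmod (a n) \<le> C * (2 / e) ^ n"
      using holomorphic_deriv_bound[OF hol e bd, of n] by (simp add: a_def norm_divide divide_le_eq mult_ac)
    then have "cmod (a n) * cmod z ^ n \<le> C * (2 / e) ^ n * cmod z ^ n" by (rule mult_right_mono) simp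
    then show ?thesis by (simp add: norm_mult norm_power x_def power_divide power_mult_distrib)
  qed
  have "(\<lambda>n. a n * z ^ n) sums D z"
    using holomorphic_power_series[OF hol, of z] z e by (simp add: a_def)
  from sums_split_initial_segment[OF this, of "Suc q"]
  have s: "(\<lambda>n. a (n + Suc q) * z ^ (n + Suc q)) sums (D z - (\<Sum>n\<le>q. a n * z ^ n))"
    by (simp only: lessThan_Suc_atMost)
  have g: "(\<lambda>n. C * x ^ Suc q * x ^ n) sums (C * x ^ Suc q * (1 / (1 - x)))"
    using x by (intro sums_mult geometric_sums) auto
  have le: "cmod (a (n + Suc q) * z ^ (n + Suc q)) \<le> C * x ^ Suc q * x ^ n" for n
    using an[of "n + Suc q"] by (simp add: power_add mult_ac)
  have "summable (\<lambda>n. cmod (a (n + Suc q) * z ^ (n + Suc q)))"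
    by (rule summable_comparison_test'[OF sums_summable[OF g]]) (use le in simp)
  then have "cmod (D z - (\<Sum>n\<le>q. a n * z ^ n)) \<le> (\<Sum>n. cmod (a (n + Suc q) * z ^ (n + Suc q)))"
    using summable_norm sums_unique[OF s] by metis
  also have "\<dots> \<le> C * x ^ Suc q * (1 / (1 - x))"
    unfolding sums_unique[OF g]
    by (intro suminf_le le sums_summable[OF g]) fact
  also have "\<dots> \<le> C * x ^ Suc q * 2" using x C by (intro mult_left_mono) (auto simp: field_simps)
  finally show ?thesis by (simp add: a_def x_def poly_sum poly_monom mult_ac)
qed

text \<open>A two-constants estimate obtained from polynomials. For \<open>|z| \<le> e / 72\<close>
  the Taylor tail of degree \<open>q\<close> is of order \<open>C / 36^(q+1)\<close>, while
  extrapolation from the real segment costs \<open>6^q\<close>. The product is still of order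
  \<open>C / 6^(q+1)\<close>. Choosing \<open>q\<close> with
  \<open>6^q \<le> sqrt (C / \<delta>) < 6^(q+1)\<close> balances this against
  \<open>6^q * \<delta>\<close>.\<close>

lemma small_on_reals_imp_small:
  assumes hol: "D holomorphic_on ball 0 e" and e: "e > 0" and bd: "\<And>w. w \<in> ball 0 e \<Longrightarrow> cmod (D w) \<le> C"
    and re: "\<And>s. \<bar>s\<bar> < e \<Longrightarrow> cmod (D (of_real s)) \<le> \<delta>" and d: "0 < \<delta>" "\<delta> \<le> C"
    and z: "cmod z \<le> e / 72"
  shows "cmod (D z) \<le> 5 * sqrt (C * \<delta>)"
proof -
  define k where "k = e / 72"
  define R where "R = sqrt (C / \<delta>)"
  have C: "C > 0" using d by linarith
  have R1: "R \<ge> 1" using d by (simp add: R_def)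
  have Rd: "R * \<delta> = sqrt (C * \<delta>)" "C / R = sqrt (C * \<delta>)"
  proof -
    have R2: "R * R = C / \<delta>" using d by (simp add: R_def)
    have "(R * \<delta>)\<^sup>2 = R * R * \<delta> * \<delta>" by (simp add: power2_eq_square)
    also have "\<dots> = C * \<delta>" using d by (simp add: R2)
    finally show "R * \<delta> = sqrt (C * \<delta>)"
      using d R1 by (intro real_sqrt_unique[symmetric]) auto
    have "(C / R)\<^sup>2 = C * C / (R * R)" by (simp add: power2_eq_square)
    also have "\<dots> = C * \<delta>" using d C by (simp add: R2)
    finally show "C / R = sqrt (C * \<delta>)"
      using C R1 by (intro real_sqrt_unique[symmetric]) auto
  qed
  obtain q where q: "6 ^ q \<le> R" "R < 6 ^ Suc q"
  proof -
    obtain n where n: "R < 6 ^ n" using real_arch_pow[of 6 R] by auto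
    define N where "N = (LEAST n. R < 6 ^ n)"
    have N: "R < 6 ^ N" unfolding N_def by (rule LeastI[of "\<lambda>n. R < 6 ^ n", OF n])
    then have "N \<noteq> 0" using R1 by (intro notI) simp
    then obtain q where q: "N = Suc q" by (cases N) auto
    have "\<not> R < 6 ^ q" using not_less_Least[of q "\<lambda>n. R < 6 ^ n"] q by (simp add: N_def)
    then show ?thesis using that[of q] N q by simp
  qed
  define P where "P = (\<Sum>n\<le>q. monom ((deriv ^^ n) D 0 / fact n) n)"
  have tail: "cmod (D w - poly P w) \<le> 2 * C * (1 / 36) ^ Suc q" if w: "cmod w \<le> k" for w
  proof -
    have "cmod (D w - poly P w) \<le> 2 * C * (2 * cmod w / e) ^ Suc q"
      unfolding P_def by (rule holomorphic_Taylor_tail[OF hol e bd]) (use w e in \<open>auto simp: k_def\<close>)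
    also have "\<dots> \<le> 2 * C * (1 / 36) ^ Suc q"
      using w e C by (intro mult_left_mono power_mono) (auto simp: k_def field_simps)
    finally show ?thesis .
  qed
  define P' where "P' = pcompose P [:0, of_real k:]"
  have P': "poly P' w = poly P (of_real k * w)" for w by (simp add: P'_def poly_pcompose mult.commute)
  have "degree P' \<le> q"
  proof -
    have "degree P \<le> q" unfolding P_def by (rule degree_sum_le) (auto intro: order_trans[OF degree_monom_le])
    then show ?thesis using degree_pcompose_le[of P "[:0, of_real k:]"] e by (auto simp: P'_def k_def)
  qed
  moreover have "cmod (poly P' (of_real t)) \<le> \<delta> + 2 * C * (1 / 36) ^ Suc q" if "t \<in> {-1..1}" for t
  proof -
    have kt: "\<bar>k * t\<bar> \<le> k" using that e by (auto simp: k_def abs_mult abs_le_iff)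
    have "cmod (D (of_real (k * t))) \<le> \<delta>" by (rule re) (use kt e in \<open>auto simp: k_def\<close>)
    moreover have "cmod (D (of_real (k * t)) - poly P (of_real (k * t))) \<le> 2 * C * (1 / 36) ^ Suc q"
      by (rule tail) (use kt in \<open>simp only: norm_of_real\<close>)
    ultimately show ?thesis
      using norm_triangle_ineq4[of "D (of_real (k * t))" "D (of_real (k * t)) - poly P (of_real (k * t))"]
      by (simp add: P')
  qed
  moreover have "cmod (z / of_real k) \<le> 1" using z e by (simp add: k_def norm_divide divide_le_eq)
  ultimately have "cmod (poly P' (z / of_real k)) \<le> (6 * 1) ^ q * (\<delta> + 2 * C * (1 / 36) ^ Suc q)"
    by (intro poly_extrapolate) auto
  then have "cmod (poly P z) \<le> 6 ^ q * \<delta> + 2 * C * (6 ^ q * (1 / 36) ^ Suc q)"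
    using e by (simp add: P' k_def algebra_simps)
  also have "6 ^ q * (1 / 36) ^ Suc q \<le> 1 / (6::real) ^ Suc q"
  proof -
    have "6 ^ q * (1 / 36 :: real) ^ Suc q = (6 * (1 / 36)) ^ q * (1 / 36)"
      by (simp only: power_Suc2 power_mult_distrib mult.assoc)
    also have "\<dots> = (1 / 6) ^ Suc q * (1 / 6)" by simp
    also have "\<dots> \<le> (1 / 6) ^ Suc q * 1" by (intro mult_left_mono) auto
    finally show ?thesis by (simp add: power_divide)
  qed
  finally have 1: "cmod (poly P z) \<le> 6 ^ q * \<delta> + 2 * C * (1 / 6 ^ Suc q)" using C by (simp add: mult_left_mono)
  have "(1 / 36) ^ Suc q \<le> 1 / (6::real) ^ Suc q"
    unfolding power_one_over[symmetric] by (rule power_mono) auto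
  then have 2: "cmod (D z - poly P z) \<le> 2 * C * (1 / 6 ^ Suc q)"
    using tail[of z] z C mult_left_mono[of "(1 / 36) ^ Suc q" "1 / (6::real) ^ Suc q" "2 * C"] by (simp add: k_def)
  have "cmod (D z) \<le> 6 ^ q * \<delta> + 4 * C * (1 / 6 ^ Suc q)"
    using 1 2 norm_triangle_sub[of "D z" "poly P z"] by linarith
  also have "\<dots> \<le> R * \<delta> + 4 * C * (1 / R)"
    using q C d R1 by (intro add_mono mult_right_mono mult_left_mono divide_left_mono) auto
  also have "\<dots> = 5 * sqrt (C * \<delta>)" using Rd by simp
  finally show ?thesis .
qed

section \<open>Approximants on shrinking discs along one line\<close>

definition line_approx :: "(real \<Rightarrow> complex) \<Rightarrow> nat \<Rightarrow> real \<Rightarrow> real \<Rightarrow> (complex \<Rightarrow> complex) \<Rightarrow> bool" where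
  "line_approx \<psi> N C e F \<longleftrightarrow> F holomorphic_on ball 0 e \<and> (\<forall>z\<in>ball 0 e. cmod (F z) \<le> C) \<and>
     (\<forall>s. \<bar>s\<bar> < e \<longrightarrow> cmod (\<psi> s - F (of_real s)) \<le> C * e ^ N)"

text \<open>On the reals the two approximants differ by the order \<open>e^(2 M + 2)\<close>. The
  two-constants estimate leaves \<open>e^(M+1)\<close> on a smaller disc, and Cauchy's estimate for
  the derivative takes one more power. Comparable radii suffice, so dyadic scales can be
  linked.\<close>

lemma line_approx_compare:
  assumes F: "line_approx \<psi> (2 * M + 2) C e F" and F': "line_approx \<psi> (2 * M + 2) C e' F'"
    and C: "C > 0" and e: "0 < e" "e \<le> 1" "e / 2 \<le> e'" "e' \<le> e"
  shows "cmod (deriv F 0 - deriv F' 0) \<le> 2880 * C * e ^ M"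
proof -
  define D where "D z = F z - F' z" for z
  have e': "0 < e'" "e' \<le> 1" using e by auto
  have sub: "ball 0 e' \<subseteq> ball (0::complex) e" using e by auto
  have holF: "F holomorphic_on ball 0 e'" "F' holomorphic_on ball 0 e'"
    using F F' sub by (auto simp: line_approx_def intro: holomorphic_on_subset)
  then have hol: "D holomorphic_on ball 0 e'" unfolding D_def by (intro holomorphic_intros)
  have D: "cmod (D z) \<le> 2 * C" if "z \<in> ball 0 e'" for z
    using F F' that sub norm_triangle_ineq4[of "F z" "F' z"] unfolding line_approx_def D_def by fastforce
  have re: "cmod (D (of_real s)) \<le> 2 * C * e ^ (2 * M + 2)" if s: "\<bar>s\<bar> < e'" for s
  proof -
    have 1: "cmod (\<psi> s - F (of_real s)) \<le> C * e ^ (2 * M + 2)"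
      using F s e unfolding line_approx_def by auto
    have 2: "cmod (\<psi> s - F' (of_real s)) \<le> C * e' ^ (2 * M + 2)"
      using F' s unfolding line_approx_def by auto
    have "e' ^ (2 * M + 2) \<le> e ^ (2 * M + 2)" using e e' by (intro power_mono) auto
    then have "C * e' ^ (2 * M + 2) \<le> C * e ^ (2 * M + 2)" using C by simp
    with 1 2 have "cmod ((\<psi> s - F' (of_real s)) - (\<psi> s - F (of_real s))) \<le> 2 * C * e ^ (2 * M + 2)"
      using norm_triangle_ineq4[of "\<psi> s - F' (of_real s)" "\<psi> s - F (of_real s)"] by linarith
    then show ?thesis by (simp add: D_def)
  qed
  have small: "cmod (D z) \<le> 10 * C * e ^ (M + 1)" if z: "z \<in> ball 0 (e' / 72)" for z
  proof -
    have "e ^ (2 * M + 2) \<le> 1" using e by (intro power_le_one) auto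
    then have "2 * C * e ^ (2 * M + 2) \<le> 2 * C" "0 < 2 * C * e ^ (2 * M + 2)"
      using C e by (auto simp: mult_left_le simp del: power_Suc)
    then have "cmod (D z) \<le> 5 * sqrt ((2 * C) * (2 * C * e ^ (2 * M + 2)))"
      using z by (intro small_on_reals_imp_small[OF hol e'(1) D re]) auto
    also have "(2 * C) * (2 * C * e ^ (2 * M + 2)) = (2 * C * e ^ (M + 1))\<^sup>2"
    proof -
      have "2 * M + 2 = (M + 1) + (M + 1)" by simp
      then have "e ^ (2 * M + 2) = e ^ (M + 1) * e ^ (M + 1)" by (simp only: power_add)
      then show ?thesis by (simp only: power2_eq_square mult_ac)
    qed
    also have "sqrt \<dots> = 2 * C * e ^ (M + 1)" using C e by (simp add: real_sqrt_abs del: power_Suc)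
    finally show ?thesis by simp
  qed
  have "cmod ((deriv ^^ 1) D 0) \<le> fact 1 * (10 * C * e ^ (M + 1)) * (2 / (e' / 72)) ^ 1"
    by (rule holomorphic_deriv_bound) (use small e' hol in \<open>auto intro: holomorphic_on_subset\<close>)
  also have "deriv D 0 = deriv F 0 - deriv F' 0"
    unfolding D_def using holF e'
    by (intro deriv_diff) (auto simp: holomorphic_on_imp_differentiable_at[OF _ open_ball])
  then have "(deriv ^^ 1) D 0 = deriv F 0 - deriv F' 0" by simp
  finally have "cmod (deriv F 0 - deriv F' 0) \<le> 10 * C * e ^ (M + 1) * (144 / e')" by simp
  also have "\<dots> \<le> 10 * C * e ^ (M + 1) * (144 / (e / 2))"
    using e e' C by (intro mult_left_mono divide_left_mono) auto
  also have "\<dots> = 2880 * C * e ^ M" using e by simp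
  finally show ?thesis .
qed

text \<open>The choice \<open>|s| = e^3\<close> balances the errors. The quadratic Taylor tail is of
  order \<open>(|s| / e)^2 = |s| e\<close>, and the approximation error \<open>e^N \<le> e^4\<close>
  is of the same order. Both are small compared with \<open>|s|\<close>.\<close>

lemma line_approx_increment:
  assumes F: "line_approx \<psi> N C e F" and N: "N \<ge> 4" and C: "C > 0" and e: "0 < e" "e \<le> 1/2" and s: "\<bar>s\<bar> = e ^ 3"
  shows "cmod (\<psi> s - \<psi> 0 - of_real s * deriv F 0) \<le> 10 * C * \<bar>s\<bar> * e"
proof -
  have hol: "F holomorphic_on ball 0 e" and bd: "\<And>z. z \<in> ball 0 e \<Longrightarrow> cmod (F z) \<le> C"
    using F by (auto simp: line_approx_def)
  have e3: "e ^ 3 \<le> e / 4"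
  proof -
    have "e ^ 2 \<le> (1/2) ^ 2" using e by (intro power_mono) auto
    then have "e * e ^ 2 \<le> e * (1/4)" using e by (intro mult_left_mono) (auto simp: power2_eq_square)
    then show ?thesis by (simp add: power2_eq_square power3_eq_cube)
  qed
  have p: "poly (\<Sum>n\<le>1. monom ((deriv ^^ n) F 0 / fact n) n) (of_real s) = F 0 + of_real s * deriv F 0"
    by (simp add: poly_monom)
  have "cmod (F (of_real s) - (F 0 + of_real s * deriv F 0)) \<le> 2 * C * (2 * cmod (of_real s) / e) ^ Suc 1"
    using holomorphic_Taylor_tail[OF hol e(1) bd, of "of_real s" 1] s e3 unfolding p by simp
  also have "\<dots> = 8 * C * (\<bar>s\<bar> * (\<bar>s\<bar> / e\<^sup>2))" by (simp add: power2_eq_square)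
  also have "\<bar>s\<bar> / e\<^sup>2 = e" using s e by (simp add: power2_eq_square power3_eq_cube)
  finally have 1: "cmod (F (of_real s) - (F 0 + of_real s * deriv F 0)) \<le> 8 * C * \<bar>s\<bar> * e" by simp
  have "e ^ N \<le> e ^ 4" using N e by (intro power_decreasing) auto
  also have "\<dots> = \<bar>s\<bar> * e" using s by (simp add: power3_eq_cube power4_eq_xxxx)
  finally have eN: "C * e ^ N \<le> C * \<bar>s\<bar> * e" using C by (simp add: mult.assoc)
  have se: "\<bar>s\<bar> < e" using s e3 e by linarith
  have 2: "cmod (\<psi> s - F (of_real s)) \<le> C * e ^ N" using F se by (auto simp: line_approx_def)
  have 3: "cmod (\<psi> 0 - F 0) \<le> C * e ^ N" using F e(1) unfolding line_approx_def by (metis abs_zero of_real_0)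
  have "\<psi> s - \<psi> 0 - of_real s * deriv F 0 = (F (of_real s) - (F 0 + of_real s * deriv F 0)) + ((\<psi> s - F (of_real s)) - (\<psi> 0 - F 0))"
    by simp
  then have "cmod (\<psi> s - \<psi> 0 - of_real s * deriv F 0) \<le> cmod (F (of_real s) - (F 0 + of_real s * deriv F 0)) + (cmod (\<psi> s - F (of_real s)) + cmod (\<psi> 0 - F 0))"
    by (metis add_left_mono norm_triangle_ineq norm_triangle_ineq4 order_trans)
  then show ?thesis using 1 2 3 eN by linarith
qed

text \<open>The derivatives at 0 of the approximants at the dyadic scales form a Cauchy sequence,
  and its limit \<open>a\<close> is the derivative of \<open>\<psi>\<close>. Differentiability is
  thus a conclusion; nothing but the approximants is known about \<open>\<psi>\<close>.\<close>

lemma line_approx_derivative: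
  assumes ex: "\<And>e. 0 < e \<Longrightarrow> e \<le> e0 \<Longrightarrow> \<exists>F. line_approx \<psi> (2 * M + 2) C e F"
    and M: "M \<ge> 1" and C: "C > 0" and e0: "0 < e0" "e0 \<le> 1/2"
  obtains a where
    "\<And>e F. 0 < e \<Longrightarrow> e \<le> e0 \<Longrightarrow> line_approx \<psi> (2 * M + 2) C e F \<Longrightarrow> cmod (deriv F 0 - a) \<le> 9000 * C * e ^ M"
    "\<And>s e. 0 < e \<Longrightarrow> e \<le> e0 \<Longrightarrow> \<bar>s\<bar> \<le> e ^ 3 \<Longrightarrow> cmod (\<psi> s - \<psi> 0 - of_real s * a) \<le> 10000 * C * \<bar>s\<bar> * e"
proof -
  define ei where "ei i = e0 / 2 ^ i" for i :: nat
  have ei: "0 < ei i" "ei i \<le> e0" "ei i \<le> 1" for i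
  proof -
    show "0 < ei i" using e0 by (simp add: ei_def)
    show 1: "ei i \<le> e0" using e0 by (simp add: ei_def divide_le_eq)
    then show "ei i \<le> 1" using e0 by linarith
  qed
  have "\<forall>i. \<exists>F. line_approx \<psi> (2 * M + 2) C (ei i) F" using ex ei by blast
  then obtain Fi where Fi: "\<And>i. line_approx \<psi> (2 * M + 2) C (ei i) (Fi i)" by metis
  define d where "d i = deriv (Fi i) 0" for i
  have step: "cmod (d i - d (Suc i)) \<le> 2880 * C * ei i ^ M" for i
    unfolding d_def by (rule line_approx_compare[OF Fi Fi C]) (use ei[of i] ei[of "Suc i"] in \<open>auto simp: ei_def\<close>)
  have geo: "ei (i + k) ^ M \<le> ei i ^ M * (1/2) ^ k" for i k
  proof -
    have "ei (i + k) ^ M = ei i ^ M * ((1/2) ^ k) ^ M" by (simp add: ei_def power_add power_divide power_mult_distrib)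
    also have "((1/2::real) ^ k) ^ M \<le> ((1/2) ^ k) ^ 1" using M by (intro power_decreasing) (auto simp: power_le_one)
    finally show ?thesis using ei[of i] by (simp add: mult_left_mono)
  qed
  have sum1: "(\<lambda>k. 2880 * C * ei i ^ M * (1/2) ^ k) sums (2880 * C * ei i ^ M * 2)" for i
    using sums_mult[OF geometric_sums[of "1/2::real"], of "2880 * C * ei i ^ M"] by simp
  have incr: "cmod (d (i + Suc k) - d (i + k)) \<le> 2880 * C * ei i ^ M * (1/2) ^ k" for i k
  proof -
    have "cmod (d (i + Suc k) - d (i + k)) \<le> 2880 * C * ei (i + k) ^ M"
      using step[of "i + k"] by (simp add: norm_minus_commute)
    also have "\<dots> \<le> 2880 * C * (ei i ^ M * (1/2) ^ k)" using geo[of i k] C by (intro mult_left_mono) auto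
    finally show ?thesis by (simp add: mult.assoc)
  qed
  have sumd: "summable (\<lambda>k. d (i + Suc k) - d (i + k))" for i
    by (rule summable_comparison_test'[OF sums_summable[OF sum1[of i]]]) (use incr in blast)
  have "convergent d"
  proof -
    have "(\<lambda>n. \<Sum>k<n. d (0 + Suc k) - d (0 + k)) \<longlonglongrightarrow> (\<Sum>k. d (0 + Suc k) - d (0 + k))"
      by (rule summable_LIMSEQ[OF sumd])
    then have "(\<lambda>n. d n - d 0) \<longlonglongrightarrow> (\<Sum>k. d (0 + Suc k) - d (0 + k))"
      by (simp add: sum_lessThan_telescope)
    from tendsto_add[OF this tendsto_const[of "d 0"]] show ?thesis by (auto simp: convergent_def)
  qed
  then obtain a where a: "d \<longlonglongrightarrow> a" by (auto simp: convergent_def)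
  have da: "cmod (d i - a) \<le> 5760 * C * ei i ^ M" for i
  proof -
    have "(\<lambda>k. d (i + k)) \<longlonglongrightarrow> a" using LIMSEQ_ignore_initial_segment[OF a, of i] by (simp add: add.commute)
    from telescope_sums[OF this] have "(\<lambda>k. d (i + Suc k) - d (i + k)) sums (a - d (i + 0))" .
    then have eq: "a - d i = (\<Sum>k. d (i + Suc k) - d (i + k))" by (simp add: sums_iff)
    have sn: "summable (\<lambda>k. cmod (d (i + Suc k) - d (i + k)))"
      by (rule summable_comparison_test'[OF sums_summable[OF sum1[of i]]]) (use incr in simp)
    have "cmod (a - d i) \<le> (\<Sum>k. cmod (d (i + Suc k) - d (i + k)))" unfolding eq by (rule summable_norm[OF sn])
    also have "\<dots> \<le> 2880 * C * ei i ^ M * 2"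
      unfolding sums_unique[OF sum1[of i]] by (intro suminf_le incr sn sums_summable[OF sum1[of i]])
    finally show ?thesis by (simp add: norm_minus_commute)
  qed
  have near: "cmod (deriv F 0 - a) \<le> 9000 * C * e ^ M" if e: "0 < e" "e \<le> e0" and F: "line_approx \<psi> (2 * M + 2) C e F" for e F
  proof -
    obtain n where n: "e0 / e < 2 ^ n" using real_arch_pow[of 2 "e0 / e"] by auto
    then have ex: "ei n \<le> e" using e by (simp add: ei_def field_simps)
    \<comment> \<open>The first dyadic scale not above \<open>e\<close> is at least
      \<open>e / 2\<close>, so the two scales are comparable. The constants add up to 2880 + 5760,
      below 9000.\<close>
    define i where "i = (LEAST n. ei n \<le> e)"
    have i: "ei i \<le> e" unfolding i_def by (rule LeastI[of "\<lambda>n. ei n \<le> e", OF ex])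
    have i2: "e / 2 \<le> ei i"
    proof (cases i)
      case 0
      then show ?thesis using e by (simp add: ei_def)
    next
      case (Suc k)
      then have "\<not> ei k \<le> e" using not_less_Least[of k "\<lambda>n. ei n \<le> e"] by (simp add: i_def)
      then show ?thesis by (simp add: Suc ei_def)
    qed
    have "cmod (deriv F 0 - d i) \<le> 2880 * C * e ^ M"
      unfolding d_def by (rule line_approx_compare[OF F Fi C]) (use e e0 i i2 in auto)
    moreover have "5760 * C * ei i ^ M \<le> 5760 * C * e ^ M" using i ei[of i] C by (intro mult_left_mono power_mono) auto
    moreover have "cmod (deriv F 0 - a) \<le> cmod (deriv F 0 - d i) + cmod (d i - a)"
      by (metis norm_triangle_ineq diff_add_cancel add_diff_eq)
    moreover have "0 \<le> C * e ^ M" using C e by simp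
    ultimately show ?thesis using da[of i] by linarith
  qed
  show ?thesis
  proof (rule that[of a])
    show "cmod (deriv F 0 - a) \<le> 9000 * C * e ^ M" if "0 < e" "e \<le> e0" "line_approx \<psi> (2 * M + 2) C e F" for e F
      using near[OF that] .
    fix s e assume e: "0 < e" "e \<le> e0" and s: "\<bar>s\<bar> \<le> e ^ 3"
    show "cmod (\<psi> s - \<psi> 0 - of_real s * a) \<le> 10000 * C * \<bar>s\<bar> * e"
    proof (cases "s = 0")
      case False
      \<comment> \<open>For a given increment the relevant scale is its cube root, which may be much
        smaller than \<open>e\<close>. The estimate for \<open>e\<close> follows as
        \<open>e' \<le> e\<close>.\<close>
      define e' where "e' = root 3 \<bar>s\<bar>"
      have e': "0 < e'" "e' ^ 3 = \<bar>s\<bar>" using False by (auto simp: e'_def real_root_pow_pos2)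
      have "e' \<le> e" by (rule power_le_imp_le_base[of _ 2]) (use s e' e in \<open>auto simp: numeral_3_eq_3\<close>)
      then have e'0: "e' \<le> e0" "e' \<le> 1/2" using e e0 by auto
      obtain F where F: "line_approx \<psi> (2 * M + 2) C e' F" using ex[OF e'(1) e'0(1)] by auto
      have 1: "cmod (\<psi> s - \<psi> 0 - of_real s * deriv F 0) \<le> 10 * C * \<bar>s\<bar> * e'"
        by (rule line_approx_increment[OF F _ C e'(1) e'0(2)]) (use M e' in auto)
      have "e' ^ M \<le> e' ^ 1" by (rule power_decreasing) (use M e' e'0 in auto)
      then have "9000 * C * e' ^ M \<le> 9000 * C * e'" using C by simp
      then have "cmod (of_real s * (deriv F 0 - a)) \<le> \<bar>s\<bar> * (9000 * C * e')"
        using near[OF e'(1) e'0(1) F] by (simp add: norm_mult mult_left_mono)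
      moreover have tri: "cmod (\<psi> s - \<psi> 0 - of_real s * a) \<le> cmod (\<psi> s - \<psi> 0 - of_real s * deriv F 0) + cmod (of_real s * (deriv F 0 - a))"
        using norm_triangle_ineq[of "\<psi> s - \<psi> 0 - of_real s * deriv F 0" "of_real s * (deriv F 0 - a)"] by (simp add: algebra_simps)
      ultimately have "cmod (\<psi> s - \<psi> 0 - of_real s * a) \<le> 10000 * C * \<bar>s\<bar> * e'"
      proof -
        define X where "X = C * \<bar>s\<bar> * e'"
        have X: "X \<ge> 0" using C e' by (simp add: X_def)
        have "cmod (\<psi> s - \<psi> 0 - of_real s * deriv F 0) \<le> 10 * X" using 1 by (simp add: X_def)
        moreover have "cmod (of_real s * (deriv F 0 - a)) \<le> 9000 * X"
          using \<open>cmod (of_real s * (deriv F 0 - a)) \<le> \<bar>s\<bar> * (9000 * C * e')\<close> by (simp add: X_def mult_ac)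
        ultimately have "cmod (\<psi> s - \<psi> 0 - of_real s * a) \<le> 10 * X + 9000 * X"
          by (intro order_trans[OF tri add_mono])
        also have "\<dots> \<le> 10000 * X" using X by simp
        finally show ?thesis by (simp add: X_def)
      qed
      also have "\<dots> \<le> 10000 * C * \<bar>s\<bar> * e" using C \<open>e' \<le> e\<close> by (intro mult_left_mono) auto
      finally show ?thesis .
    qed simp
  qed
qed

section \<open>Smoothness from holomorphic approximation\<close>

text \<open>Approximation to every polynomial order \<open>N\<close>, locally uniformly in the base
  point and uniformly in the direction. This property presupposes no derivatives and passes from a
  function to its directional derivatives; losses in the order are irrelevant because
  \<open>N\<close> is arbitrary.\<close>

definition holo_approx :: "'a::euclidean_space set \<Rightarrow> ('a \<Rightarrow> complex) \<Rightarrow> bool" where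
  "holo_approx U \<phi> \<longleftrightarrow> (\<forall>K N. compact K \<longrightarrow> K \<subseteq> U \<longrightarrow> (\<exists>C e0. 1 \<le> C \<and> 0 < e0 \<and> e0 \<le> 1/2 \<and>
     (\<forall>x\<in>K. \<forall>v. norm v \<le> 1 \<longrightarrow> (\<forall>e. 0 < e \<and> e \<le> e0 \<longrightarrow> (\<exists>F. line_approx (\<lambda>s. \<phi> (x + s *\<^sub>R v)) N C e F)))))"

definition dir_deriv :: "('a::real_normed_vector \<Rightarrow> complex) \<Rightarrow> 'a \<Rightarrow> 'a \<Rightarrow> complex" where
  "dir_deriv \<phi> v x = vector_derivative (\<lambda>s. \<phi> (x + s *\<^sub>R v)) (at 0)"

lemma compact_nbhd:
  fixes K :: "'a::euclidean_space set"
  assumes "compact K" "K \<subseteq> U" "open U"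
  obtains r K' where "0 < r" "compact K'" "K' \<subseteq> U" "\<And>x. x \<in> K \<Longrightarrow> cball x r \<subseteq> K'"
proof -
  obtain r where r: "r > 0" "(\<Union>x\<in>K. cball x r) \<subseteq> U"
    using compact_subset_open_imp_cball_epsilon_subset[OF assms(1,3,2)] by blast
  show ?thesis by (rule that[of r "\<Union>x\<in>K. cball x r"]) (use r compact_minkowski_sum_cball[OF assms(1)] in auto)
qed

text \<open>The definition does not force the segments into \<open>U\<close>. Shrinking
  \<open>e0\<close> below the distance \<open>r\<close> does, so that only values on
  \<open>U\<close> matter.\<close>

lemma holo_approx_cong:
  fixes U :: "'a::euclidean_space set"
  assumes U: "open U" and eq: "\<And>x. x \<in> U \<Longrightarrow> \<phi> x = \<phi>' x" and g: "holo_approx U \<phi>"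
  shows "holo_approx U \<phi>'"
  unfolding holo_approx_def
proof (intro allI impI)
  fix K :: "'a set" and N assume K: "compact K" "K \<subseteq> U"
  obtain r K' where r: "0 < r" "K' \<subseteq> U" "\<And>x. x \<in> K \<Longrightarrow> cball x r \<subseteq> K'"
    using compact_nbhd[OF K U] by metis
  obtain C e0 where C: "1 \<le> C" "0 < e0" "e0 \<le> 1/2"
    and ap: "\<And>x v e. x \<in> K \<Longrightarrow> norm v \<le> 1 \<Longrightarrow> 0 < e \<Longrightarrow> e \<le> e0 \<Longrightarrow> \<exists>F. line_approx (\<lambda>s. \<phi> (x + s *\<^sub>R v)) N C e F"
    using g K unfolding holo_approx_def by metis
  show "\<exists>C e0. 1 \<le> C \<and> 0 < e0 \<and> e0 \<le> 1/2 \<and>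
     (\<forall>x\<in>K. \<forall>v. norm v \<le> 1 \<longrightarrow> (\<forall>e. 0 < e \<and> e \<le> e0 \<longrightarrow> (\<exists>F. line_approx (\<lambda>s. \<phi>' (x + s *\<^sub>R v)) N C e F)))"
  proof (rule exI[of _ C], rule exI[of _ "min e0 r"], intro conjI ballI allI impI)
    fix x v :: 'a and e assume x: "x \<in> K" "norm v \<le> 1" and e: "0 < e \<and> e \<le> min e0 r"
    obtain F where F: "line_approx (\<lambda>s. \<phi> (x + s *\<^sub>R v)) N C e F" using ap[OF x] e by auto
    have "\<phi> (x + s *\<^sub>R v) = \<phi>' (x + s *\<^sub>R v)" if s: "\<bar>s\<bar> < e" for s
    proof (rule eq)
      have "\<bar>s\<bar> * norm v \<le> r * 1" by (rule mult_mono) (use s e x in auto)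
      then show "x + s *\<^sub>R v \<in> U" using r(2) r(3)[OF x(1)] by (force simp: dist_norm)
    qed
    then show "\<exists>F. line_approx (\<lambda>s. \<phi>' (x + s *\<^sub>R v)) N C e F"
      using F unfolding line_approx_def by (intro exI[of _ F]) auto
  qed (use C r in auto)
qed

lemma holo_approx_cmult:
  fixes U :: "'a::euclidean_space set"
  assumes g: "holo_approx U \<phi>"
  shows "holo_approx U (\<lambda>x. c * \<phi> x)"
  unfolding holo_approx_def
proof (intro allI impI)
  fix K :: "'a set" and N assume K: "compact K" "K \<subseteq> U"
  obtain C e0 where C: "1 \<le> C" "0 < e0" "e0 \<le> 1/2"
    and ap: "\<And>x v e. x \<in> K \<Longrightarrow> norm v \<le> 1 \<Longrightarrow> 0 < e \<Longrightarrow> e \<le> e0 \<Longrightarrow> \<exists>F. line_approx (\<lambda>s. \<phi> (x + s *\<^sub>R v)) N C e F"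
    using g K unfolding holo_approx_def by metis
  show "\<exists>C e0. 1 \<le> C \<and> 0 < e0 \<and> e0 \<le> 1/2 \<and>
     (\<forall>x\<in>K. \<forall>v. norm v \<le> 1 \<longrightarrow> (\<forall>e. 0 < e \<and> e \<le> e0 \<longrightarrow> (\<exists>F. line_approx (\<lambda>s. c * \<phi> (x + s *\<^sub>R v)) N C e F)))"
  proof (rule exI[of _ "C + cmod c * C"], rule exI[of _ e0], intro conjI ballI allI impI)
    show "1 \<le> C + cmod c * C" using C by (simp add: add_increasing2)
    fix x v :: 'a and e assume x: "x \<in> K" "norm v \<le> 1" and e: "0 < e \<and> e \<le> e0"
    obtain F where F: "line_approx (\<lambda>s. \<phi> (x + s *\<^sub>R v)) N C e F" using ap[OF x] e by auto
    have "line_approx (\<lambda>s. c * \<phi> (x + s *\<^sub>R v)) N (C + cmod c * C) e (\<lambda>z. c * F z)"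
      unfolding line_approx_def
    proof (intro conjI ballI allI impI)
      show "(\<lambda>z. c * F z) holomorphic_on ball 0 e" using F unfolding line_approx_def by (intro holomorphic_intros) auto
      show "cmod (c * F z) \<le> C + cmod c * C" if "z \<in> ball 0 e" for z
        using F that C mult_left_mono[of "cmod (F z)" C "cmod c"] by (auto simp: line_approx_def norm_mult)
      fix s :: real assume s: "\<bar>s\<bar> < e"
      have "cmod (c * \<phi> (x + s *\<^sub>R v) - c * F (of_real s)) = cmod c * cmod (\<phi> (x + s *\<^sub>R v) - F (of_real s))"
        by (simp add: right_diff_distrib flip: norm_mult)
      also have "\<dots> \<le> cmod c * (C * e ^ N)" using F s by (intro mult_left_mono) (auto simp: line_approx_def)
      also have "\<dots> \<le> (C + cmod c * C) * e ^ N" using C e by (simp add: algebra_simps)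
      finally show "cmod (c * \<phi> (x + s *\<^sub>R v) - c * F (of_real s)) \<le> (C + cmod c * C) * e ^ N" .
    qed
    then show "\<exists>F. line_approx (\<lambda>s. c * \<phi> (x + s *\<^sub>R v)) N (C + cmod c * C) e F" by blast
  qed (use C in auto)
qed

text \<open>\<open>dir_deriv\<close> is total by convention. The increment estimate proves that the
  limit \<open>a\<close> of the approximants' derivatives is an actual derivative, and only then do
  both agree.\<close>

lemma dir_deriv_estimates:
  fixes U :: "'a::euclidean_space set"
  assumes g: "holo_approx U \<phi>" and K: "compact K" "K \<subseteq> U" and M: "M \<ge> 1"
  obtains C e0 where "1 \<le> C" "0 < e0" "e0 \<le> 1/2"
    "\<And>x v e. x \<in> K \<Longrightarrow> norm v \<le> 1 \<Longrightarrow> 0 < e \<Longrightarrow> e \<le> e0 \<Longrightarrow> \<exists>F. line_approx (\<lambda>s. \<phi> (x + s *\<^sub>R v)) (2 * M + 2) C e F"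
    "\<And>x v e F. x \<in> K \<Longrightarrow> norm v \<le> 1 \<Longrightarrow> 0 < e \<Longrightarrow> e \<le> e0 \<Longrightarrow> line_approx (\<lambda>s. \<phi> (x + s *\<^sub>R v)) (2 * M + 2) C e F
       \<Longrightarrow> cmod (deriv F 0 - dir_deriv \<phi> v x) \<le> 9000 * C * e ^ M"
    "\<And>x v e s. x \<in> K \<Longrightarrow> norm v \<le> 1 \<Longrightarrow> 0 < e \<Longrightarrow> e \<le> e0 \<Longrightarrow> \<bar>s\<bar> \<le> e ^ 3 \<Longrightarrow>
       cmod (\<phi> (x + s *\<^sub>R v) - \<phi> x - of_real s * dir_deriv \<phi> v x) \<le> 10000 * C * \<bar>s\<bar> * e"
    "\<And>x v. x \<in> K \<Longrightarrow> norm v \<le> 1 \<Longrightarrow> ((\<lambda>s. \<phi> (x + s *\<^sub>R v)) has_vector_derivative dir_deriv \<phi> v x) (at 0)"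
proof -
  obtain C e0 where C: "1 \<le> C" "0 < e0" "e0 \<le> 1/2"
    and ap: "\<And>x v e. x \<in> K \<Longrightarrow> norm v \<le> 1 \<Longrightarrow> 0 < e \<Longrightarrow> e \<le> e0 \<Longrightarrow> \<exists>F. line_approx (\<lambda>s. \<phi> (x + s *\<^sub>R v)) (2 * M + 2) C e F"
    using g K unfolding holo_approx_def by metis
  have *: "(\<forall>e F. 0 < e \<longrightarrow> e \<le> e0 \<longrightarrow> line_approx (\<lambda>s. \<phi> (x + s *\<^sub>R v)) (2 * M + 2) C e F \<longrightarrow>
        cmod (deriv F 0 - dir_deriv \<phi> v x) \<le> 9000 * C * e ^ M) \<and>
      (\<forall>s e. 0 < e \<longrightarrow> e \<le> e0 \<longrightarrow> \<bar>s\<bar> \<le> e ^ 3 \<longrightarrow> cmod (\<phi> (x + s *\<^sub>R v) - \<phi> x - of_real s * dir_deriv \<phi> v x) \<le> 10000 * C * \<bar>s\<bar> * e) \<and>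
      ((\<lambda>s. \<phi> (x + s *\<^sub>R v)) has_vector_derivative dir_deriv \<phi> v x) (at 0)"
    if x: "x \<in> K" "norm v \<le> 1" for x v
  proof -
    have C0: "C > 0" using C by simp
    obtain a where a: "\<And>e F. 0 < e \<Longrightarrow> e \<le> e0 \<Longrightarrow> line_approx (\<lambda>s. \<phi> (x + s *\<^sub>R v)) (2 * M + 2) C e F \<Longrightarrow> cmod (deriv F 0 - a) \<le> 9000 * C * e ^ M"
      and b: "\<And>s e. 0 < e \<Longrightarrow> e \<le> e0 \<Longrightarrow> \<bar>s\<bar> \<le> e ^ 3 \<Longrightarrow> cmod (\<phi> (x + s *\<^sub>R v) - \<phi> (x + 0 *\<^sub>R v) - of_real s * a) \<le> 10000 * C * \<bar>s\<bar> * e"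
      using line_approx_derivative[OF ap[OF x] M C0 C(2,3)] by metis
    have "((\<lambda>s. \<phi> (x + s *\<^sub>R v)) has_vector_derivative a) (at 0)"
      unfolding has_vector_derivative_def has_derivative_at_alt
    proof (intro conjI allI impI)
      fix \<epsilon> :: real assume eps: "\<epsilon> > 0"
      define e where "e = min e0 (\<epsilon> / (10000 * C))"
      have e: "0 < e" "e \<le> e0" "10000 * C * e \<le> \<epsilon>"
        using eps C by (auto simp: e_def min_def field_simps)
      show "\<exists>d>0. \<forall>y. norm (y - 0) < d \<longrightarrow> norm (\<phi> (x + y *\<^sub>R v) - \<phi> (x + 0 *\<^sub>R v) - (y - 0) *\<^sub>R a) \<le> \<epsilon> * norm (y - 0)"
      proof (intro exI[of _ "e ^ 3"] conjI allI impI)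
        show "e ^ 3 > 0" using e by simp
        fix y :: real assume "norm (y - 0) < e ^ 3"
        then have "cmod (\<phi> (x + y *\<^sub>R v) - \<phi> (x + 0 *\<^sub>R v) - of_real y * a) \<le> 10000 * C * \<bar>y\<bar> * e"
          using e by (intro b) auto
        also have "\<dots> = (10000 * C * e) * \<bar>y\<bar>" by simp
        also have "\<dots> \<le> \<epsilon> * \<bar>y\<bar>" by (rule mult_right_mono[OF e(3)]) simp
        finally show "norm (\<phi> (x + y *\<^sub>R v) - \<phi> (x + 0 *\<^sub>R v) - (y - 0) *\<^sub>R a) \<le> \<epsilon> * norm (y - 0)"
          by (simp add: scaleR_conv_of_real)
      qed
    qed (rule bounded_linear_scaleR_left)
    moreover from this have "dir_deriv \<phi> v x = a" unfolding dir_deriv_def by (rule vector_derivative_at)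
    ultimately show ?thesis using a b by simp
  qed
  show ?thesis by (rule that[OF C ap]) (use * in blast)+
qed

lemma dir_deriv_exists:
  fixes U :: "'a::euclidean_space set"
  assumes g: "holo_approx U \<phi>" and x: "x \<in> U"
  shows "((\<lambda>s. \<phi> (x + s *\<^sub>R v)) has_vector_derivative dir_deriv \<phi> v x) (at 0)"
    and "dir_deriv \<phi> (c *\<^sub>R v) x = c *\<^sub>R dir_deriv \<phi> v x"
proof -
  have unit: "((\<lambda>s. \<phi> (x + s *\<^sub>R v)) has_vector_derivative dir_deriv \<phi> v x) (at 0)" if "norm v \<le> 1" for v
    using dir_deriv_estimates[OF g, of "{x}" 1] x that by auto
  have scale: "((\<lambda>s. \<phi> (x + s *\<^sub>R (c *\<^sub>R v))) has_vector_derivative c *\<^sub>R a) (at 0)"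
    if "((\<lambda>s. \<phi> (x + s *\<^sub>R v)) has_vector_derivative a) (at 0)" for c v a
  proof -
    have "((\<lambda>s. s * c) has_vector_derivative c) (at (0::real))"
      by (auto intro!: derivative_eq_intros simp flip: has_real_derivative_iff_has_vector_derivative)
    from vector_diff_chain_at[OF this, of "\<lambda>s. \<phi> (x + s *\<^sub>R v)" a] that show ?thesis by (simp add: o_def)
  qed
  have ex: "((\<lambda>s. \<phi> (x + s *\<^sub>R v)) has_vector_derivative dir_deriv \<phi> v x) (at 0)" for v
  proof -
    define n where "n = 1 + norm v"
    have n: "n > 0" "norm ((1 / n) *\<^sub>R v) \<le> 1" by (auto simp: n_def add_pos_nonneg)
    from scale[OF unit[OF n(2)], of n] n(1) have "((\<lambda>s. \<phi> (x + s *\<^sub>R v)) has_vector_derivative n *\<^sub>R dir_deriv \<phi> ((1 / n) *\<^sub>R v) x) (at 0)"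
      by simp
    then show ?thesis unfolding dir_deriv_def using vector_derivative_at by metis
  qed
  show "((\<lambda>s. \<phi> (x + s *\<^sub>R v)) has_vector_derivative dir_deriv \<phi> v x) (at 0)" by (rule ex)
  show "dir_deriv \<phi> (c *\<^sub>R v) x = c *\<^sub>R dir_deriv \<phi> v x"
    unfolding dir_deriv_def[of \<phi> "c *\<^sub>R v"] by (rule vector_derivative_at[OF scale[OF ex]])
qed

text \<open>Every nearby point lies on a line through \<open>x\<close>, and the constants do not
  depend on its direction. For distances below \<open>e^2 / 2\<close> the approximant varies by
  \<open>O(e)\<close>, and the approximation error is at most \<open>O(e)\<close> as well.\<close>

lemma holo_approx_continuous:
  fixes U :: "'a::euclidean_space set"
  assumes g: "holo_approx U \<phi>" and x: "x \<in> U"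
  shows "isCont \<phi> x"
proof -
  obtain C e0 where C: "1 \<le> C" "0 < e0" "e0 \<le> 1/2"
    and ap: "\<And>v e. norm v \<le> 1 \<Longrightarrow> 0 < e \<Longrightarrow> e \<le> e0 \<Longrightarrow> \<exists>F. line_approx (\<lambda>s. \<phi> (x + s *\<^sub>R v)) 4 C e F"
    using g[unfolded holo_approx_def, rule_format, of "{x}" 4] x by auto
  show ?thesis unfolding continuous_at_eps_delta
  proof (intro allI impI)
    fix \<epsilon> :: real assume eps: "\<epsilon> > 0"
    define e where "e = min e0 (\<epsilon> / (10 * C))"
    have e: "0 < e" "e \<le> e0" "e \<le> \<epsilon> / (10 * C)" using eps C by (auto simp: e_def)
    then have e': "10 * C * e \<le> \<epsilon>" "e \<le> 1/2" using C by (auto simp: field_simps)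
    note e = e e'
    show "\<exists>d>0. \<forall>y. dist y x < d \<longrightarrow> dist (\<phi> y) (\<phi> x) < \<epsilon>"
    proof (intro exI[of _ "e\<^sup>2 / 2"] conjI allI impI)
      show "e\<^sup>2 / 2 > 0" using e by simp
      fix y assume y: "dist y x < e\<^sup>2 / 2"
      define s where "s = norm (y - x)"
      define v where "v = (y - x) /\<^sub>R s"
      have v: "norm v \<le> 1" by (cases "s = 0") (simp_all add: v_def s_def)
      have yx: "y = x + s *\<^sub>R v" by (cases "s = 0") (simp_all add: v_def s_def)
      have s: "0 \<le> s" "s < e\<^sup>2 / 2" using y by (auto simp: s_def dist_norm)
      have e2: "e\<^sup>2 \<le> e / 2" using e by (simp add: power2_eq_square)
      have se: "s \<le> e / 4" using s e2 by linarith
      obtain F where F: "line_approx (\<lambda>s. \<phi> (x + s *\<^sub>R v)) 4 C e F" using ap[OF v e(1,2)] by auto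
      have hol: "F holomorphic_on ball 0 e" and bd: "\<And>z. z \<in> ball 0 e \<Longrightarrow> cmod (F z) \<le> C"
        and err: "\<And>s. \<bar>s\<bar> < e \<Longrightarrow> cmod (\<phi> (x + s *\<^sub>R v) - F (of_real s)) \<le> C * e ^ 4"
        using F by (auto simp: line_approx_def)
      have "cmod (F (of_real s) - F 0) \<le> 2 * C * (2 * s / e)"
        using holomorphic_Taylor_tail[OF hol e(1) bd, of "of_real s" 0] s se by (simp add: poly_monom)
      also have "\<dots> \<le> 2 * C * e"
        using s e C by (intro mult_left_mono) (auto simp: divide_le_eq power2_eq_square)
      finally have 1: "cmod (F (of_real s) - F 0) \<le> 2 * C * e" .
      have "e ^ 4 \<le> e ^ 1" using e by (intro power_decreasing) auto
      then have "C * e ^ 4 \<le> C * e" using C by simp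
      then have 2: "cmod (\<phi> y - F (of_real s)) \<le> C * e" "cmod (\<phi> x - F 0) \<le> C * e"
        using err[of s] err[of 0] s se e unfolding yx by auto
      have "cmod (\<phi> y - \<phi> x) \<le> cmod (\<phi> y - F (of_real s)) + cmod (F (of_real s) - F 0) + cmod (\<phi> x - F 0)"
        using norm_triangle_ineq[of "\<phi> y - F (of_real s)" "F (of_real s) - F 0"]
          norm_triangle_ineq4[of "\<phi> y - F 0" "\<phi> x - F 0"] by simp
      also have "\<dots> \<le> 4 * C * e" using 1 2 by linarith
      also have "\<dots> < 10 * C * e" using C e by simp
      finally show "dist (\<phi> y) (\<phi> x) < \<epsilon>" using e by (simp add: dist_norm)
    qed
  qed
qed

text \<open>The weights are exact for the Taylor polynomial of degree \<open>m\<close>, rescaled by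
  the step \<open>t\<close>. So only the Taylor tail at the nodes contributes, divided by
  \<open>t\<close>.\<close>

lemma numeric_derivative_error:
  assumes c: "\<And>q. degree q \<le> m \<Longrightarrow> poly (pderiv q) 0 = (\<Sum>l\<le>m. c l * poly q (of_nat l))"
    and hol: "F holomorphic_on ball 0 e" and bd: "\<And>z. z \<in> ball 0 e \<Longrightarrow> cmod (F z) \<le> C"
    and m: "m > 0" and t: "t > 0" "real m * t \<le> e / 4"
  shows "cmod ((\<Sum>l\<le>m. c l * F (of_real (real l * t))) / of_real t - deriv F 0)
    \<le> (\<Sum>l\<le>m. cmod (c l)) * (2 * C * (2 * (real m * t) / e) ^ Suc m) / t"
proof -
  have "0 < real m * t" using m t by simp
  then have e: "e > 0" using t by linarith
  define P where "P = (\<Sum>n\<le>m. monom ((deriv ^^ n) F 0 / fact n) n)"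
  define P' where "P' = pcompose P [:0, of_real t:]"
  have degP: "degree P \<le> m" unfolding P_def by (rule degree_sum_le) (auto intro: order_trans[OF degree_monom_le])
  have P': "poly P' w = poly P (of_real t * w)" for w by (simp add: P'_def poly_pcompose mult.commute)
  have degP': "degree P' \<le> m" using degree_pcompose_le[of P "[:0, of_real t:]"] degP t by (simp add: P'_def)
  have cP: "coeff P 1 = deriv F 0"
    using m by (simp add: P_def coeff_sum sum.delta coeff_monom)
  have "poly (pderiv P') 0 = of_real t * deriv F 0"
    by (simp add: P'_def pderiv_pcompose poly_pcompose pderiv_pCons cP[symmetric] poly_0_coeff_0 coeff_pderiv mult.commute)
  then have id: "of_real t * deriv F 0 = (\<Sum>l\<le>m. c l * poly P (of_real (real l * t)))"
    using c[OF degP'] by (simp add: P' mult.commute)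
  have tail: "cmod (F (of_real (real l * t)) - poly P (of_real (real l * t))) \<le> 2 * C * (2 * (real m * t) / e) ^ Suc m"
    if l: "l \<le> m" for l
  proof -
    have lt: "real l * t \<le> real m * t" using l t by (intro mult_right_mono) auto
    have "cmod (of_real (real l * t)) = real l * t" using t by (simp add: norm_mult)
    then have "cmod (F (of_real (real l * t)) - poly P (of_real (real l * t))) \<le> 2 * C * (2 * (real l * t) / e) ^ Suc m"
      using holomorphic_Taylor_tail[OF hol e bd, of "of_real (real l * t)" m] lt t unfolding P_def by simp
    also have "\<dots> \<le> 2 * C * (2 * (real m * t) / e) ^ Suc m"
      using lt t e order_trans[OF norm_ge_zero bd[of 0]] by (intro mult_left_mono power_mono divide_right_mono) auto
    finally show ?thesis .
  qed
  have "(\<Sum>l\<le>m. c l * (F (of_real (real l * t)) - poly P (of_real (real l * t))))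
      = (\<Sum>l\<le>m. c l * F (of_real (real l * t))) - of_real t * deriv F 0"
    unfolding id right_diff_distrib sum_subtractf ..
  then have "(\<Sum>l\<le>m. c l * F (of_real (real l * t))) / of_real t - deriv F 0
      = (\<Sum>l\<le>m. c l * (F (of_real (real l * t)) - poly P (of_real (real l * t)))) / of_real t"
    using t by (simp only: diff_divide_distrib) simp
  also have "cmod \<dots> \<le> (\<Sum>l\<le>m. cmod (c l) * (2 * C * (2 * (real m * t) / e) ^ Suc m)) / t"
  proof -
    have "cmod (\<Sum>l\<le>m. c l * (F (of_real (real l * t)) - poly P (of_real (real l * t))))
        \<le> (\<Sum>l\<le>m. cmod (c l) * (2 * C * (2 * (real m * t) / e) ^ Suc m))"
      by (rule sum_norm_le, subst norm_mult, rule mult_left_mono) (use tail in auto)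
    then show ?thesis unfolding norm_divide norm_of_real using t by (simp add: divide_right_mono)
  qed
  finally show ?thesis by (simp only: sum_distrib_right)
qed

text \<open>The approximant of the derivative in direction \<open>v\<close> along a line in
  direction \<open>w\<close> is a numerical derivative: the approximants \<open>F l\<close> on the
  parallel lines through \<open>x + l t v\<close> are combined with the weights \<open>c l\<close>
  and divided by \<open>t\<close>. At a real point of the line this is compared with the approximant
  \<open>A\<close> on the transversal line in direction \<open>v\<close>, whose derivative is
  already known to be close to \<open>dir_deriv\<close>.\<close>

lemma holo_approx_dir_deriv:
  fixes U :: "'a::euclidean_space set"
  assumes U: "open U" and g: "holo_approx U \<phi>" and v: "norm v \<le> 1"
  shows "holo_approx U (dir_deriv \<phi> v)"
  unfolding holo_approx_def
proof (intro allI impI)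
  fix K :: "'a set" and N :: nat assume K: "compact K" "K \<subseteq> U"
  obtain r K' where r: "0 < r" "compact K'" "K' \<subseteq> U" "\<And>x. x \<in> K \<Longrightarrow> cball x r \<subseteq> K'"
    using compact_nbhd[OF K U] by metis
  \<comment> \<open>With \<open>t\<close> of order \<open>e^3\<close>, the three errors are of order
    \<open>e^(2 m + 2) / t\<close>, \<open>(e^2)^(m+1) / t\<close> and \<open>e^m\<close>. For
    \<open>m = 4 N + 1\<close> each is at most of order \<open>(e^4)^N\<close>, the accuracy
    required at the new radius \<open>e^4\<close>.\<close>
  define m where "m = 4 * N + 1"
  have m: "m \<ge> 1" "m > 0" by (auto simp: m_def)
  obtain C e0 where C: "1 \<le> C" "0 < e0" "e0 \<le> 1/2"
    and ap: "\<And>x w e. x \<in> K' \<Longrightarrow> norm w \<le> 1 \<Longrightarrow> 0 < e \<Longrightarrow> e \<le> e0 \<Longrightarrow> \<exists>F. line_approx (\<lambda>s. \<phi> (x + s *\<^sub>R w)) (2 * m + 2) C e F"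
    and near: "\<And>x w e F. x \<in> K' \<Longrightarrow> norm w \<le> 1 \<Longrightarrow> 0 < e \<Longrightarrow> e \<le> e0 \<Longrightarrow> line_approx (\<lambda>s. \<phi> (x + s *\<^sub>R w)) (2 * m + 2) C e F
       \<Longrightarrow> cmod (deriv F 0 - dir_deriv \<phi> w x) \<le> 9000 * C * e ^ m"
    by (rule dir_deriv_estimates[OF g r(2,3) m(1)]) (rule that; blast)
  obtain c :: "nat \<Rightarrow> complex" where c': "\<forall>q. degree q \<le> m \<longrightarrow> poly (pderiv q) 0 = (\<Sum>l\<le>m. c l * poly q (of_nat l))"
    using numeric_derivative_weights[of m] ..
  then have c: "\<And>q. degree q \<le> m \<Longrightarrow> poly (pderiv q) 0 = (\<Sum>l\<le>m. c l * poly q (of_nat l))" by blast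
  define S where "S = (\<Sum>l\<le>m. cmod (c l))"
  have S: "S \<ge> 0" by (simp add: S_def sum_nonneg)
  define e1 where "e1 = Min {e0, r, 1/4}"
  have e1: "0 < e1" "e1 \<le> e0" "e1 \<le> r" "e1 \<le> 1/4" using C r by (auto simp: e1_def)
  define C3 where "C3 = 2 * S * (real m + 1) + 2 * S * (real m + 1) * 2 ^ Suc m + 9000"
  define Cn where "Cn = 4 * S * C * (real m + 1) + C * C3 + 9000 * C + 2 * C / e0"
  have C3: "C3 \<ge> 9000" using S by (simp add: C3_def)
  have Cn: "1 \<le> Cn" "C * C3 \<le> Cn"
  proof -
    have "0 \<le> 4 * S * C * (real m + 1)" "0 \<le> 2 * C / e0" "0 \<le> C * C3" using S C C3 by auto
    then show "1 \<le> Cn" "C * C3 \<le> Cn" unfolding Cn_def using C by linarith+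
  qed
  have main: "\<exists>F. line_approx (\<lambda>s. dir_deriv \<phi> v (x + s *\<^sub>R w)) N Cn (e ^ 4) F"
    if x: "x \<in> K" and w: "norm w \<le> 1" and e: "0 < e" "e \<le> e1" for x w and e :: real
  proof -
    define t where "t = e ^ 3 / (real m + 1)"
    have t: "t > 0" "1 / t = (real m + 1) / e ^ 3" using e by (auto simp: t_def)
    have mt: "real m * t \<le> e ^ 3" using e by (simp add: t_def divide_le_eq mult.commute)
    have ee: "e \<le> e0" "e \<le> r" "e \<le> 1/4" "e \<le> 1/2" using e e1 by auto
    have e3: "e ^ 3 \<le> e / 4"
    proof -
      have "e ^ 2 \<le> (1/4) ^ 2" using e ee by (intro power_mono) auto
      then have "e * e ^ 2 \<le> e * (1/4)" using e by (intro mult_left_mono) (auto simp: power2_eq_square)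
      then show ?thesis by (simp add: power2_eq_square power3_eq_cube)
    qed
    have e4: "e ^ 4 \<le> e ^ 3" "e ^ 4 \<le> e" using e ee power_decreasing[of 3 4 e] power_decreasing[of 1 4 e] by auto
    have lt: "0 \<le> real l * t" "real l * t \<le> e ^ 3" "real l * t < e" if "l \<le> m" for l
    proof -
      have "real l * t \<le> real m * t" using that t by (intro mult_right_mono) auto
      moreover have "0 \<le> real l * t" using t by simp
      ultimately show "0 \<le> real l * t" "real l * t \<le> e ^ 3" "real l * t < e" using mt e3 e by linarith+
    qed
    have inK: "x + a *\<^sub>R u \<in> K'" if "\<bar>a\<bar> \<le> e" "norm u \<le> 1" for a u
    proof -
      have "\<bar>a\<bar> * norm u \<le> r * 1" by (rule mult_mono) (use that ee r in auto)
      then show ?thesis using r(4)[OF x] by (force simp: dist_norm)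
    qed
    have "\<forall>l\<in>{..m}. \<exists>F. line_approx (\<lambda>s. \<phi> ((x + (real l * t) *\<^sub>R v) + s *\<^sub>R w)) (2 * m + 2) C e F"
    proof
      fix l assume "l \<in> {..m}"
      then have "x + (real l * t) *\<^sub>R v \<in> K'" using lt[of l] by (intro inK v) auto
      then show "\<exists>F. line_approx (\<lambda>s. \<phi> ((x + (real l * t) *\<^sub>R v) + s *\<^sub>R w)) (2 * m + 2) C e F"
        by (rule ap[OF _ w e(1) ee(1)])
    qed
    then obtain F where F: "\<And>l. l \<le> m \<Longrightarrow> line_approx (\<lambda>s. \<phi> ((x + (real l * t) *\<^sub>R v) + s *\<^sub>R w)) (2 * m + 2) C e (F l)"
      by (metis atMost_iff)
    have hol: "F l holomorphic_on ball 0 e" and bd: "\<And>z. z \<in> ball 0 e \<Longrightarrow> cmod (F l z) \<le> C"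
      and err: "\<And>s. \<bar>s\<bar> < e \<Longrightarrow> cmod (\<phi> ((x + (real l * t) *\<^sub>R v) + s *\<^sub>R w) - F l (of_real s)) \<le> C * e ^ (2 * m + 2)"
      if "l \<le> m" for l using F[OF that] by (auto simp: line_approx_def)
    define \<Phi> where "\<Phi> z = (\<Sum>l\<le>m. c l * F l z) / of_real t" for z
    have powers: "e ^ (2 * m + 2) * (1 / t) \<le> (real m + 1) * (e ^ 4) ^ N"
      "(2 * (real m * t) / e) ^ Suc m * (1 / t) \<le> 2 ^ Suc m * (real m + 1) * (e ^ 4) ^ N" "e ^ m \<le> (e ^ 4) ^ N"
    proof -
      have *: "e ^ (4 * N + 3 + k) / e ^ 3 \<le> (e ^ 4) ^ N" for k
      proof -
        have "e ^ (4 * N + 3 + k) / e ^ 3 = e ^ (4 * N + k)" using e by (simp add: power_add)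
        also have "\<dots> \<le> e ^ (4 * N)" using e ee by (intro power_decreasing) auto
        finally show ?thesis by (simp add: power_mult)
      qed
      have "e ^ (2 * m + 2) * (1 / t) = (real m + 1) * (e ^ (4 * N + 3 + (4 * N + 1)) / e ^ 3)"
      proof -
        have "2 * m + 2 = 4 * N + 3 + (4 * N + 1)" by (simp add: m_def)
        then show ?thesis unfolding t(2) by (simp only: times_divide_eq_right times_divide_eq_left mult.commute)
      qed
      also have "\<dots> \<le> (real m + 1) * (e ^ 4) ^ N" by (intro mult_left_mono *) auto
      finally show "e ^ (2 * m + 2) * (1 / t) \<le> (real m + 1) * (e ^ 4) ^ N" .
      have "2 * (real m * t) / e \<le> 2 * e\<^sup>2"
        using mt e by (simp add: divide_le_eq power2_eq_square power3_eq_cube)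
      then have "(2 * (real m * t) / e) ^ Suc m * (1 / t) \<le> (2 * e\<^sup>2) ^ Suc m * (1 / t)"
        using t e by (intro mult_right_mono power_mono) auto
      also have "\<dots> = 2 ^ Suc m * (real m + 1) * (e ^ (4 * N + 3 + (4 * N + 1)) / e ^ 3)"
      proof -
        have "(e\<^sup>2) ^ Suc m = e ^ (4 * N + 3 + (4 * N + 1))"
          unfolding power_mult[symmetric] by (rule arg_cong[of _ _ "power e"]) (simp add: m_def)
        then show ?thesis unfolding t(2) power_mult_distrib by (simp only: mult_ac times_divide_eq_right times_divide_eq_left)
      qed
      also have "\<dots> \<le> 2 ^ Suc m * (real m + 1) * (e ^ 4) ^ N" by (intro mult_left_mono *) auto
      finally show "(2 * (real m * t) / e) ^ Suc m * (1 / t) \<le> 2 ^ Suc m * (real m + 1) * (e ^ 4) ^ N" .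
      have "e ^ m \<le> e ^ (4 * N)" using e ee by (intro power_decreasing) (auto simp: m_def)
      then show "e ^ m \<le> (e ^ 4) ^ N" by (simp add: power_mult)
    qed
    have error: "cmod (dir_deriv \<phi> v (x + s *\<^sub>R w) - \<Phi> (of_real s)) \<le> C * C3 * (e ^ 4) ^ N" if s: "\<bar>s\<bar> < e ^ 4" for s
    proof -
      define y where "y = x + s *\<^sub>R w"
      have se: "\<bar>s\<bar> < e" using s e4 by linarith
      have y: "y \<in> K'" unfolding y_def by (rule inK[OF _ w]) (use se in auto)
      obtain A where A: "line_approx (\<lambda>s. \<phi> (y + s *\<^sub>R v)) (2 * m + 2) C e A" using ap[OF y v e(1) ee(1)] by auto
      have holA: "A holomorphic_on ball 0 e" and bdA: "\<And>z. z \<in> ball 0 e \<Longrightarrow> cmod (A z) \<le> C"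
        and errA: "\<And>s. \<bar>s\<bar> < e \<Longrightarrow> cmod (\<phi> (y + s *\<^sub>R v) - A (of_real s)) \<le> C * e ^ (2 * m + 2)"
        using A by (auto simp: line_approx_def)
      have n: "cmod (deriv A 0 - dir_deriv \<phi> v y) \<le> 9000 * C * e ^ m" by (rule near[OF y v e(1) ee(1) A])
      define Q where "Q = (\<Sum>l\<le>m. c l * A (of_real (real l * t))) / of_real t"
      have Q: "cmod (Q - deriv A 0) \<le> S * (2 * C * (2 * (real m * t) / e) ^ Suc m) / t"
        unfolding Q_def S_def
        by (rule numeric_derivative_error[OF c holA bdA m(2) t(1)]) (use mt e3 in auto)
      have "cmod (\<Phi> (of_real s) - Q) \<le> S * (2 * C * e ^ (2 * m + 2)) / t"
      proof -
        have "\<Phi> (of_real s) - Q = (\<Sum>l\<le>m. c l * (F l (of_real s) - A (of_real (real l * t)))) / of_real t"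
          by (simp add: \<Phi>_def Q_def right_diff_distrib sum_subtractf diff_divide_distrib)
        moreover have "cmod (\<Sum>l\<le>m. c l * (F l (of_real s) - A (of_real (real l * t)))) \<le> (\<Sum>l\<le>m. cmod (c l) * (2 * C * e ^ (2 * m + 2)))"
        proof (rule sum_norm_le, subst norm_mult, rule mult_left_mono)
          fix l assume "l \<in> {..m}"
          then have l: "l \<le> m" by simp
          have eq: "x + (real l * t) *\<^sub>R v + s *\<^sub>R w = y + (real l * t) *\<^sub>R v" by (simp add: y_def)
          have "cmod (\<phi> (y + (real l * t) *\<^sub>R v) - F l (of_real s)) \<le> C * e ^ (2 * m + 2)"
            using err[OF l se] unfolding eq .
          moreover have "cmod (\<phi> (y + (real l * t) *\<^sub>R v) - A (of_real (real l * t))) \<le> C * e ^ (2 * m + 2)"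
            using lt[OF l] by (intro errA) auto
          ultimately show "cmod (F l (of_real s) - A (of_real (real l * t))) \<le> 2 * C * e ^ (2 * m + 2)"
            using norm_triangle_ineq4[of "\<phi> (y + (real l * t) *\<^sub>R v) - A (of_real (real l * t))" "\<phi> (y + (real l * t) *\<^sub>R v) - F l (of_real s)"]
            by simp
        qed simp
        ultimately show ?thesis using t by (simp add: norm_divide divide_right_mono S_def sum_distrib_right)
      qed
      also have "\<dots> = 2 * S * C * (e ^ (2 * m + 2) * (1 / t))" by (simp add: mult_ac)
      also have "\<dots> \<le> 2 * S * C * ((real m + 1) * (e ^ 4) ^ N)" using S C by (intro mult_left_mono powers) auto
      finally have 1: "cmod (\<Phi> (of_real s) - Q) \<le> 2 * S * C * ((real m + 1) * (e ^ 4) ^ N)" .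
      have "S * (2 * C * (2 * (real m * t) / e) ^ Suc m) / t = 2 * S * C * ((2 * (real m * t) / e) ^ Suc m * (1 / t))"
        by (simp only: mult_ac times_divide_eq_right times_divide_eq_left mult_1_right)
      also have "\<dots> \<le> 2 * S * C * (2 ^ Suc m * (real m + 1) * (e ^ 4) ^ N)" using S C by (intro mult_left_mono powers) auto
      finally have 2: "cmod (Q - deriv A 0) \<le> 2 * S * C * (2 ^ Suc m * (real m + 1) * (e ^ 4) ^ N)" using Q by linarith
      have 3: "cmod (deriv A 0 - dir_deriv \<phi> v y) \<le> 9000 * C * (e ^ 4) ^ N"
        using n mult_left_mono[OF powers(3), of "9000 * C"] C by linarith
      have "cmod (dir_deriv \<phi> v y - \<Phi> (of_real s)) \<le> cmod (\<Phi> (of_real s) - Q) + (cmod (Q - deriv A 0) + cmod (deriv A 0 - dir_deriv \<phi> v y))"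
        using norm_triangle_ineq[of "\<Phi> (of_real s) - Q" "(Q - deriv A 0) + (deriv A 0 - dir_deriv \<phi> v y)"]
          norm_triangle_ineq[of "Q - deriv A 0" "deriv A 0 - dir_deriv \<phi> v y"] by (simp add: norm_minus_commute)
      also have "\<dots> \<le> 2 * S * C * ((real m + 1) * (e ^ 4) ^ N) + (2 * S * C * (2 ^ Suc m * (real m + 1) * (e ^ 4) ^ N) + 9000 * C * (e ^ 4) ^ N)"
        by (intro add_mono 1 2 3)
      also have "\<dots> = C * C3 * (e ^ 4) ^ N" unfolding C3_def by (simp only: distrib_left distrib_right mult_ac add_ac)
      finally show ?thesis by (simp add: y_def)
    qed
    \<comment> \<open>At the centre, \<open>\<Phi>\<close> is close to the directional derivative,
      which is bounded uniformly in \<open>e\<close> through the approximant \<open>A\<close> at the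
      fixed scale \<open>e0\<close>.\<close>
    have Phi0: "cmod (\<Phi> 0) \<le> C * C3 + 9000 * C + 2 * C / e0"
    proof -
      have "(e ^ 4) ^ N \<le> 1" using e ee by (intro power_le_one) (auto simp: power_le_one)
      then have "C * C3 * (e ^ 4) ^ N \<le> C * C3" using C C3 by (intro mult_left_le) auto
      then have 1: "cmod (dir_deriv \<phi> v x - \<Phi> 0) \<le> C * C3" using error[of 0] e by simp
      have xK: "x \<in> K'" using inK[of 0 0] e by simp
      obtain A where A: "line_approx (\<lambda>s. \<phi> (x + s *\<^sub>R v)) (2 * m + 2) C e0 A" using ap[OF xK v C(2)] by auto
      have 2: "cmod (deriv A 0 - dir_deriv \<phi> v x) \<le> 9000 * C * e0 ^ m" by (rule near[OF xK v C(2) _ A]) simp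
      have "e0 ^ m \<le> 1" using C by (intro power_le_one) auto
      then have 3: "9000 * C * e0 ^ m \<le> 9000 * C" using C by (intro mult_left_le) auto
      have 4: "cmod (deriv A 0) \<le> 2 * C / e0"
        using holomorphic_deriv_bound[of A 0 e0 C 1] A C by (simp add: line_approx_def mult.commute)
      show ?thesis using 1 2 3 4 norm_triangle_sub[of "\<Phi> 0" "dir_deriv \<phi> v x"] norm_triangle_sub[of "dir_deriv \<phi> v x" "deriv A 0"]
        by (simp add: norm_minus_commute)
    qed
    have bound: "cmod (\<Phi> z) \<le> Cn" if z: "z \<in> ball 0 (e ^ 4)" for z
    proof -
      have z': "cmod z < e ^ 4" using z by simp
      \<comment> \<open>The division by \<open>t\<close> would destroy the bound on the whole disc
        of radius \<open>e\<close>. On the disc of radius \<open>e^4\<close> each \<open>F l\<close>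
        varies by \<open>O(e^3)\<close> only, which is the order of \<open>t\<close>; this dictates
        the new radius.\<close>
      have "cmod (\<Phi> z - \<Phi> 0) \<le> S * (4 * C * e ^ 3) / t"
      proof -
        have "\<Phi> z - \<Phi> 0 = (\<Sum>l\<le>m. c l * (F l z - F l 0)) / of_real t"
          by (simp add: \<Phi>_def right_diff_distrib sum_subtractf diff_divide_distrib)
        moreover have "cmod (\<Sum>l\<le>m. c l * (F l z - F l 0)) \<le> (\<Sum>l\<le>m. cmod (c l) * (4 * C * e ^ 3))"
        proof (rule sum_norm_le, subst norm_mult, rule mult_left_mono)
          fix l assume "l \<in> {..m}"
          then have l: "l \<le> m" by simp
          have "cmod (F l z - F l 0) \<le> 2 * C * (2 * cmod z / e)"
            using holomorphic_Taylor_tail[OF hol[OF l] e(1) bd[OF l], of z 0] z' e4 e3 by (simp add: poly_monom)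
          also have "\<dots> \<le> 2 * C * (2 * e ^ 3)"
          proof (rule mult_left_mono)
            have "cmod z \<le> e ^ 3 * e" using z' by (simp add: power3_eq_cube power4_eq_xxxx)
            then show "2 * cmod z / e \<le> 2 * e ^ 3" using e by (simp add: divide_le_eq)
          qed (use C in auto)
          finally show "cmod (F l z - F l 0) \<le> 4 * C * e ^ 3" by simp
        qed simp
        ultimately show ?thesis using t by (simp add: norm_divide divide_right_mono S_def sum_distrib_right)
      qed
      also have "\<dots> = 4 * S * C * (e ^ 3 * (1 / t))" by (simp add: mult_ac)
      also have "e ^ 3 * (1 / t) = real m + 1" unfolding t(2) using e by simp
      finally show ?thesis using Phi0 norm_triangle_sub[of "\<Phi> z" "\<Phi> 0"] by (simp add: Cn_def)
    qed
    have "line_approx (\<lambda>s. dir_deriv \<phi> v (x + s *\<^sub>R w)) N Cn (e ^ 4) \<Phi>"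
      unfolding line_approx_def
    proof (intro conjI ballI allI impI)
      have "F l holomorphic_on ball 0 (e ^ 4)" if "l \<le> m" for l
        by (rule holomorphic_on_subset[OF hol[OF that]]) (use e4 in auto)
      then show "\<Phi> holomorphic_on ball 0 (e ^ 4)" unfolding \<Phi>_def[abs_def]
        using t by (intro holomorphic_intros) auto
      show "cmod (\<Phi> z) \<le> Cn" if "z \<in> ball 0 (e ^ 4)" for z by (rule bound[OF that])
      fix s :: real assume s: "\<bar>s\<bar> < e ^ 4"
      have "C * C3 * (e ^ 4) ^ N \<le> Cn * (e ^ 4) ^ N" using Cn e by (intro mult_right_mono) auto
      then show "cmod (dir_deriv \<phi> v (x + s *\<^sub>R w) - \<Phi> (of_real s)) \<le> Cn * (e ^ 4) ^ N"
        using error[OF s] by linarith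
    qed
    then show ?thesis by blast
  qed
  show "\<exists>C e0. 1 \<le> C \<and> 0 < e0 \<and> e0 \<le> 1/2 \<and>
     (\<forall>x\<in>K. \<forall>w. norm w \<le> 1 \<longrightarrow> (\<forall>e. 0 < e \<and> e \<le> e0 \<longrightarrow> (\<exists>F. line_approx (\<lambda>s. dir_deriv \<phi> v (x + s *\<^sub>R w)) N C e F)))"
  proof (rule exI[of _ Cn], rule exI[of _ "e1 ^ 4"], intro conjI ballI allI impI)
    have "e1 ^ 4 \<le> e1 ^ 1" using e1 by (intro power_decreasing) auto
    then show "e1 ^ 4 \<le> 1/2" using e1 by simp
    fix x w :: 'a and e assume x: "x \<in> K" "norm w \<le> 1" and e: "0 < e \<and> e \<le> e1 ^ 4"
    \<comment> \<open>The construction yields approximants on radii \<open>e^4\<close>, so a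
      prescribed radius is reached by starting from its fourth root.\<close>
    have r4: "root 4 e > 0" "root 4 e ^ 4 = e" using e by auto
    then have "root 4 e ^ Suc 3 \<le> e1 ^ Suc 3" using e by simp
    then have "root 4 e \<le> e1" by (rule power_le_imp_le_base) (use e1 in simp)
    from main[OF x r4(1) this] show "\<exists>F. line_approx (\<lambda>s. dir_deriv \<phi> v (x + s *\<^sub>R w)) N Cn e F"
      unfolding r4(2) .
  qed (use Cn e1 in auto)
qed

lemma dir_deriv_increment:
  fixes U :: "'a::euclidean_space set"
  assumes g: "holo_approx U \<phi>" and K: "compact K" "K \<subseteq> U"
  obtains C e0 where "1 \<le> C" "0 < e0" "e0 \<le> 1/2"
    "\<And>x v e s. x \<in> K \<Longrightarrow> norm v \<le> 1 \<Longrightarrow> 0 < e \<Longrightarrow> e \<le> e0 \<Longrightarrow> \<bar>s\<bar> \<le> e ^ 3 \<Longrightarrow>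
       cmod (\<phi> (x + s *\<^sub>R v) - \<phi> x - of_real s * dir_deriv \<phi> v x) \<le> 10000 * C * \<bar>s\<bar> * e"
proof (rule dir_deriv_estimates[OF g K order_refl])
  fix C e0 :: real
  assume "1 \<le> C" "0 < e0" "e0 \<le> 1/2"
    "\<And>x v e s. x \<in> K \<Longrightarrow> norm v \<le> 1 \<Longrightarrow> 0 < e \<Longrightarrow> e \<le> e0 \<Longrightarrow> \<bar>s\<bar> \<le> e ^ 3 \<Longrightarrow>
       cmod (\<phi> (x + s *\<^sub>R v) - \<phi> x - of_real s * dir_deriv \<phi> v x) \<le> 10000 * C * \<bar>s\<bar> * e"
  then show thesis by (rule that)
qed

text \<open>The increment along \<open>u + v\<close> equals the increment along \<open>u\<close>
  followed by one along \<open>v\<close> from the shifted point. The derivative at that point tends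
  to the one at \<open>x\<close>, because a directional derivative again has holomorphic
  approximants and is therefore continuous.\<close>

lemma dir_deriv_add:
  fixes U :: "'a::euclidean_space set"
  assumes U: "open U" and g: "holo_approx U \<phi>" and x: "x \<in> U"
    and uv: "norm u \<le> 1" "norm v \<le> 1" "norm (u + v) \<le> 1"
  shows "dir_deriv \<phi> (u + v) x = dir_deriv \<phi> u x + dir_deriv \<phi> v x"
proof -
  obtain r where r: "r > 0" "cball x r \<subseteq> U" using U x by (meson open_contains_cball)
  obtain C e0 where C: "1 \<le> C" "0 < e0" "e0 \<le> 1/2"
    and inc: "\<And>y v e s. y \<in> cball x r \<Longrightarrow> norm v \<le> 1 \<Longrightarrow> 0 < e \<Longrightarrow> e \<le> e0 \<Longrightarrow> \<bar>s\<bar> \<le> e ^ 3 \<Longrightarrow>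
       cmod (\<phi> (y + s *\<^sub>R v) - \<phi> y - of_real s * dir_deriv \<phi> v y) \<le> 10000 * C * \<bar>s\<bar> * e"
    using dir_deriv_increment[OF g compact_cball r(2)] by blast
  define D where "D = dir_deriv \<phi> (u + v) x - dir_deriv \<phi> u x - dir_deriv \<phi> v x"
  have le: "cmod D \<le> 30000 * C * e + cmod (dir_deriv \<phi> v (x + e ^ 3 *\<^sub>R u) - dir_deriv \<phi> v x)"
    if e: "0 < e" "e \<le> e0" "e \<le> r" for e
  proof -
    define s where "s = e ^ 3"
    have s: "s > 0" "\<bar>s\<bar> \<le> e ^ 3" using e by (auto simp: s_def)
    have "e ^ 3 \<le> e ^ 1" using e C by (intro power_decreasing) auto
    then have "s * norm u \<le> r * 1" using e uv by (intro mult_mono) (auto simp: s_def)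
    then have y: "x + s *\<^sub>R u \<in> cball x r" using s by (simp add: dist_norm)
    have xc: "x \<in> cball x r" using r by simp
    note a = inc[OF xc uv(3) e(1,2) s(2)]
    note b = inc[OF xc uv(1) e(1,2) s(2)]
    note c = inc[OF y uv(2) e(1,2) s(2)]
    define A where "A = \<phi> (x + s *\<^sub>R (u + v)) - \<phi> x - of_real s * dir_deriv \<phi> (u + v) x"
    define B where "B = \<phi> (x + s *\<^sub>R u) - \<phi> x - of_real s * dir_deriv \<phi> u x"
    define E where "E = \<phi> (x + s *\<^sub>R u + s *\<^sub>R v) - \<phi> (x + s *\<^sub>R u) - of_real s * dir_deriv \<phi> v (x + s *\<^sub>R u)"
    define Z where "Z = of_real s * (dir_deriv \<phi> v (x + s *\<^sub>R u) - dir_deriv \<phi> v x)"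
    have "of_real s * D = (B + E) + (Z - A)"
      by (simp add: D_def A_def B_def E_def Z_def algebra_simps)
    then have "s * cmod D = cmod ((B + E) + (Z - A))" using s by (metis norm_mult norm_of_real abs_of_pos)
    also have "\<dots> \<le> (cmod B + cmod E) + (cmod Z + cmod A)"
      by (intro order_trans[OF norm_triangle_ineq] add_mono norm_triangle_ineq norm_triangle_ineq4)
    also have "\<dots> \<le> s * (30000 * C * e + cmod (dir_deriv \<phi> v (x + s *\<^sub>R u) - dir_deriv \<phi> v x))"
    proof -
      have "cmod Z = s * cmod (dir_deriv \<phi> v (x + s *\<^sub>R u) - dir_deriv \<phi> v x)"
        using s by (simp only: Z_def norm_mult norm_of_real abs_of_pos)
      then show ?thesis using a b c s unfolding A_def[symmetric] B_def[symmetric] E_def[symmetric] by (simp add: distrib_left mult_ac)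
    qed
    finally show ?thesis using s by (simp add: s_def)
  qed
  have cont: "isCont (dir_deriv \<phi> v) x"
    by (rule holo_approx_continuous[OF holo_approx_dir_deriv[OF U g uv(2)] x])
  have "((\<lambda>e. 30000 * C * e + cmod (dir_deriv \<phi> v (x + e ^ 3 *\<^sub>R u) - dir_deriv \<phi> v x)) \<longlongrightarrow>
      30000 * C * 0 + cmod (dir_deriv \<phi> v x - dir_deriv \<phi> v x)) (at_right 0)"
  proof (intro tendsto_intros isCont_tendsto_compose[OF cont])
    have "((\<lambda>e. x + e ^ 3 *\<^sub>R u) \<longlongrightarrow> x + 0 ^ 3 *\<^sub>R u) (at_right (0::real))" by (intro tendsto_intros)
    then show "((\<lambda>e. x + e ^ 3 *\<^sub>R u) \<longlongrightarrow> x) (at_right (0::real))" by simp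
  qed
  then have lim: "((\<lambda>e. 30000 * C * e + cmod (dir_deriv \<phi> v (x + e ^ 3 *\<^sub>R u) - dir_deriv \<phi> v x)) \<longlongrightarrow> 0) (at_right 0)" by simp
  have "min e0 r > 0" using C r by simp
  then have "\<forall>\<^sub>F e in at_right 0. cmod D \<le> 30000 * C * e + cmod (dir_deriv \<phi> v (x + e ^ 3 *\<^sub>R u) - dir_deriv \<phi> v x)"
    unfolding eventually_at_right_field using le by (intro exI[of _ "min e0 r"]) auto
  from tendsto_lowerbound[OF lim this] have "cmod D \<le> 0" by simp
  then show ?thesis by (simp add: D_def algebra_simps)
qed

text \<open>Linearity reduces to vectors of norm at most 1 by homogeneity. The increment estimates
  are uniform in the direction, so the directional derivatives assemble to a Frechet
  derivative.\<close>

lemma holo_approx_has_derivative: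
  fixes U :: "'a::euclidean_space set"
  assumes U: "open U" and g: "holo_approx U \<phi>" and x: "x \<in> U"
  shows "(\<phi> has_derivative (\<lambda>v. dir_deriv \<phi> v x)) (at x)"
proof -
  note scale = dir_deriv_exists(2)[OF g x]
  have lin: "linear (\<lambda>v. dir_deriv \<phi> v x)"
  proof (rule linearI)
    fix u v :: 'a
    define n where "n = 1 + norm u + norm v"
    have n: "n > 0" "norm u \<le> n" "norm v \<le> n" "norm (u + v) \<le> n"
      using norm_triangle_ineq[of u v] by (auto simp: n_def add_pos_nonneg)
    have "dir_deriv \<phi> (u /\<^sub>R n + v /\<^sub>R n) x = dir_deriv \<phi> (u /\<^sub>R n) x + dir_deriv \<phi> (v /\<^sub>R n) x"
    proof (rule dir_deriv_add[OF U g x])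
      show "norm (u /\<^sub>R n) \<le> 1" "norm (v /\<^sub>R n) \<le> 1" using n by (auto simp: divide_le_eq divide_inverse_commute[symmetric])
      have "norm (u /\<^sub>R n + v /\<^sub>R n) = norm (u + v) / n" using n by (simp add: scaleR_add_right[symmetric] divide_inverse_commute)
      then show "norm (u /\<^sub>R n + v /\<^sub>R n) \<le> 1" using n by simp
    qed
    then have "dir_deriv \<phi> (u + v) x /\<^sub>R n = (dir_deriv \<phi> u x + dir_deriv \<phi> v x) /\<^sub>R n"
      by (simp only: scale scaleR_add_right[symmetric])
    then show "dir_deriv \<phi> (u + v) x = dir_deriv \<phi> u x + dir_deriv \<phi> v x" using n by simp
  qed (rule scale)
  obtain C e0 where C: "1 \<le> C" "0 < e0" "e0 \<le> 1/2"
    and inc: "\<And>v e s. norm v \<le> 1 \<Longrightarrow> 0 < e \<Longrightarrow> e \<le> e0 \<Longrightarrow> \<bar>s\<bar> \<le> e ^ 3 \<Longrightarrow>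
       cmod (\<phi> (x + s *\<^sub>R v) - \<phi> x - of_real s * dir_deriv \<phi> v x) \<le> 10000 * C * \<bar>s\<bar> * e"
  proof -
    have x1: "{x} \<subseteq> U" using x by simp
    show ?thesis using dir_deriv_increment[OF g compact_sing x1] that by (metis singletonI)
  qed
  show ?thesis unfolding has_derivative_at_alt
  proof (intro conjI allI impI)
    show "bounded_linear (\<lambda>v. dir_deriv \<phi> v x)" using lin by (simp add: linear_conv_bounded_linear)
    fix \<epsilon> :: real assume eps: "\<epsilon> > 0"
    define e where "e = min e0 (\<epsilon> / (10000 * C))"
    have e: "0 < e" "e \<le> e0" "e \<le> \<epsilon> / (10000 * C)" using eps C by (auto simp: e_def)
    then have eC: "10000 * C * e \<le> \<epsilon>" using C by (simp add: field_simps)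
    show "\<exists>d>0. \<forall>y. norm (y - x) < d \<longrightarrow> norm (\<phi> y - \<phi> x - dir_deriv \<phi> (y - x) x) \<le> \<epsilon> * norm (y - x)"
    proof (intro exI[of _ "e ^ 3"] conjI allI impI)
      show "e ^ 3 > 0" using e by simp
      fix y assume y: "norm (y - x) < e ^ 3"
      define s where "s = norm (y - x)"
      define v where "v = (y - x) /\<^sub>R s"
      have v: "norm v \<le> 1" by (cases "s = 0") (simp_all add: v_def s_def)
      have yx: "y - x = s *\<^sub>R v" by (cases "s = 0") (simp_all add: v_def s_def)
      then have yx': "y = x + s *\<^sub>R v" by (simp add: algebra_simps)
      have s: "0 \<le> s" "\<bar>s\<bar> \<le> e ^ 3" using y by (auto simp: s_def)
      have "cmod (\<phi> y - \<phi> x - of_real s * dir_deriv \<phi> v x) \<le> 10000 * C * \<bar>s\<bar> * e"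
        unfolding yx' by (rule inc[OF v e(1,2) s(2)])
      also have "\<dots> = (10000 * C * e) * s" using s by simp
      also have "\<dots> \<le> \<epsilon> * s" by (rule mult_right_mono[OF eC s(1)])
      finally show "norm (\<phi> y - \<phi> x - dir_deriv \<phi> (y - x) x) \<le> \<epsilon> * norm (y - x)"
        unfolding yx scale by (simp add: scaleR_conv_of_real s_def[symmetric] yx[symmetric])
    qed
  qed
qed

text \<open>On \<open>U\<close>, a Frechet derivative in direction \<open>v\<close> is a multiple of
  a directional derivative in a short direction, hence has holomorphic approximants again. Induction
  over the list of directions then gives derivatives of all orders.\<close>

lemma holo_approx_imp_smooth:
  fixes U :: "'a::euclidean_space set"
  assumes U: "open U" and g: "holo_approx U f"
  shows "smooth_fun_on U f"
proof -
  have step: "holo_approx U (\<lambda>x. frechet_derivative \<phi> (at x) v)" if h: "holo_approx U \<phi>" for \<phi> v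
  proof -
    define n where "n = 1 + norm v"
    have n: "n > 0" by (simp add: n_def add_pos_nonneg)
    have nv: "norm (v /\<^sub>R n) \<le> 1" using n by (simp add: n_def divide_le_eq divide_inverse_commute[symmetric])
    have "holo_approx U (\<lambda>x. of_real n * dir_deriv \<phi> (v /\<^sub>R n) x)"
      by (rule holo_approx_cmult[OF holo_approx_dir_deriv[OF U h nv]])
    then show ?thesis
    proof (rule holo_approx_cong[OF U, rotated])
      fix x assume x: "x \<in> U"
      have "of_real n * dir_deriv \<phi> (v /\<^sub>R n) x = dir_deriv \<phi> v x"
        using n by (simp add: dir_deriv_exists(2)[OF h x] scaleR_conv_of_real)
      also have "(\<lambda>v. dir_deriv \<phi> v x) = frechet_derivative \<phi> (at x)"
        by (rule frechet_derivative_at[OF holo_approx_has_derivative[OF U h x]])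
      then have "dir_deriv \<phi> v x = frechet_derivative \<phi> (at x) v" by metis
      finally show "of_real n * dir_deriv \<phi> (v /\<^sub>R n) x = frechet_derivative \<phi> (at x) v" .
    qed
  qed
  have all: "holo_approx U (Frechet_deriv f vs)" for vs
    by (induction vs) (use g step in auto)
  show ?thesis unfolding smooth_fun_on_def
    using holo_approx_has_derivative[OF U all] by (auto simp: differentiable_def)
qed

section \<open>Symmetry and polarization of higher derivatives\<close>

text \<open>The limit is not symmetric in form, but the difference quotient is symmetric in
  \<open>a\<close> and \<open>b\<close>; this yields the symmetry of second derivatives. The mean
  value inequality is applied in direction \<open>a\<close> to \<open>g\<close>, from which the
  expected term \<open>(s t) L b\<close> has been subtracted. Its derivative is controlled by the
  differentiability of \<open>D y a\<close> at the single point \<open>x\<close>.\<close>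

lemma second_difference:
  fixes \<phi> :: "'a::real_normed_vector \<Rightarrow> 'b::real_normed_vector"
  assumes U: "open U" "x \<in> U"
    and d: "\<And>y. y \<in> U \<Longrightarrow> (\<phi> has_derivative D y) (at y)"
    and d2: "((\<lambda>y. D y a) has_derivative L) (at x)"
  shows "((\<lambda>t. (\<phi> (x + t *\<^sub>R a + t *\<^sub>R b) - \<phi> (x + t *\<^sub>R a) - \<phi> (x + t *\<^sub>R b) + \<phi> x) /\<^sub>R t\<^sup>2) \<longlongrightarrow> L b) (at_right 0)"
proof (rule tendstoI)
  fix \<epsilon> :: real assume eps: "\<epsilon> > 0"
  define n where "n = 2 * (norm a + norm b) + 1"
  have n: "n > 0" "2 * (norm a + norm b) < n" by (auto simp: n_def add_nonneg_pos)
  define \<epsilon>' where "\<epsilon>' = \<epsilon> / n"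
  have eps': "\<epsilon>' > 0" using eps n by (simp add: \<epsilon>'_def)
  obtain r where r: "r > 0" "ball x r \<subseteq> U" using U by (meson open_contains_ball)
  obtain d0 where d0: "d0 > 0" "\<And>y. norm (y - x) < d0 \<Longrightarrow> norm (D y a - D x a - L (y - x)) \<le> \<epsilon>' * norm (y - x)"
    using d2 eps' unfolding has_derivative_at_alt by metis
  have lin: "linear L" using d2 by (rule has_derivative_linear)
  define m where "m = min r d0 / n"
  have m: "m > 0" using r d0 n by (simp add: m_def)
  have "dist ((\<phi> (x + t *\<^sub>R a + t *\<^sub>R b) - \<phi> (x + t *\<^sub>R a) - \<phi> (x + t *\<^sub>R b) + \<phi> x) /\<^sub>R t\<^sup>2) (L b) < \<epsilon>"
    if t: "0 < t" "t < m" for t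
  proof -
    have tn: "t * n < min r d0" using t n by (simp add: m_def pos_less_divide_eq)
    have small: "norm (s *\<^sub>R a + c *\<^sub>R b) \<le> t * (norm a + norm b)" "norm (s *\<^sub>R a + c *\<^sub>R b) < min r d0"
      if "0 \<le> s" "s \<le> t" "0 \<le> c" "c \<le> t" for s c
    proof -
      have "norm (s *\<^sub>R a + c *\<^sub>R b) \<le> s * norm a + c * norm b"
        using norm_triangle_ineq[of "s *\<^sub>R a" "c *\<^sub>R b"] that by simp
      also have "\<dots> \<le> t * norm a + t * norm b" using that by (intro add_mono mult_right_mono) auto
      finally show 1: "norm (s *\<^sub>R a + c *\<^sub>R b) \<le> t * (norm a + norm b)" by (simp add: distrib_left)
      have "t * (norm a + norm b) \<le> t * n" using t n by (intro mult_left_mono) (auto intro: order_trans[OF _ less_imp_le])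
      then show "norm (s *\<^sub>R a + c *\<^sub>R b) < min r d0" using 1 tn by linarith
    qed
    define g where "g s = \<phi> (x + s *\<^sub>R a + t *\<^sub>R b) - \<phi> (x + s *\<^sub>R a) - (s * t) *\<^sub>R L b" for s
    have pt: "x + s *\<^sub>R a + c *\<^sub>R b \<in> U" if "0 \<le> s" "s \<le> t" "0 \<le> c" "c \<le> t" for s c
    proof -
      have "x - (x + s *\<^sub>R a + c *\<^sub>R b) = - (s *\<^sub>R a + c *\<^sub>R b)" by simp
      then have "dist x (x + s *\<^sub>R a + c *\<^sub>R b) = norm (s *\<^sub>R a + c *\<^sub>R b)" by (simp only: dist_norm norm_minus_cancel)
      then show ?thesis using small(2)[OF that] r by (intro subsetD[OF r(2)]) simp
    qed
    have line: "((\<lambda>s. \<phi> (x + s *\<^sub>R a + c *\<^sub>R b)) has_vector_derivative D (x + s *\<^sub>R a + c *\<^sub>R b) a) (at s)"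
      if "0 \<le> s" "s \<le> t" "0 \<le> c" "c \<le> t" for s c
    proof -
      have "((\<lambda>s. x + s *\<^sub>R a + c *\<^sub>R b) has_derivative (\<lambda>h. h *\<^sub>R a)) (at s)"
        by (auto intro!: derivative_eq_intros)
      from has_derivative_compose[OF this d[OF pt[OF that]]] show ?thesis
        unfolding has_vector_derivative_def
        using linear_scale[OF has_derivative_linear[OF d[OF pt[OF that]]]] by simp
    qed
    have g': "(g has_vector_derivative D (x + s *\<^sub>R a + t *\<^sub>R b) a - D (x + s *\<^sub>R a) a - t *\<^sub>R L b) (at s)"
      if s: "0 \<le> s" "s \<le> t" for s
    proof -
      have "((\<lambda>s. (s * t) *\<^sub>R L b) has_vector_derivative t *\<^sub>R L b) (at s)"
        unfolding has_vector_derivative_def by (auto intro!: derivative_eq_intros)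
      from has_vector_derivative_diff[OF has_vector_derivative_diff[OF line[OF s, of t] line[OF s, of 0]] this]
      show ?thesis using t by (simp add: g_def[abs_def])
    qed
    have bound: "norm (D (x + s *\<^sub>R a + t *\<^sub>R b) a - D (x + s *\<^sub>R a) a - t *\<^sub>R L b) \<le> \<epsilon>' * (2 * (t * (norm a + norm b)))"
      if s: "0 \<le> s" "s \<le> t" for s
    proof -
      define y where "y = x + s *\<^sub>R a + t *\<^sub>R b"
      define z where "z = x + s *\<^sub>R a"
      have yx: "y - x = s *\<^sub>R a + t *\<^sub>R b" and zx: "z - x = s *\<^sub>R a + 0 *\<^sub>R b" by (simp_all add: y_def z_def)
      have 1: "norm (D y a - D x a - L (y - x)) \<le> \<epsilon>' * (t * (norm a + norm b))"
        using d0(2)[of y] small[OF s, of t] t eps' unfolding yx by (auto intro: order_trans mult_left_mono)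
      have 2: "norm (D z a - D x a - L (z - x)) \<le> \<epsilon>' * (t * (norm a + norm b))"
        using d0(2)[of z] small[OF s, of 0] t eps' unfolding zx by (auto intro: order_trans mult_left_mono)
      have "L (y - x) = L (z - x) + t *\<^sub>R L b"
        unfolding yx zx by (simp add: linear_add[OF lin] linear_scale[OF lin])
      then have "D y a - D z a - t *\<^sub>R L b = (D y a - D x a - L (y - x)) - (D z a - D x a - L (z - x))" by simp
      then have "norm (D y a - D z a - t *\<^sub>R L b) \<le> norm (D y a - D x a - L (y - x)) + norm (D z a - D x a - L (z - x))"
        by (metis norm_triangle_ineq4)
      then show ?thesis using 1 2 by (simp add: y_def z_def)
    qed
    define M where "M = \<epsilon>' * (2 * (t * (norm a + norm b)))"
    have "norm (g t - g 0) \<le> M * t - M * 0"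
    proof (rule differentiable_bound_general[OF t(1), where f' = "\<lambda>s. D (x + s *\<^sub>R a + t *\<^sub>R b) a - D (x + s *\<^sub>R a) a - t *\<^sub>R L b" and \<phi>' = "\<lambda>_. M"])
      show "continuous_on {0..t} g"
        by (rule continuous_at_imp_continuous_on) (use g' has_vector_derivative_continuous in force)
      show "((\<lambda>s. M * s) has_vector_derivative M) (at s)" for s
        by (auto intro!: derivative_eq_intros simp: has_real_derivative_iff_has_vector_derivative[symmetric])
    qed (use g' bound in \<open>auto simp: M_def intro!: continuous_intros\<close>)
    then have *: "norm (\<phi> (x + t *\<^sub>R a + t *\<^sub>R b) - \<phi> (x + t *\<^sub>R a) - \<phi> (x + t *\<^sub>R b) + \<phi> x - t\<^sup>2 *\<^sub>R L b) \<le> M * t"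
      by (simp add: g_def power2_eq_square algebra_simps)
    have "(\<phi> (x + t *\<^sub>R a + t *\<^sub>R b) - \<phi> (x + t *\<^sub>R a) - \<phi> (x + t *\<^sub>R b) + \<phi> x) /\<^sub>R t\<^sup>2 - L b
       = (\<phi> (x + t *\<^sub>R a + t *\<^sub>R b) - \<phi> (x + t *\<^sub>R a) - \<phi> (x + t *\<^sub>R b) + \<phi> x - t\<^sup>2 *\<^sub>R L b) /\<^sub>R t\<^sup>2"
      using t by (simp add: scaleR_diff_right)
    then have "dist ((\<phi> (x + t *\<^sub>R a + t *\<^sub>R b) - \<phi> (x + t *\<^sub>R a) - \<phi> (x + t *\<^sub>R b) + \<phi> x) /\<^sub>R t\<^sup>2) (L b)
       = norm (\<phi> (x + t *\<^sub>R a + t *\<^sub>R b) - \<phi> (x + t *\<^sub>R a) - \<phi> (x + t *\<^sub>R b) + \<phi> x - t\<^sup>2 *\<^sub>R L b) / t\<^sup>2"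
      by (simp add: dist_norm divide_inverse_commute)
    also have "\<dots> \<le> M * t / t\<^sup>2" using * t by (intro divide_right_mono) auto
    also have "\<dots> = \<epsilon>' * (2 * (norm a + norm b))" using t by (simp add: M_def power2_eq_square)
    also have "\<dots> < \<epsilon>' * n" using eps' n by (intro mult_strict_left_mono) auto
    also have "\<dots> = \<epsilon>" using n by (simp add: \<epsilon>'_def)
    finally show ?thesis .
  qed
  then show "\<forall>\<^sub>F t in at_right 0. dist ((\<phi> (x + t *\<^sub>R a + t *\<^sub>R b) - \<phi> (x + t *\<^sub>R a) - \<phi> (x + t *\<^sub>R b) + \<phi> x) /\<^sub>R t\<^sup>2) (L b) < \<epsilon>"
    unfolding eventually_at_right_field using m by (intro exI[of _ m]) auto
qed

lemma Frechet_deriv_swap: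
  assumes f: "smooth_fun_on U f" "open U" "x \<in> U"
  shows "Frechet_deriv f (a # b # vs) x = Frechet_deriv f (b # a # vs) x"
proof -
  define \<phi> where "\<phi> = Frechet_deriv f vs"
  have d: "(\<phi> has_derivative (\<lambda>v. Frechet_deriv f (v # vs) y)) (at y)" if "y \<in> U" for y
    unfolding \<phi>_def by (rule Frechet_deriv_has_derivative[OF f(1) that])
  have d2: "((\<lambda>y. Frechet_deriv f (c # vs) y) has_derivative (\<lambda>v. Frechet_deriv f (v # c # vs) x)) (at x)" for c
    by (rule Frechet_deriv_has_derivative[OF f(1,3)])
  have 1: "((\<lambda>t. (\<phi> (x + t *\<^sub>R b + t *\<^sub>R a) - \<phi> (x + t *\<^sub>R b) - \<phi> (x + t *\<^sub>R a) + \<phi> x) /\<^sub>R t\<^sup>2) \<longlongrightarrow> Frechet_deriv f (a # b # vs) x) (at_right 0)"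
    by (rule second_difference[OF f(2,3) d d2])
  have 2: "((\<lambda>t. (\<phi> (x + t *\<^sub>R a + t *\<^sub>R b) - \<phi> (x + t *\<^sub>R a) - \<phi> (x + t *\<^sub>R b) + \<phi> x) /\<^sub>R t\<^sup>2) \<longlongrightarrow> Frechet_deriv f (b # a # vs) x) (at_right 0)"
    by (rule second_difference[OF f(2,3) d d2])
  have "\<phi> (x + t *\<^sub>R b + t *\<^sub>R a) - \<phi> (x + t *\<^sub>R b) - \<phi> (x + t *\<^sub>R a) + \<phi> x
      = \<phi> (x + t *\<^sub>R a + t *\<^sub>R b) - \<phi> (x + t *\<^sub>R a) - \<phi> (x + t *\<^sub>R b) + \<phi> x" for t
    by (simp add: add.assoc add.commute[of "t *\<^sub>R b"])
  with 1 have "((\<lambda>t. (\<phi> (x + t *\<^sub>R a + t *\<^sub>R b) - \<phi> (x + t *\<^sub>R a) - \<phi> (x + t *\<^sub>R b) + \<phi> x) /\<^sub>R t\<^sup>2) \<longlongrightarrow> Frechet_deriv f (a # b # vs) x) (at_right 0)"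
    by simp
  from tendsto_unique[OF _ this 2] show ?thesis by simp
qed

lemma Frechet_deriv_Cons_cong:
  assumes f: "smooth_fun_on U f" "open U" and eq: "\<And>x. x \<in> U \<Longrightarrow> Frechet_deriv f us x = Frechet_deriv f vs x" and x: "x \<in> U"
  shows "Frechet_deriv f (a # us) x = Frechet_deriv f (a # vs) x"
proof -
  have "(Frechet_deriv f vs has_derivative (\<lambda>v. Frechet_deriv f (v # us) x)) (at x)"
    by (rule has_derivative_transform_within_open[OF Frechet_deriv_has_derivative[OF f(1) x] f(2) x eq])
  from has_derivative_unique[OF this Frechet_deriv_has_derivative[OF f(1) x]] show ?thesis by metis
qed

lemma Frechet_deriv_move:
  assumes f: "smooth_fun_on U f" "open U" and x: "x \<in> U"
  shows "Frechet_deriv f (us @ a # vs) x = Frechet_deriv f (a # us @ vs) x"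
  using x
proof (induction us arbitrary: x)
  case (Cons u us)
  have "Frechet_deriv f (u # us @ a # vs) x = Frechet_deriv f (u # a # us @ vs) x"
    by (rule Frechet_deriv_Cons_cong[OF f Cons.IH Cons.prems])
  also have "\<dots> = Frechet_deriv f (a # u # us @ vs) x" by (rule Frechet_deriv_swap[OF f Cons.prems])
  finally show ?case by simp
qed simp

lemma Frechet_deriv_mset_cong:
  assumes f: "smooth_fun_on U f" "open U" and x: "x \<in> U" and m: "mset us = mset vs"
  shows "Frechet_deriv f us x = Frechet_deriv f vs x"
  using x m
proof (induction us arbitrary: vs x)
  case (Cons a us)
  then obtain vs1 vs2 where vs: "vs = vs1 @ a # vs2"
    by (metis in_set_conv_decomp list.set_intros(1) mset_eq_setD)
  then have "mset us = mset (vs1 @ vs2)" using Cons.prems by simp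
  then have "Frechet_deriv f (a # us) x = Frechet_deriv f (a # vs1 @ vs2) x"
    by (intro Frechet_deriv_Cons_cong[OF f Cons.IH Cons.prems(1)])
  then show ?case using Frechet_deriv_move[OF f Cons.prems(1), of vs1 a vs2] vs by simp
qed simp

section \<open>Polarization by finite differences\<close>

definition fdiff :: "'a::ab_group_add \<Rightarrow> ('a \<Rightarrow> complex) \<Rightarrow> 'a \<Rightarrow> complex" where
  "fdiff v \<psi> y = \<psi> (y + v) - \<psi> y"

lemma foldr_fdiff_sum:
  "foldr fdiff vs (\<lambda>y. \<Sum>i\<in>I. c i * \<psi> i y) = (\<lambda>y. \<Sum>i\<in>I. c i * foldr fdiff vs (\<psi> i) y)"
  by (induction vs) (simp_all add: fdiff_def fun_eq_iff right_diff_distrib sum_subtractf)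

lemma foldr_fdiff_comm: "foldr fdiff vs (fdiff v \<psi>) = fdiff v (foldr fdiff vs \<psi>)"
  by (induction vs) (simp_all add: fdiff_def fun_eq_iff add_ac)

lemma foldr_fdiff_bound:
  fixes \<psi> :: "'a::real_normed_vector \<Rightarrow> complex"
  assumes "\<And>y. norm y \<le> R + real (length vs) \<Longrightarrow> cmod (\<psi> y) \<le> S" "\<forall>v\<in>set vs. norm v \<le> 1" "norm y \<le> R"
  shows "cmod (foldr fdiff vs \<psi> y) \<le> 2 ^ length vs * S"
  using assms
proof (induction vs arbitrary: y R)
  case (Cons v vs)
  have "cmod (foldr fdiff vs \<psi> (y + v)) \<le> 2 ^ length vs * S"
    by (rule Cons.IH[of "R + 1"]) (use Cons.prems norm_triangle_ineq[of y v] in \<open>auto simp: add_ac\<close>)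
  moreover have "cmod (foldr fdiff vs \<psi> y) \<le> 2 ^ length vs * S"
    by (rule Cons.IH[of "R + 1"]) (use Cons.prems in \<open>auto simp: add_ac\<close>)
  ultimately show ?case
    using norm_triangle_ineq4[of "foldr fdiff vs \<psi> (y + v)" "foldr fdiff vs \<psi> y"] by (simp add: fdiff_def[of v])
qed simp

lemma foldr_fdiff_zero: "foldr fdiff vs (\<lambda>y. 0) = (\<lambda>y. 0)"
  by (induction vs) (simp_all add: fdiff_def fun_eq_iff)

context
  fixes B :: "'a::real_vector list \<Rightarrow> complex"
  assumes lin: "\<And>us vs. linear (\<lambda>v. B (us @ v # vs))"
    and sym: "\<And>us vs. mset us = mset vs \<Longrightarrow> B us = B vs"
begin

lemma binomial_expansion:
  "B (ws @ replicate n (y + v)) = (\<Sum>i\<le>n. of_nat (n choose i) * B (ws @ replicate (n - i) v @ replicate i y))"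
proof (induction n arbitrary: ws)
  case (Suc n)
  define b where "b i = B (ws @ replicate (Suc n - i) v @ replicate i y)" for i
  have "B (ws @ replicate (Suc n) (y + v)) = B (ws @ y # replicate n (y + v)) + B (ws @ v # replicate n (y + v))"
    using linear_add[OF lin[of ws "replicate n (y + v)"]] by simp
  also have "B (ws @ y # replicate n (y + v)) = (\<Sum>i\<le>n. of_nat (n choose i) * b (Suc i))"
    using Suc.IH[of "ws @ [y]"] by (simp add: b_def) (intro sum.cong refl arg_cong2[where f="(*)"] sym; simp)
  also have "B (ws @ v # replicate n (y + v)) = (\<Sum>i\<le>n. of_nat (n choose i) * b i)"
    using Suc.IH[of "ws @ [v]"] by (simp add: b_def) (intro sum.cong refl arg_cong2[where f="(*)"] sym; simp add: Suc_diff_le)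
  also have "(\<Sum>i\<le>n. of_nat (n choose i) * b (Suc i)) + (\<Sum>i\<le>n. of_nat (n choose i) * b i)
      = (\<Sum>i\<le>Suc n. of_nat (Suc n choose i) * b i)"
  proof -
    have "(\<Sum>i\<le>n. of_nat (n choose i) * b i) = (\<Sum>i\<le>Suc n. of_nat (n choose i) * b i)" by (simp add: binomial_eq_0)
    also have "\<dots> = b 0 + (\<Sum>i\<le>n. of_nat (n choose Suc i) * b (Suc i))" by (subst sum.atMost_Suc_shift) simp
    finally show ?thesis
      by (subst sum.atMost_Suc_shift) (simp add: sum.distrib[symmetric] distrib_right add_ac)
  qed
  finally show ?case by (simp add: b_def)
qed simp

lemma fdiff_multilinear:
  "fdiff v (\<lambda>y. B (ws @ replicate n y)) = (\<lambda>y. \<Sum>i<n. of_nat (n choose i) * B ((ws @ replicate (n - i) v) @ replicate i y))"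
  by (simp add: fdiff_def binomial_expansion fun_eq_iff lessThan_Suc_atMost[symmetric])

text \<open>A difference lowers the degree in \<open>y\<close>: expanding \<open>B\<close> at
  \<open>y + v\<close> leaves terms with at most \<open>n - 1\<close> slots \<open>y\<close>, the
  other slots being frozen at \<open>v\<close>. The list \<open>ws\<close> collects frozen slots.
  The case of more differences than the degree is included because the lower terms of the expansion
  must vanish in the induction.\<close>

lemma polarization:
  "length vs \<ge> n \<Longrightarrow> foldr fdiff vs (\<lambda>y. B (ws @ replicate n y)) y = (if length vs = n then fact n * B (ws @ vs) else 0)"
proof (induction vs arbitrary: n ws y)
  case Nil
  then show ?case by simp
next
  case (Cons v vs)
  show ?case
  proof (cases n)
    case 0
    have "fdiff v (\<lambda>y. B ws) = (\<lambda>y. 0)" by (simp add: fdiff_def fun_eq_iff)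
    then have "foldr fdiff (v # vs) (\<lambda>y. B ws) = (\<lambda>y. 0)"
      by (simp add: foldr_fdiff_comm[symmetric] foldr_fdiff_zero)
    then have "foldr fdiff (v # vs) (\<lambda>y. B ws) y = 0" by metis
    then show ?thesis using 0 by simp
  next
    case (Suc k)
    have "foldr fdiff (v # vs) (\<lambda>y. B (ws @ replicate n y)) y = foldr fdiff vs (fdiff v (\<lambda>y. B (ws @ replicate n y))) y"
      by (simp add: foldr_fdiff_comm)
    also have "\<dots> = (\<Sum>i<n. of_nat (n choose i) * foldr fdiff vs (\<lambda>y. B ((ws @ replicate (n - i) v) @ replicate i y)) y)"
      unfolding fdiff_multilinear foldr_fdiff_sum by simp
    also have "\<dots> = (\<Sum>i<n. of_nat (n choose i) * (if length vs = i then fact i * B ((ws @ replicate (n - i) v) @ vs) else 0))"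
      using Cons.prems Suc by (intro sum.cong refl arg_cong2[where f="(*)"] Cons.IH) auto
    also have "\<dots> = (if length vs = k then of_nat (n choose k) * (fact k * B ((ws @ [v]) @ vs)) else 0)"
      using Suc Cons.prems by (auto simp: if_distrib[of "\<lambda>x. _ * x"] sum.delta' cong: if_cong)
    also have "\<dots> = (if length (v # vs) = n then fact n * B (ws @ v # vs) else 0)"
      using Suc by (simp add: mult_ac)
    finally show ?thesis .
  qed
qed

end

text \<open>The iterated difference at 0 has \<open>2^k\<close> terms at points of norm at most
  \<open>k\<close>, where homogeneity gives \<open>k^k * S\<close>. Division by \<open>k!\<close>
  leaves \<open>2^k * 3^k\<close>. Such a geometric factor is harmless for the classes.\<close>

lemma Frechet_deriv_polarization_bound:
  fixes f :: "'a::euclidean_space \<Rightarrow> complex"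
  assumes f: "smooth_fun_on U f" "open U" and x: "x \<in> U"
    and S: "\<And>v. norm v \<le> 1 \<Longrightarrow> cmod (Frechet_deriv f (replicate k v) x) \<le> S"
    and vs: "length vs = k" "\<forall>v\<in>set vs. norm v \<le> 1"
  shows "cmod (Frechet_deriv f vs x) \<le> 6 ^ k * S"
proof -
  define B where "B vs = Frechet_deriv f vs x" for vs
  have lin: "linear (\<lambda>v. B (us @ v # vs))" for us vs unfolding B_def by (rule Frechet_deriv_linear[OF f x])
  have sym: "B us = B vs" if "mset us = mset vs" for us vs unfolding B_def by (rule Frechet_deriv_mset_cong[OF f x that])
  have S0: "S \<ge> 0" using order_trans[OF norm_ge_zero S[of 0]] by simp
  have hom: "B (us @ replicate n (c *\<^sub>R v)) = c ^ n *\<^sub>R B (us @ replicate n v)" for us n c v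
  proof (induction n arbitrary: us)
    case (Suc n)
    have "B (us @ replicate (Suc n) (c *\<^sub>R v)) = c *\<^sub>R B ((us @ [v]) @ replicate n (c *\<^sub>R v))"
      using linear_scale[OF lin[of us "replicate n (c *\<^sub>R v)"]] by simp
    also have "\<dots> = c ^ Suc n *\<^sub>R B (us @ replicate (Suc n) v)" unfolding Suc.IH by simp
    finally show ?case .
  qed simp
  have bd: "cmod (B (replicate k y)) \<le> real k ^ k * S" if y: "norm y \<le> real k" for y
  proof (cases "k = 0")
    case True
    then show ?thesis using S[of 0] by (simp add: B_def)
  next
    case False
    have "B (replicate k y) = real k ^ k *\<^sub>R B (replicate k (y /\<^sub>R real k))"
      using hom[of "[]" k "real k" "y /\<^sub>R real k"] False by simp
    moreover have "cmod (B (replicate k (y /\<^sub>R real k))) \<le> S"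
      unfolding B_def by (rule S) (use y False in \<open>simp add: divide_inverse_commute[symmetric]\<close>)
    ultimately show ?thesis by (simp add: mult_left_mono)
  qed
  have "fact k * B vs = foldr fdiff vs (\<lambda>y. B (replicate k y)) 0"
    using polarization[of B k vs "[]" 0, OF lin sym] vs by simp
  moreover have "cmod (foldr fdiff vs (\<lambda>y. B (replicate k y)) 0) \<le> 2 ^ length vs * (real k ^ k * S)"
    by (rule foldr_fdiff_bound[of 0]) (use bd vs in auto)
  ultimately have "fact k * cmod (B vs) \<le> 2 ^ k * (real k ^ k * S)"
    using vs by (metis norm_fact norm_mult)
  also have "\<dots> \<le> 2 ^ k * (3 ^ k * fact k * S)"
  proof (intro mult_left_mono mult_right_mono S0)
    have "exp (real k) = exp 1 ^ k" using exp_of_nat_mult[of k "1::real"] by simp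
    also have "\<dots> \<le> 3 ^ k" using exp_le by (intro power_mono) auto
    finally have "exp (real k) * fact k \<le> 3 ^ k * fact k" by simp
    then show "real k ^ k \<le> 3 ^ k * fact k" using pow_le_exp_fact[of k] by linarith
  qed auto
  also have "\<dots> = fact k * (6 ^ k * S)"
  proof -
    have "(2::real) ^ k * 3 ^ k = 6 ^ k" by (subst power_mult_distrib[symmetric]) simp
    then show ?thesis by (metis (no_types) mult.assoc mult.commute)
  qed
  finally show ?thesis by (simp add: B_def)
qed

section \<open>Derivative bounds\<close>

lemma M_seminorm_finiteD:
  assumes fin: "M_seminorm M K \<rho> f < \<infinity>" and pos: "\<And>k. M k > 0" "\<rho> > 0"
  shows "\<exists>C\<ge>1. \<forall>x\<in>K. \<forall>vs. (\<forall>v\<in>set vs. norm v \<le> 1) \<longrightarrow>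
    cmod (Frechet_deriv f vs x) \<le> C * (\<rho> ^ length vs * M (length vs))"
proof -
  obtain c where c: "M_seminorm M K \<rho> f = ennreal c" "c \<ge> 0" using fin by (cases "M_seminorm M K \<rho> f") auto
  have "cmod (Frechet_deriv f vs x) \<le> max 1 c * (\<rho> ^ length vs * M (length vs))"
    if x: "x \<in> K" and vs: "\<forall>v\<in>set vs. norm v \<le> 1" for x vs
  proof -
    define \<beta> where "\<beta> = \<rho> ^ length vs * M (length vs)"
    have \<beta>: "\<beta> > 0" using pos by (simp add: \<beta>_def)
    have "ennreal (cmod (Frechet_deriv f vs x)) \<le> Frechet_norm f (length vs) x"
      unfolding Frechet_norm_def by (rule SUP_upper) (use vs in auto)
    then have "ennreal (cmod (Frechet_deriv f vs x)) / ennreal \<beta> \<le> Frechet_norm f (length vs) x / ennreal \<beta>"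
      by (rule divide_right_mono_ennreal)
    also have "\<dots> \<le> (SUP k. Frechet_norm f k x / ennreal (\<rho> ^ k * M k))"
      unfolding \<beta>_def by (rule SUP_upper) simp
    also have "\<dots> \<le> M_seminorm M K \<rho> f" unfolding M_seminorm_def by (rule SUP_upper[OF x])
    finally have "cmod (Frechet_deriv f vs x) / \<beta> \<le> c" using \<beta> c by (simp add: divide_ennreal)
    then have "cmod (Frechet_deriv f vs x) \<le> c * \<beta>" using \<beta> by (simp add: pos_divide_le_eq)
    also have "\<dots> \<le> max 1 c * \<beta>" using \<beta> by (intro mult_right_mono) auto
    finally show ?thesis by (simp add: \<beta>_def)
  qed
  then show ?thesis by (intro exI[of _ "max 1 c"]) auto
qed

lemma M_seminorm_finiteI:
  assumes bd: "\<And>x vs. x \<in> K \<Longrightarrow> (\<forall>v\<in>set vs. norm v \<le> 1) \<Longrightarrow>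
      cmod (Frechet_deriv f vs x) \<le> C * (\<rho> ^ length vs * M (length vs))"
    and pos: "\<And>k. M k > 0" "\<rho> > 0" and C: "C \<ge> 0"
  shows "M_seminorm M K \<rho> f < \<infinity>"
proof -
  have "M_seminorm M K \<rho> f \<le> ennreal C"
    unfolding M_seminorm_def
  proof (intro SUP_least)
    fix x k assume x: "x \<in> K"
    define \<beta> where "\<beta> = \<rho> ^ k * M k"
    have \<beta>: "\<beta> > 0" using pos by (simp add: \<beta>_def)
    have "Frechet_norm f k x \<le> ennreal (C * \<beta>)"
      unfolding Frechet_norm_def \<beta>_def by (rule SUP_least) (use bd[OF x] in \<open>auto intro!: ennreal_leI\<close>)
    then have "Frechet_norm f k x / ennreal \<beta> \<le> ennreal (C * \<beta>) / ennreal \<beta>" by (rule divide_right_mono_ennreal)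
    also have "\<dots> = ennreal C" using \<beta> C by (simp add: divide_ennreal)
    finally show "Frechet_norm f k x / ennreal (\<rho> ^ k * M k) \<le> ennreal C" by (simp add: \<beta>_def)
  qed
  then show ?thesis by (simp add: le_less_trans)
qed

text \<open>As \<open>k\<close> is arbitrary, the error is measured by the fourth power of
  \<open>h_fun l (B e)\<close>. A square root is lost in the two-constants estimate. The remaining
  square is used as a product of the bounds for the indices \<open>k\<close> and 1: the first yields
  the \<open>k\<close>-th derivative, the second a factor \<open>e\<close> that is summable over
  dyadic scales.\<close>

definition class_approx ::
    "('a::real_normed_vector \<Rightarrow> complex) \<Rightarrow> 'a set \<Rightarrow> (nat \<Rightarrow> real) \<Rightarrow> real \<Rightarrow> real \<Rightarrow> real \<Rightarrow> bool" where
  "class_approx f K l B C e0 \<longleftrightarrow> 1 \<le> C \<and> 0 < e0 \<and> e0 \<le> 1 \<and> (\<forall>x\<in>K. \<forall>v. norm v \<le> 1 \<longrightarrow> (\<forall>e. 0 < e \<and> e \<le> e0 \<longrightarrow>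
     (\<exists>F. F holomorphic_on ball 0 e \<and> (\<forall>z\<in>ball 0 e. cmod (F z) \<le> C) \<and>
       (\<forall>s. \<bar>s\<bar> < e \<longrightarrow> (\<forall>k. cmod (f (x + s *\<^sub>R v) - F (of_real s)) \<le> C * (l k * (B * e) ^ k) ^ 4)))))"

lemma class_approxD:
  assumes "class_approx f K l B C e0" "x \<in> K" "norm v \<le> 1" "0 < e" "e \<le> e0"
  shows "\<exists>F. F holomorphic_on ball 0 e \<and> (\<forall>z\<in>ball 0 e. cmod (F z) \<le> C) \<and>
       (\<forall>s. \<bar>s\<bar> < e \<longrightarrow> (\<forall>k. cmod (f (x + s *\<^sub>R v) - F (of_real s)) \<le> C * (l k * (B * e) ^ k) ^ 4))"
  using assms unfolding class_approx_def by blast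

lemma Frechet_deriv_line:
  assumes f: "smooth_fun_on U f" "open U" and x: "x + s *\<^sub>R v \<in> U"
  shows "((\<lambda>s. Frechet_deriv f (replicate k v) (x + s *\<^sub>R v)) has_vector_derivative
    Frechet_deriv f (replicate (Suc k) v) (x + s *\<^sub>R v)) (at s)"
proof -
  have "((\<lambda>s. x + s *\<^sub>R v) has_derivative (\<lambda>h. h *\<^sub>R v)) (at s)" by (auto intro!: derivative_eq_intros)
  from has_derivative_compose[OF this Frechet_deriv_has_derivative[OF f(1) x]]
  have "((\<lambda>s. Frechet_deriv f (replicate k v) (x + s *\<^sub>R v)) has_derivative
      (\<lambda>h. Frechet_deriv f (h *\<^sub>R v # replicate k v) (x + s *\<^sub>R v))) (at s)" .
  moreover have "Frechet_deriv f (h *\<^sub>R v # replicate k v) (x + s *\<^sub>R v) = h *\<^sub>R Frechet_deriv f (replicate (Suc k) v) (x + s *\<^sub>R v)" for h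
    using linear_scale[OF Frechet_deriv_linear[OF f x, of "[]" "replicate k v"]] by (simp del: Frechet_deriv.simps)
  ultimately show ?thesis unfolding has_vector_derivative_def by simp
qed

text \<open>The order of the Taylor polynomials is \<open>Gamma_lower m \<tau>\<close>, at which the
  remainder has the bound \<open>h\<close>. Its root of order \<open>Kj\<close> is still a fourth
  power because \<open>4 Kj \<le> 2^i\<close>. The resulting \<open>B\<close> is proportional to
  \<open>\<rho>\<close> with a factor that depends only on \<open>j\<close> and \<open>C\<close>;
  the Beurling case relies on this.\<close>

lemma class_approx_root:
  fixes f :: "'a::euclidean_space \<Rightarrow> complex"
  assumes j: "j > 0" and U: "open U" "K' \<subseteq> U" and r: "r > 0" "\<And>x. x \<in> K \<Longrightarrow> cball x r \<subseteq> K'"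
    and smooth: "smooth_fun_on U (\<lambda>x. f x ^ j)" "smooth_fun_on U (\<lambda>x. f x ^ (j+1))"
    and m: "\<And>k. m k > 0" "m 0 = 1" "filterlim (\<lambda>k. root k (m k)) at_top sequentially"
    and C0: "C0 \<ge> 1" and \<rho>: "\<rho> > 0"
    and gb: "\<And>x vs. x \<in> K' \<Longrightarrow> (\<forall>v\<in>set vs. norm v \<le> 1) \<Longrightarrow>
      cmod (Frechet_deriv (\<lambda>x. f x ^ j) vs x) \<le> C0 * (\<rho> ^ length vs * (fact (length vs) * m (length vs)))"
    and hb: "\<And>x vs. x \<in> K' \<Longrightarrow> (\<forall>v\<in>set vs. norm v \<le> 1) \<Longrightarrow>
      cmod (Frechet_deriv (\<lambda>x. f x ^ (j+1)) vs x) \<le> C0 * (\<rho> ^ length vs * (fact (length vs) * m (length vs)))"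
    and l: "\<And>k. l k > 0" and C: "C > 0" and i: "4 * (7 * j * (j+1) * (j+1)) \<le> 2 ^ i"
    and h: "\<And>t k. t > 0 \<Longrightarrow> m (Gamma_lower m t) * t ^ Gamma_lower m t \<le> (l k * (C * t) ^ k) ^ 2 ^ i"
  shows "\<exists>C' e0. class_approx f K l (2 * C * root_scale j * \<rho>) C' e0"
proof -
  define Kj where "Kj = 7 * j * (j+1) * (j+1)"
  have Kj: "Kj > 0" using j by (simp add: Kj_def)
  define A where "A = root_scale j"
  have A: "A > 0" by (simp add: A_def root_scale_def)
  from holomorphic_approximation_on_line[OF j C0, folded Kj_def A_def]
  obtain C1 where C1: "C1 \<ge> 1" and approx:
    "\<And>(m :: nat \<Rightarrow> real) p \<tau> \<rho> g h \<phi>. \<tau> > 0 \<Longrightarrow> \<rho> > 0 \<Longrightarrow> (\<And>k. m k > 0) \<Longrightarrow> (\<And>k. k \<le> p \<Longrightarrow> m k * \<tau> ^ k \<le> 1) \<Longrightarrow>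
      (\<And>k s. \<bar>s\<bar> \<le> \<tau> / (A * \<rho>) \<Longrightarrow> (g k has_vector_derivative g (Suc k) s) (at s)) \<Longrightarrow>
      (\<And>k s. \<bar>s\<bar> \<le> \<tau> / (A * \<rho>) \<Longrightarrow> (h k has_vector_derivative h (Suc k) s) (at s)) \<Longrightarrow>
      (\<And>k s. \<bar>s\<bar> \<le> \<tau> / (A * \<rho>) \<Longrightarrow> cmod (g k s) \<le> C0 * \<rho> ^ k * fact k * m k) \<Longrightarrow>
      (\<And>k s. \<bar>s\<bar> \<le> \<tau> / (A * \<rho>) \<Longrightarrow> cmod (h k s) \<le> C0 * \<rho> ^ k * fact k * m k) \<Longrightarrow>
      g 0 = (\<lambda>s. \<phi> s ^ j) \<Longrightarrow> h 0 = (\<lambda>s. \<phi> s ^ (j+1)) \<Longrightarrow>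
      \<exists>F. F holomorphic_on ball 0 (\<tau> / (A * \<rho>) / 2) \<and> (\<forall>z\<in>ball 0 (\<tau> / (A * \<rho>) / 2). cmod (F z) \<le> C1) \<and>
        (\<forall>s. \<bar>s\<bar> < \<tau> / (A * \<rho>) / 2 \<longrightarrow> cmod (\<phi> s - F (of_real s)) \<le> C1 * root Kj (m p * \<tau> ^ p))"
    by blast
  define e0 where "e0 = min (r / 2) 1"
  have "class_approx f K l (2 * C * A * \<rho>) C1 e0"
    unfolding class_approx_def
  proof (intro conjI ballI allI impI)
    fix x v :: 'a and e :: real assume x: "x \<in> K" and v: "norm v \<le> 1" and e: "0 < e \<and> e \<le> e0"
    define \<tau> where "\<tau> = 2 * e * A * \<rho>"
    have \<tau>: "\<tau> > 0" "\<tau> / (A * \<rho>) = 2 * e" using e A \<rho> by (auto simp: \<tau>_def)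
    have er: "2 * e \<le> r" using e by (simp add: e0_def)
    define p where "p = Gamma_lower m \<tau>"
    have mp: "m k * \<tau> ^ k \<le> 1" if "k \<le> p" for k
      using Gamma_lower_decreasing[OF m(1,3) \<tau>(1), of 0 k] that m(2) by (simp add: p_def)
    have inK: "x + s *\<^sub>R v \<in> K'" if "\<bar>s\<bar> \<le> 2 * e" for s
    proof -
      have "\<bar>s\<bar> * norm v \<le> r * 1" by (rule mult_mono) (use that er r v in auto)
      then show ?thesis using r(2)[OF x] by (force simp: dist_norm)
    qed
    have rep: "\<forall>w\<in>set (replicate k v). norm w \<le> 1" for k using v by simp
    have "\<exists>F. F holomorphic_on ball 0 (\<tau> / (A * \<rho>) / 2) \<and> (\<forall>z\<in>ball 0 (\<tau> / (A * \<rho>) / 2). cmod (F z) \<le> C1) \<and>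
        (\<forall>s. \<bar>s\<bar> < \<tau> / (A * \<rho>) / 2 \<longrightarrow> cmod (f (x + s *\<^sub>R v) - F (of_real s)) \<le> C1 * root Kj (m p * \<tau> ^ p))"
    proof (rule approx[where g = "\<lambda>k s. Frechet_deriv (\<lambda>x. f x ^ j) (replicate k v) (x + s *\<^sub>R v)"
          and h = "\<lambda>k s. Frechet_deriv (\<lambda>x. f x ^ (j+1)) (replicate k v) (x + s *\<^sub>R v)"])
      fix k s assume "\<bar>s\<bar> \<le> \<tau> / (A * \<rho>)"
      then have y: "x + s *\<^sub>R v \<in> K'" unfolding \<tau>(2) by (rule inK)
      then have yU: "x + s *\<^sub>R v \<in> U" using U by blast
      show "((\<lambda>s. Frechet_deriv (\<lambda>x. f x ^ j) (replicate k v) (x + s *\<^sub>R v)) has_vector_derivative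
          Frechet_deriv (\<lambda>x. f x ^ j) (replicate (Suc k) v) (x + s *\<^sub>R v)) (at s)"
        by (rule Frechet_deriv_line[OF smooth(1) U(1) yU])
      show "((\<lambda>s. Frechet_deriv (\<lambda>x. f x ^ (j+1)) (replicate k v) (x + s *\<^sub>R v)) has_vector_derivative
          Frechet_deriv (\<lambda>x. f x ^ (j+1)) (replicate (Suc k) v) (x + s *\<^sub>R v)) (at s)"
        by (rule Frechet_deriv_line[OF smooth(2) U(1) yU])
      show "cmod (Frechet_deriv (\<lambda>x. f x ^ j) (replicate k v) (x + s *\<^sub>R v)) \<le> C0 * \<rho> ^ k * fact k * m k"
        using gb[OF y rep[of k]] by (simp only: length_replicate mult.assoc)
      show "cmod (Frechet_deriv (\<lambda>x. f x ^ (j+1)) (replicate k v) (x + s *\<^sub>R v)) \<le> C0 * \<rho> ^ k * fact k * m k"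
        using hb[OF y rep[of k]] by (simp only: length_replicate mult.assoc)
    qed (use \<tau> \<rho> m mp in auto)
    then obtain F where F: "F holomorphic_on ball 0 e" "\<And>z. z \<in> ball 0 e \<Longrightarrow> cmod (F z) \<le> C1"
      "\<And>s. \<bar>s\<bar> < e \<Longrightarrow> cmod (f (x + s *\<^sub>R v) - F (of_real s)) \<le> C1 * root Kj (m p * \<tau> ^ p)"
      unfolding \<tau>(2) by auto
    have rt: "root Kj (m p * \<tau> ^ p) \<le> (l k * (2 * C * A * \<rho> * e) ^ k) ^ 4" for k
    proof -
      define X where "X = l k * (2 * C * A * \<rho> * e) ^ k"
      have X: "X > 0" using l[of k] C A \<rho> e by (simp add: X_def)
      have eq: "2 * C * A * \<rho> * e = C * \<tau>" by (simp add: \<tau>_def)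
      have 1: "m p * \<tau> ^ p \<le> X ^ 2 ^ i" unfolding X_def eq p_def by (rule h[OF \<tau>(1)])
      have "m p * \<tau> ^ p \<le> X ^ (4 * Kj)"
      \<comment> \<open>Lowering the exponent from \<open>2^i\<close> to \<open>4 Kj\<close> is
        legitimate only for \<open>X < 1\<close>. Otherwise the claim follows from
        \<open>m p * \<tau>^p \<le> 1\<close>.\<close>
      proof (cases "X \<ge> 1")
        case True
        then have "1 \<le> X ^ (4 * Kj)" by (rule one_le_power)
        then show ?thesis using mp[of p] by linarith
      next
        case False
        then have "X ^ 2 ^ i \<le> X ^ (4 * Kj)" using i X by (intro power_decreasing) (auto simp: Kj_def)
        then show ?thesis using 1 by linarith
      qed
      also have "X ^ (4 * Kj) = (X ^ 4) ^ Kj" by (rule power_mult)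
      finally have "root Kj (m p * \<tau> ^ p) \<le> root Kj ((X ^ 4) ^ Kj)" using Kj by simp
      also have "\<dots> = X ^ 4" using Kj X by (intro real_root_power_cancel) auto
      finally show ?thesis by (simp add: X_def)
    qed
    have "cmod (f (x + s *\<^sub>R v) - F (of_real s)) \<le> C1 * (l k * (2 * C * A * \<rho> * e) ^ k) ^ 4" if "\<bar>s\<bar> < e" for s k
      using F(3)[OF that] mult_left_mono[OF rt[of k], of C1] C1 by linarith
    with F(1,2) show "\<exists>F. F holomorphic_on ball 0 e \<and> (\<forall>z\<in>ball 0 e. cmod (F z) \<le> C1) \<and>
       (\<forall>s. \<bar>s\<bar> < e \<longrightarrow> (\<forall>k. cmod (f (x + s *\<^sub>R v) - F (of_real s)) \<le> C1 * (l k * (2 * C * A * \<rho> * e) ^ k) ^ 4))"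
      by blast
  qed (use C1 r in \<open>auto simp: e0_def\<close>)
  then show ?thesis by (auto simp: A_def)
qed

text \<open>For the order \<open>N\<close> it suffices to take \<open>k = N\<close>: the weight
  \<open>l N\<close> only enters the constant, and \<open>e^(4 N) \<le> e^N\<close>.\<close>

lemma class_approx_imp_holo_approx:
  fixes f :: "'a::euclidean_space \<Rightarrow> complex"
  assumes "\<And>K. compact K \<Longrightarrow> K \<subseteq> U \<Longrightarrow> \<exists>l B C e0. class_approx f K l B C e0"
  shows "holo_approx U f"
  unfolding holo_approx_def
proof (intro allI impI)
  fix K :: "'a set" and N :: nat assume K: "compact K" "K \<subseteq> U"
  obtain l B C e0 where ca: "class_approx f K l B C e0" using assms[OF K] by blast
  have C: "1 \<le> C" "0 < e0" "e0 \<le> 1" using ca by (auto simp: class_approx_def)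
  define C' where "C' = C * (1 + (l N * B ^ N) ^ 4)"
  have nn: "0 \<le> (l N * B ^ N) ^ 4" by simp
  have C': "C \<le> C'" "C * (l N * B ^ N) ^ 4 \<le> C'"
    using C mult_nonneg_nonneg[of C "(l N * B ^ N) ^ 4"] by (simp_all add: C'_def distrib_left)
  show "\<exists>C e0. 1 \<le> C \<and> 0 < e0 \<and> e0 \<le> 1/2 \<and>
     (\<forall>x\<in>K. \<forall>v. norm v \<le> 1 \<longrightarrow> (\<forall>e. 0 < e \<and> e \<le> e0 \<longrightarrow> (\<exists>F. line_approx (\<lambda>s. f (x + s *\<^sub>R v)) N C e F)))"
  proof (rule exI[of _ C'], rule exI[of _ "e0 / 2"], intro conjI ballI allI impI)
    fix x v :: 'a and e :: real assume x: "x \<in> K" "norm v \<le> 1" and e: "0 < e \<and> e \<le> e0 / 2"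
    then have e': "0 < e" "e \<le> e0" using C by auto
    obtain F where F: "F holomorphic_on ball 0 e" "\<forall>z\<in>ball 0 e. cmod (F z) \<le> C"
      "\<forall>s. \<bar>s\<bar> < e \<longrightarrow> (\<forall>k. cmod (f (x + s *\<^sub>R v) - F (of_real s)) \<le> C * (l k * (B * e) ^ k) ^ 4)"
      using class_approxD[OF ca x e'] by blast
    have "C * (l N * (B * e) ^ N) ^ 4 \<le> C' * e ^ N"
    proof -
      have "(l N * (B * e) ^ N) ^ 4 = (l N * B ^ N) ^ 4 * (e ^ N) ^ 4" by (simp add: power_mult_distrib)
      also have "\<dots> \<le> (l N * B ^ N) ^ 4 * e ^ N"
      proof (rule mult_left_mono[OF _ nn])
        have "e ^ N \<le> 1" using e' C by (intro power_le_one) auto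
        then show "(e ^ N) ^ 4 \<le> e ^ N" using power_decreasing[of 1 4 "e ^ N"] e' by simp
      qed
      finally have "C * (l N * (B * e) ^ N) ^ 4 \<le> C * ((l N * B ^ N) ^ 4 * e ^ N)" using C by (intro mult_left_mono) auto
      also have "\<dots> = (C * (l N * B ^ N) ^ 4) * e ^ N" by simp
      also have "\<dots> \<le> C' * e ^ N" using C'(2) e' by (intro mult_right_mono) auto
      finally show ?thesis .
    qed
    then have "line_approx (\<lambda>s. f (x + s *\<^sub>R v)) N C' e F"
      unfolding line_approx_def using F C' by (meson order_trans)
    then show "\<exists>F. line_approx (\<lambda>s. f (x + s *\<^sub>R v)) N C' e F" by blast
  qed (use C C' in auto)
qed

lemma higher_deriv_poly:
  fixes p :: "'a::real_normed_field poly"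
  shows "(deriv ^^ n) (poly p) = poly ((pderiv ^^ n) p)"
proof (induction n)
  case (Suc n)
  have "deriv (poly q) = poly (pderiv q)" for q :: "'a poly"
    by (rule ext) (rule DERIV_imp_deriv[OF poly_DERIV])
  with Suc show ?case by simp
qed simp

text \<open>On the reals the difference of two consecutive approximants is bounded by the fourth
  power of the smaller of \<open>X k\<close> and \<open>X 1\<close>, hence by the square of their
  product. The two-constants estimate leaves \<open>X k * X 1\<close> on a smaller disc. In the
  \<open>k\<close>-th derivative the powers of \<open>e\<close> from Cauchy's estimate cancel those
  in \<open>X k\<close>, and the factor \<open>e\<close> in \<open>X 1\<close> remains.\<close>

lemma class_approx_step:
  assumes ca: "class_approx f K l B C e0" and l: "\<And>k. l k > 0" and B: "B > 0"
    and e: "0 < e" "e \<le> e0"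
    and F: "F holomorphic_on ball 0 e" "\<forall>z\<in>ball 0 e. cmod (F z) \<le> C"
      "\<forall>s. \<bar>s\<bar> < e \<longrightarrow> (\<forall>k. cmod (f (x + s *\<^sub>R v) - F (of_real s)) \<le> C * (l k * (B * e) ^ k) ^ 4)"
    and F': "F' holomorphic_on ball 0 (e/2)" "\<forall>z\<in>ball 0 (e/2). cmod (F' z) \<le> C"
      "\<forall>s. \<bar>s\<bar> < e/2 \<longrightarrow> (\<forall>k. cmod (f (x + s *\<^sub>R v) - F' (of_real s)) \<le> C * (l k * (B * (e/2)) ^ k) ^ 4)"
  shows "cmod ((deriv ^^ k) F 0 - (deriv ^^ k) F' 0) \<le> fact k * (10 * C * (l k * (288 * B) ^ k) * (l 1 * B * e))"
proof -
  have C: "C \<ge> 1" using ca by (simp add: class_approx_def)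
  define D where "D z = F z - F' z" for z
  define X where "X k = l k * (B * e) ^ k" for k
  have X: "X k > 0" for k using l[of k] B e by (simp add: X_def)
  \<comment> \<open>The truncation at 1 keeps the bound on the reals below the bound on the disc, as
    the two-constants estimate requires.\<close>
  define Y where "Y = min 1 ((X k * X 1)\<^sup>2)"
  have Y: "0 < Y" "Y \<le> 1" "Y \<le> (X k * X 1)\<^sup>2"
    using X[of k] X[of 1] by (auto simp: Y_def)
  have sub: "z \<in> ball 0 e" if "z \<in> ball 0 (e/2)" for z :: complex using that e by simp
  have hF: "F holomorphic_on ball 0 (e/2)" by (rule holomorphic_on_subset[OF F(1)]) (use sub in blast)
  have hol: "D holomorphic_on ball 0 (e/2)" unfolding D_def by (intro holomorphic_intros hF F')
  have D: "cmod (D z) \<le> 2 * C" if "z \<in> ball 0 (e/2)" for z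
    using F(2) F'(2) sub[OF that] that norm_triangle_ineq4[of "F z" "F' z"] unfolding D_def by fastforce
  have re: "cmod (D (of_real s)) \<le> 2 * C * Y" if s: "\<bar>s\<bar> < e/2" for s
  proof -
    have b: "cmod (D (of_real s)) \<le> 2 * C * X n ^ 4" for n
    proof -
      have 1: "cmod (f (x + s *\<^sub>R v) - F (of_real s)) \<le> C * X n ^ 4" using F(3) s e unfolding X_def by auto
      have "cmod (f (x + s *\<^sub>R v) - F' (of_real s)) \<le> C * (l n * (B * (e/2)) ^ n) ^ 4" using F'(3) s by blast
      also have "\<dots> \<le> C * X n ^ 4" unfolding X_def
        using C B e l[of n] by (intro mult_left_mono power_mono mult_mono) (auto simp: less_imp_le)
      finally have "cmod ((f (x + s *\<^sub>R v) - F' (of_real s)) - (f (x + s *\<^sub>R v) - F (of_real s))) \<le> 2 * (C * X n ^ 4)"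
        using 1 norm_triangle_ineq4[of "f (x + s *\<^sub>R v) - F' (of_real s)" "f (x + s *\<^sub>R v) - F (of_real s)"] by linarith
      then show ?thesis by (simp add: D_def)
    qed
    have "min (X k) (X 1) ^ 4 \<le> (X k * X 1)\<^sup>2"
    proof -
      have "min (X k) (X 1) * min (X k) (X 1) \<le> X k * X 1"
        using X[of k] X[of 1] by (intro mult_mono) (auto simp: less_imp_le)
      then have "(min (X k) (X 1) * min (X k) (X 1))\<^sup>2 \<le> (X k * X 1)\<^sup>2" using X[of k] X[of 1] by (intro power_mono) auto
      moreover have "min (X k) (X 1) ^ 4 = (min (X k) (X 1) * min (X k) (X 1))\<^sup>2"
        by (simp add: power2_eq_square power4_eq_xxxx)
      ultimately show ?thesis by simp
    qed
    then have le: "2 * C * min (X k) (X 1) ^ 4 \<le> 2 * C * (X k * X 1)\<^sup>2" using C by (intro mult_left_mono) auto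
    have "cmod (D (of_real s)) \<le> 2 * C * min (X k) (X 1) ^ 4" using b[of k] b[of 1] by (simp add: min_def)
    then have 1: "cmod (D (of_real s)) \<le> 2 * C * (X k * X 1)\<^sup>2" using le by (rule order_trans)
    have 2: "cmod (D (of_real s)) \<le> 2 * C * 1" unfolding mult_1_right by (rule D) (use s in simp)
    show ?thesis unfolding Y_def min_def using 1 2 by (simp only: split: if_split) simp
  qed
  have small: "cmod (D z) \<le> 10 * C * (X k * X 1)" if z: "z \<in> ball 0 (e/2/72)" for z
  proof -
    have "cmod (D z) \<le> 5 * sqrt ((2 * C) * (2 * C * Y))"
      by (rule small_on_reals_imp_small[OF hol _ D re]) (use e C Y z in auto)
    also have "\<dots> \<le> 5 * sqrt ((2 * C * (X k * X 1))\<^sup>2)"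
    proof (intro mult_left_mono real_sqrt_le_mono)
      have "(2 * C) * (2 * C * Y) = (2 * C)\<^sup>2 * Y" by (simp add: power2_eq_square)
      also have "\<dots> \<le> (2 * C)\<^sup>2 * (X k * X 1)\<^sup>2" using Y by (intro mult_left_mono) auto
      finally show "(2 * C) * (2 * C * Y) \<le> (2 * C * (X k * X 1))\<^sup>2" by (simp only: power_mult_distrib[of "2 * C"])
    qed simp
    also have "\<dots> = 10 * C * (X k * X 1)" using C X[of k] X[of 1] by simp
    finally show ?thesis .
  qed
  have "cmod ((deriv ^^ k) D 0) \<le> fact k * (10 * C * (X k * X 1)) * (2 / (e/2/72)) ^ k"
    by (rule holomorphic_deriv_bound) (use small e hol in \<open>auto intro: holomorphic_on_subset\<close>)
  also have "(deriv ^^ k) D 0 = (deriv ^^ k) F 0 - (deriv ^^ k) F' 0"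
    unfolding D_def by (rule higher_deriv_diff[OF hF F'(1)]) (use e in auto)
  also have "fact k * (10 * C * (X k * X 1)) * (2 / (e/2/72)) ^ k = fact k * (10 * C * (l k * (288 * B) ^ k) * (l 1 * B * e))"
  proof -
    have "(B * e) ^ k * (2 / (e/2/72)) ^ k = (288 * B) ^ k"
      unfolding power_mult_distrib[symmetric] using e by simp
    moreover have "fact k * (10 * C * (X k * X 1)) * (2 / (e/2/72)) ^ k = fact k * (10 * C * (l k * ((B * e) ^ k * (2 / (e/2/72)) ^ k)) * (l 1 * B * e))"
      unfolding X_def by (simp only: power_one_right mult_ac)
    ultimately show ?thesis by simp
  qed
  finally show ?thesis .
qed

text \<open>Now that \<open>f\<close> is known to be smooth, its Taylor polynomial \<open>P\<close>
  on the line can be compared with the approximants. With \<open>n = 2 (k+1)\<close> the difference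
  is of order \<open>e^(k+1)\<close> on a small disc, and the \<open>k\<close>-th derivative leaves
  one factor \<open>e\<close>, which tends to 0.\<close>

lemma class_approx_limit:
  fixes f :: "'a::euclidean_space \<Rightarrow> complex"
  assumes f: "smooth_fun_on U f" "open U" and x: "x \<in> U" and v: "norm v \<le> 1" and B: "B > 0" and C: "C \<ge> 1"
    and ei: "\<And>i. 0 < e i" "\<And>i. e i \<le> 1" "e \<longlonglongrightarrow> 0"
    and F: "\<And>i. F i holomorphic_on ball 0 (e i)" "\<And>i z. z \<in> ball 0 (e i) \<Longrightarrow> cmod (F i z) \<le> C"
      "\<And>i s k. \<bar>s\<bar> < e i \<Longrightarrow> cmod (f (x + s *\<^sub>R v) - F i (of_real s)) \<le> C * (l k * (B * e i) ^ k) ^ 4"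
  shows "(\<lambda>i. (deriv ^^ k) (F i) 0) \<longlonglongrightarrow> Frechet_deriv f (replicate k v) x"
proof -
  define n where "n = 2 * (k + 1)"
  define g where "g k s = Frechet_deriv f (replicate k v) (x + s *\<^sub>R v)" for k s
  obtain r where r: "r > 0" "cball x r \<subseteq> U" using f(2) x by (meson open_contains_cball)
  have inU: "x + s *\<^sub>R v \<in> U" if "\<bar>s\<bar> \<le> r" for s
  proof -
    have "\<bar>s\<bar> * norm v \<le> r * 1" by (rule mult_mono) (use that r v in auto)
    then show ?thesis using r by (force simp: dist_norm)
  qed
  have g': "(g k has_vector_derivative g (Suc k) s) (at s)" if "\<bar>s\<bar> \<le> r" for k s
    unfolding g_def[abs_def] by (rule Frechet_deriv_line[OF f inU[OF that]])
  have "continuous_on {-r..r} (g n)"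
    by (rule continuous_at_imp_continuous_on) (use g' has_vector_derivative_continuous in \<open>force simp: abs_le_iff\<close>)
  then have "bounded (g n ` {-r..r})" by (intro compact_imp_bounded compact_continuous_image) auto
  then obtain A0 where A0: "\<And>s. s \<in> {-r..r} \<Longrightarrow> cmod (g n s) \<le> A0" unfolding bounded_iff by blast
  have A0': "cmod (g n s) \<le> A0" if "\<bar>s\<bar> \<le> r" for s using A0[of s] that by (auto simp: abs_le_iff)
  have A00: "A0 \<ge> 0" using order_trans[OF norm_ge_zero A0'[of 0]] r by simp
  define P where "P = (\<Sum>i<n. monom (g i 0 / fact i) i)"
  have polyP: "poly P z = (\<Sum>i<n. g i 0 / fact i * z ^ i)" for z by (simp add: P_def poly_sum poly_monom)
  define c1 where "c1 = (\<Sum>i<n. cmod (g i 0))"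
  have c1: "c1 \<ge> 0" by (simp add: c1_def sum_nonneg)
  have Pb: "cmod (poly P z) \<le> c1" if "cmod z \<le> 1" for z
    unfolding polyP c1_def
  proof (rule sum_norm_le)
    fix i
    have "cmod (g i 0 / fact i * z ^ i) \<le> cmod (g i 0) / 1 * 1"
      unfolding norm_mult norm_divide norm_power
      by (intro mult_mono divide_left_mono power_le_one that) (auto simp: fact_ge_1 norm_fact)
    then show "cmod (g i 0 / fact i * z ^ i) \<le> cmod (g i 0)" by simp
  qed
  have dP: "(deriv ^^ k) (poly P) 0 = Frechet_deriv f (replicate k v) x"
  proof -
    have "(deriv ^^ k) (poly P) 0 = fact k * coeff P k"
      by (simp add: higher_deriv_poly poly_0_coeff_0 coeff_higher_pderiv pochhammer_fact)
    also have "coeff P k = g k 0 / fact k"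
      by (simp add: P_def coeff_sum coeff_monom n_def if_distrib cong: if_cong)
    finally show ?thesis by (simp add: g_def)
  qed
  define C5 where "C5 = C + c1 + A0 + C * (l n * B ^ n) ^ 4"
  have nn: "0 \<le> C * (l n * B ^ n) ^ 4" using C by simp
  have C5: "C5 > 0" "C + c1 \<le> C5" "A0 + C * (l n * B ^ n) ^ 4 \<le> C5" using C c1 A00 nn unfolding C5_def by linarith+
  have est: "cmod ((deriv ^^ k) (F i) 0 - Frechet_deriv f (replicate k v) x) \<le> fact k * (5 * C5) * 144 ^ k * e i"
    if er: "e i \<le> r" for i
  proof -
    define D where "D z = F i z - poly P z" for z
    have hP: "poly P holomorphic_on ball 0 (e i)" by (rule poly_holomorphic_on)
    have hol: "D holomorphic_on ball 0 (e i)" unfolding D_def by (intro holomorphic_on_diff F hP)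
    have D: "cmod (D z) \<le> C5" if "z \<in> ball 0 (e i)" for z
    proof -
      have "cmod z \<le> 1" using that ei(2)[of i] by auto
      then show ?thesis using F(2)[OF that] Pb[of z] C5(2) norm_triangle_ineq4[of "F i z" "poly P z"] unfolding D_def by linarith
    qed
    have re: "cmod (D (of_real s)) \<le> C5 * e i ^ n" if s: "\<bar>s\<bar> < e i" for s
    proof -
      have sr: "\<bar>s\<bar> \<le> r" using s er by linarith
      have "cmod (g 0 s - (\<Sum>i<n. (s ^ i / fact i) *\<^sub>R g i 0)) \<le> A0 * \<bar>s\<bar> ^ n / fact n"
        by (rule Taylor_remainder[of r g n A0 s, OF g' A0' sr])
      also have "\<dots> \<le> A0 * \<bar>s\<bar> ^ n / 1" using A00 by (intro divide_left_mono) (auto simp: fact_ge_1)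
      also have "\<dots> \<le> A0 * e i ^ n / 1" using A00 s by (intro divide_right_mono mult_left_mono power_mono) auto
      finally have 1: "cmod (f (x + s *\<^sub>R v) - poly P (of_real s)) \<le> A0 * e i ^ n"
        by (simp add: polyP g_def scaleR_conv_of_real mult_ac)
      have "cmod (f (x + s *\<^sub>R v) - F i (of_real s)) \<le> C * (l n * (B * e i) ^ n) ^ 4" by (rule F(3)[OF s])
      also have "\<dots> = C * (l n * B ^ n) ^ 4 * (e i ^ n) ^ 4" by (simp add: power_mult_distrib)
      also have "\<dots> \<le> C * (l n * B ^ n) ^ 4 * e i ^ n"
      proof (rule mult_left_mono[OF _ nn])
        have "e i ^ n \<le> 1" using ei(1,2)[of i] by (intro power_le_one) auto
        then show "(e i ^ n) ^ 4 \<le> e i ^ n" using power_decreasing[of 1 4 "e i ^ n"] ei(1)[of i] by simp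
      qed
      finally have 2: "cmod (f (x + s *\<^sub>R v) - F i (of_real s)) \<le> C * (l n * B ^ n) ^ 4 * e i ^ n" .
      have "cmod (D (of_real s)) \<le> cmod (f (x + s *\<^sub>R v) - poly P (of_real s)) + cmod (f (x + s *\<^sub>R v) - F i (of_real s))"
        using norm_triangle_ineq4[of "f (x + s *\<^sub>R v) - poly P (of_real s)" "f (x + s *\<^sub>R v) - F i (of_real s)"] by (simp add: D_def)
      also have "\<dots> \<le> (A0 + C * (l n * B ^ n) ^ 4) * e i ^ n" using 1 2 by (simp add: distrib_right)
      also have "\<dots> \<le> C5 * e i ^ n" using C5 ei(1)[of i] by (intro mult_right_mono) auto
      finally show ?thesis .
    qed
    have en: "e i ^ n = (e i ^ (k+1))\<^sup>2" unfolding n_def power_mult[symmetric] by (simp only: mult.commute)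
    have small: "cmod (D z) \<le> 5 * C5 * e i ^ (k+1)" if z: "z \<in> ball 0 (e i / 72)" for z
    proof -
      have "e i ^ n \<le> 1" using ei(1,2)[of i] by (intro power_le_one) auto
      then have "C5 * e i ^ n \<le> C5" using C5 by (simp add: mult_left_le)
      then have "cmod (D z) \<le> 5 * sqrt (C5 * (C5 * e i ^ n))"
        using C5 ei(1)[of i] z by (intro small_on_reals_imp_small[OF hol ei(1) D re]) auto
      also have "C5 * (C5 * e i ^ n) = (C5 * e i ^ (k+1))\<^sup>2" unfolding en by (simp only: power_mult_distrib power2_eq_square mult_ac)
      also have "sqrt \<dots> = C5 * e i ^ (k+1)" using C5 ei(1)[of i] by simp
      finally show ?thesis by simp
    qed
    have "cmod ((deriv ^^ k) D 0) \<le> fact k * (5 * C5 * e i ^ (k+1)) * (2 / (e i / 72)) ^ k"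
      by (rule holomorphic_deriv_bound) (use small ei(1)[of i] hol in \<open>auto intro: holomorphic_on_subset\<close>)
    also have "(deriv ^^ k) D 0 = (deriv ^^ k) (F i) 0 - Frechet_deriv f (replicate k v) x"
      unfolding D_def dP[symmetric] by (rule higher_deriv_diff[OF F(1) hP]) (use ei(1)[of i] in auto)
    also have "fact k * (5 * C5 * e i ^ (k+1)) * (2 / (e i / 72)) ^ k = fact k * (5 * C5) * (e i ^ k * (144 / e i) ^ k) * e i"
      by simp
    also have "e i ^ k * (144 / e i) ^ k = 144 ^ k"
      unfolding power_mult_distrib[symmetric] using ei(1)[of i] by simp
    finally show ?thesis .
  qed
  have "(\<lambda>i. fact k * (5 * C5) * 144 ^ k * e i) \<longlonglongrightarrow> fact k * (5 * C5) * 144 ^ k * 0"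
    by (intro tendsto_intros ei)
  then have z: "(\<lambda>i. fact k * (5 * C5) * 144 ^ k * e i) \<longlonglongrightarrow> 0" by simp
  have ev: "\<forall>\<^sub>F i in sequentially. e i \<le> r"
    using order_tendstoD(2)[OF ei(3) r(1)] by eventually_elim simp
  have "\<forall>\<^sub>F i in sequentially. cmod ((deriv ^^ k) (F i) 0 - Frechet_deriv f (replicate k v) x) \<le> fact k * (5 * C5) * 144 ^ k * e i"
    by (rule eventually_mono[OF ev est])
  then have "(\<lambda>i. (deriv ^^ k) (F i) 0 - Frechet_deriv f (replicate k v) x) \<longlonglongrightarrow> 0"
    by (rule Lim_null_comparison[OF _ z])
  then show ?thesis by (simp add: LIM_zero_iff)
qed

text \<open>A telescoping sum over dyadic scales. Cauchy's estimate at the coarsest scale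
  \<open>e0\<close> gives the analytic term with \<open>(2 / e0)^k\<close>, and the increments form
  a geometric series with the right weights.\<close>

lemma class_approx_derivative_bound:
  fixes f :: "'a::euclidean_space \<Rightarrow> complex"
  assumes ca: "class_approx f K l B C e0" and l: "\<And>k. l k > 0" and B: "B > 0"
    and f: "smooth_fun_on U f" "open U" "K \<subseteq> U" and x: "x \<in> K" and v: "norm v \<le> 1"
  shows "cmod (Frechet_deriv f (replicate k v) x)
    \<le> (C + 20 * C * (l 1 * B * e0)) * (fact k * (2 / e0) ^ k + fact k * (l k * (288 * B) ^ k))"
proof -
  have C: "1 \<le> C" "0 < e0" "e0 \<le> 1" using ca by (auto simp: class_approx_def)
  define e where "e i = e0 / 2 ^ i" for i :: nat
  have ei: "0 < e i" "e i \<le> e0" "e i \<le> 1" "e (Suc i) = e i / 2" for i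
  proof -
    show "0 < e i" "e (Suc i) = e i / 2" using C by (auto simp: e_def)
    show "e i \<le> e0" using C by (simp add: e_def divide_le_eq)
    then show "e i \<le> 1" using C by linarith
  qed
  have "\<forall>i. \<exists>F. F holomorphic_on ball 0 (e i) \<and> (\<forall>z\<in>ball 0 (e i). cmod (F z) \<le> C) \<and>
       (\<forall>s. \<bar>s\<bar> < e i \<longrightarrow> (\<forall>k. cmod (f (x + s *\<^sub>R v) - F (of_real s)) \<le> C * (l k * (B * e i) ^ k) ^ 4))"
    using class_approxD[OF ca x v ei(1,2)] by blast
  then obtain F where F: "\<And>i. F i holomorphic_on ball 0 (e i) \<and> (\<forall>z\<in>ball 0 (e i). cmod (F i z) \<le> C) \<and>
       (\<forall>s. \<bar>s\<bar> < e i \<longrightarrow> (\<forall>k. cmod (f (x + s *\<^sub>R v) - F i (of_real s)) \<le> C * (l k * (B * e i) ^ k) ^ 4))"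
    by metis
  define d where "d i = (deriv ^^ k) (F i) 0" for i
  define Z where "Z = fact k * (10 * C * (l k * (288 * B) ^ k) * (l 1 * B * e0))"
  have Z: "Z \<ge> 0" using C B l[of k] l[of 1] by (simp add: Z_def less_imp_le)
  have step: "cmod (d i - d (Suc i)) \<le> Z * (1/2) ^ i" for i
  proof -
    have "cmod (d i - d (Suc i)) \<le> fact k * (10 * C * (l k * (288 * B) ^ k) * (l 1 * B * e i))"
      unfolding d_def
      by (rule class_approx_step[OF ca l B ei(1,2), where x = x and v = v])
        (use F[of i] F[of "Suc i", unfolded ei(4)] in blast)+
    also have "\<dots> = Z * (1/2) ^ i" by (simp add: Z_def e_def power_divide)
    finally show ?thesis .
  qed
  have d0: "cmod (d 0) \<le> fact k * C * (2 / e0) ^ k"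
    unfolding d_def by (rule holomorphic_deriv_bound) (use F[of 0] C in \<open>auto simp: e_def\<close>)
  have dn: "cmod (d n) \<le> fact k * C * (2 / e0) ^ k + 2 * Z" for n
  proof -
    have "cmod (d n - d 0) \<le> (\<Sum>i<n. Z * (1/2) ^ i)"
    proof (induction n)
      case (Suc n)
      have "cmod (d (Suc n) - d 0) \<le> cmod (d n - d 0) + cmod (d n - d (Suc n))"
        using norm_triangle_ineq4[of "d n - d 0" "d n - d (Suc n)"] by simp
      then show ?case using Suc step[of n] by simp
    qed simp
    also have "\<dots> = Z * (2 - 2 * (1/2) ^ n)" by (simp only: sum_distrib_left[symmetric] sum_gp_strict) (simp add: field_simps)
    also have "\<dots> \<le> Z * 2" using Z by (intro mult_left_mono) auto
    finally show ?thesis using d0 norm_triangle_sub[of "d n" "d 0"] by linarith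
  qed
  have e_lim: "e \<longlonglongrightarrow> 0" unfolding e_def[abs_def] using LIMSEQ_divide_realpow_zero[of 2 e0] by simp
  have "d \<longlonglongrightarrow> Frechet_deriv f (replicate k v) x"
    unfolding d_def[abs_def]
    by (rule class_approx_limit[OF f(1,2) _ v B C(1) ei(1,3) e_lim]) (use F f x in auto)
  then have "(\<lambda>n. cmod (d n)) \<longlonglongrightarrow> cmod (Frechet_deriv f (replicate k v) x)" by (rule tendsto_norm)
  then have "cmod (Frechet_deriv f (replicate k v) x) \<le> fact k * C * (2 / e0) ^ k + 2 * Z"
    by (rule Lim_bounded[where M = 0]) (use dn in auto)
  also have "\<dots> \<le> (C + 20 * C * (l 1 * B * e0)) * (fact k * (2 / e0) ^ k + fact k * (l k * (288 * B) ^ k))"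
  proof -
    define a where "a = fact k * (2 / e0) ^ k"
    define b where "b = fact k * (l k * (288 * B) ^ k)"
    define c where "c = 20 * C * (l 1 * B * e0)"
    have "0 \<le> a" "0 \<le> b" "0 \<le> c" using C B l[of k] l[of 1] by (auto simp: a_def b_def c_def less_imp_le)
    then have "C * a + c * b \<le> (C + c) * (a + b)" using C by (simp add: distrib_left distrib_right)
    moreover have "fact k * C * (2 / e0) ^ k = C * a" "2 * Z = c * b" by (simp_all add: a_def b_def c_def Z_def)
    ultimately show ?thesis by (simp only: a_def b_def c_def)
  qed
  finally show ?thesis .
qed

text \<open>The analytic term is absorbed by the weights, since the roots of
  \<open>reduced L\<close> tend to infinity and so beat any geometric sequence at the cost of a
  constant \<open>c\<close>. Hence \<open>1728 B\<close>, with 1728 = 6 * 288 from polarization and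
  Cauchy's estimate, does not depend on \<open>e0\<close>.\<close>

lemma class_approx_imp_seminorm_finite:
  fixes f :: "'a::euclidean_space \<Rightarrow> complex"
  assumes ca: "class_approx f K (reduced L) B C e0" and L: "\<And>k. L k > 0"
    and lim: "filterlim (\<lambda>k. root k (reduced L k)) at_top sequentially" and B: "B > 0"
    and f: "smooth_fun_on U f" "open U" "K \<subseteq> U"
  shows "M_seminorm L K (1728 * B) f < \<infinity>"
proof -
  have C: "1 \<le> C" "0 < e0" using ca by (auto simp: class_approx_def)
  define l where "l = reduced L"
  have l: "l k > 0" for k using L[of k] by (simp add: l_def reduced_def)
  have lL: "fact k * l k = L k" for k by (simp add: l_def reduced_def)
  obtain c where c: "c > 0" "\<And>k. ((2 / e0) / (288 * B)) ^ k \<le> c * l k"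
    using root_at_top_imp_power_le[of l "(2 / e0) / (288 * B)"] l lim C B unfolding l_def by auto
  have c2: "(2 / e0) ^ k \<le> c * (l k * (288 * B) ^ k)" for k
  proof -
    have "(2 / e0) ^ k / (288 * B) ^ k \<le> c * l k" using c(2)[of k] by (simp only: power_divide[of "2 / e0" "288 * B"])
    then have "(2 / e0) ^ k \<le> c * l k * (288 * B) ^ k" using B by (simp only: pos_divide_le_eq zero_less_power zero_less_mult_iff zero_less_numeral simp_thms)
    then show ?thesis by (simp only: mult.assoc)
  qed
  define C2 where "C2 = C + 20 * C * (l 1 * B * e0)"
  have C2: "C2 \<ge> 0" using C B l[of 1] by (simp add: C2_def less_imp_le)
  show ?thesis
  proof (rule M_seminorm_finiteI[where C = "C2 * (c + 1)"])
    fix x :: 'a and vs :: "'a list" assume x: "x \<in> K" and vs: "\<forall>v\<in>set vs. norm v \<le> 1"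
    define k where "k = length vs"
    have "cmod (Frechet_deriv f vs x) \<le> 6 ^ k * (C2 * (fact k * (2 / e0) ^ k + fact k * (l k * (288 * B) ^ k)))"
    proof (rule Frechet_deriv_polarization_bound[OF f(1,2) _ _ k_def[symmetric] vs])
      show "x \<in> U" using x f by blast
      show "cmod (Frechet_deriv f (replicate k v) x) \<le> C2 * (fact k * (2 / e0) ^ k + fact k * (l k * (288 * B) ^ k))"
        if "norm v \<le> 1" for v
        unfolding C2_def by (rule class_approx_derivative_bound[OF ca[folded l_def] l B f x that])
    qed
    also have "\<dots> \<le> 6 ^ k * (C2 * (fact k * (c * (l k * (288 * B) ^ k)) + fact k * (l k * (288 * B) ^ k)))"
      by (intro mult_left_mono add_right_mono c2 C2) auto
    also have "\<dots> = C2 * (c + 1) * ((6 ^ k * (288 * B) ^ k) * (fact k * l k))" by (simp add: algebra_simps)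
    also have "6 ^ k * (288 * B) ^ k = (1728 * B) ^ k" unfolding power_mult_distrib[symmetric] by simp
    finally show "cmod (Frechet_deriv f vs x) \<le> C2 * (c + 1) * ((1728 * B) ^ length vs * L (length vs))"
      by (simp only: lL k_def)
  qed (use L B C2 c in auto)
qed

section \<open>The Roumieu and the Beurling case\<close>

lemma exists_power_two_ge: "\<exists>i. n \<le> 2 ^ i" for n :: nat
  using less_exp[of n] less_imp_le by blast

lemma Roumieu_root:
  fixes f :: "'a::euclidean_space \<Rightarrow> complex"
  assumes U: "open U" and j: "j > 0" and R: "R_admissible \<MM>"
    and g: "(\<lambda>x. f x ^ j) \<in> Roumieu_class \<MM> U" and h: "(\<lambda>x. f x ^ (j+1)) \<in> Roumieu_class \<MM> U"
  shows "f \<in> Roumieu_class \<MM> U"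
proof -
  obtain i where i: "4 * (7 * j * (j+1) * (j+1)) \<le> 2 ^ i" using exists_power_two_ge by blast
  have ws: "weight_sequence M" if "M \<in> \<MM>" for M using R that by (auto simp: R_admissible_def weight_matrix_def)
  have pos: "M k > 0" "M 0 = 1" if "M \<in> \<MM>" for M k using ws[OF that] by (auto simp: weight_sequence_def)
  have lim: "filterlim (\<lambda>k. root k (reduced M k)) at_top sequentially" if "M \<in> \<MM>" for M
    using R that by (auto simp: R_admissible_def)
  have smooth: "smooth_fun_on U (\<lambda>x. f x ^ j)" "smooth_fun_on U (\<lambda>x. f x ^ (j+1))"
    using g h by (auto simp: Roumieu_class_def)
  have main: "\<exists>L\<in>\<MM>. \<exists>B>0. \<exists>C e0. class_approx f K (reduced L) B C e0" if K: "compact K" "K \<subseteq> U" for K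
  proof -
    obtain r K' where r: "0 < r" "compact K'" "K' \<subseteq> U" "\<And>x. x \<in> K \<Longrightarrow> cball x r \<subseteq> K'"
      using compact_nbhd[OF K U] by metis
    obtain M1 \<rho>1 where M1: "M1 \<in> \<MM>" "\<rho>1 > 0" "M_seminorm M1 K' \<rho>1 (\<lambda>x. f x ^ j) < \<infinity>"
      using g r unfolding Roumieu_class_def by blast
    obtain M2 \<rho>2 where M2: "M2 \<in> \<MM>" "\<rho>2 > 0" "M_seminorm M2 K' \<rho>2 (\<lambda>x. f x ^ (j+1)) < \<infinity>"
      using h r unfolding Roumieu_class_def by blast
    \<comment> \<open>The two powers may come with different sequences. The total order of the
      matrix provides a common bound.\<close>
    obtain M where M: "M \<in> \<MM>" "\<And>k. M1 k \<le> M k" "\<And>k. M2 k \<le> M k"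
    proof -
      have "(\<forall>k. M1 k \<le> M2 k) \<or> (\<forall>k. M2 k \<le> M1 k)"
        using R M1 M2 unfolding R_admissible_def weight_matrix_def by blast
      then show ?thesis using that[of M1] that[of M2] M1 M2 by auto
    qed
    define \<rho> where "\<rho> = max \<rho>1 \<rho>2"
    have \<rho>: "\<rho> > 0" "\<rho>1 \<le> \<rho>" "\<rho>2 \<le> \<rho>" using M1 by (auto simp: \<rho>_def)
    obtain c1 where c1: "c1 \<ge> 1" "\<And>x vs. x \<in> K' \<Longrightarrow> (\<forall>v\<in>set vs. norm v \<le> 1) \<Longrightarrow>
        cmod (Frechet_deriv (\<lambda>x. f x ^ j) vs x) \<le> c1 * (\<rho>1 ^ length vs * M1 (length vs))"
      using M_seminorm_finiteD[OF M1(3) pos(1)[OF M1(1)] M1(2)] by blast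
    obtain c2 where c2: "c2 \<ge> 1" "\<And>x vs. x \<in> K' \<Longrightarrow> (\<forall>v\<in>set vs. norm v \<le> 1) \<Longrightarrow>
        cmod (Frechet_deriv (\<lambda>x. f x ^ (j+1)) vs x) \<le> c2 * (\<rho>2 ^ length vs * M2 (length vs))"
      using M_seminorm_finiteD[OF M2(3) pos(1)[OF M2(1)] M2(2)] by blast
    define C0 where "C0 = max c1 c2"
    have C0: "C0 \<ge> 1" "c1 \<le> C0" "c2 \<le> C0" using c1 by (auto simp: C0_def)
    have fm: "fact k * reduced M k = M k" for k by (simp add: reduced_def)
    have le: "c * (\<sigma> ^ k * N k) \<le> C0 * (\<rho> ^ k * (fact k * reduced M k))"
      if "1 \<le> c" "c \<le> C0" "0 < \<sigma>" "\<sigma> \<le> \<rho>" "N k \<le> M k" "N k > 0" for c \<sigma> N k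
      unfolding fm using that by (intro mult_mono power_mono) auto
    obtain L C where L: "L \<in> \<MM>" "C \<ge> 1" "\<And>t k. t > 0 \<Longrightarrow>
        reduced M (Gamma_lower (reduced M) t) * t ^ Gamma_lower (reduced M) t \<le> (reduced L k * (C * t) ^ k) ^ 2 ^ i"
      using R_admissible_h_bound[OF R M(1), of i] by blast
    have "\<exists>C' e0. class_approx f K (reduced L) (2 * C * root_scale j * \<rho>) C' e0"
    proof (rule class_approx_root[OF j U r(3,1) r(4) smooth _ _ lim[OF M(1)] C0(1) \<rho>(1) _ _ _ _ i L(3)])
      show "reduced M k > 0" "reduced L k > 0" "reduced M 0 = 1" for k
        using pos(1)[OF M(1)] pos(1)[OF L(1)] pos(2)[OF M(1)] by (auto simp: reduced_def)
      fix x and vs :: "'a list" assume x: "x \<in> K'" "\<forall>v\<in>set vs. norm v \<le> 1"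
      show "cmod (Frechet_deriv (\<lambda>x. f x ^ j) vs x) \<le> C0 * (\<rho> ^ length vs * (fact (length vs) * reduced M (length vs)))"
        by (rule order_trans[OF c1(2)[OF x] le[of c1 \<rho>1 M1 "length vs"]]) (use c1 C0 M1 \<rho> M pos in auto)
      show "cmod (Frechet_deriv (\<lambda>x. f x ^ (j+1)) vs x) \<le> C0 * (\<rho> ^ length vs * (fact (length vs) * reduced M (length vs)))"
        by (rule order_trans[OF c2(2)[OF x] le[of c2 \<rho>2 M2 "length vs"]]) (use c2 C0 M2 \<rho> M pos in auto)
    qed (use L in auto)
    moreover have "2 * C * root_scale j * \<rho> > 0" using L \<rho> by (simp add: root_scale_def)
    ultimately show ?thesis using L by blast
  qed
  have sm: "smooth_fun_on U f"
    by (rule holo_approx_imp_smooth[OF U class_approx_imp_holo_approx]) (use main in blast)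
  show ?thesis unfolding Roumieu_class_def
  proof (intro CollectI conjI allI impI sm, elim conjE)
    fix K assume K: "compact K" "K \<subseteq> U"
    obtain L B C e0 where L: "L \<in> \<MM>" "B > 0" "class_approx f K (reduced L) B C e0" using main[OF K] by blast
    have "M_seminorm L K (1728 * B) f < \<infinity>"
      by (rule class_approx_imp_seminorm_finite[OF L(3) pos(1)[OF L(1)] lim[OF L(1)] L(2) sm U K(2)])
    then show "\<exists>M\<in>\<MM>. \<exists>\<rho>>0. M_seminorm M K \<rho> f < \<infinity>" using L by (intro bexI[of _ L] exI[of _ "1728 * B"]) auto
  qed
qed

text \<open>Here \<open>L\<close> and the final radius are prescribed. Admissibility yields
  \<open>M\<close>, and the bounds on the powers are then invoked with the \<open>\<rho>\<close>
  that produces exactly the wanted \<open>B\<close>; this is possible as they hold for all sequences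
  and all radii.\<close>

lemma Beurling_root:
  fixes f :: "'a::euclidean_space \<Rightarrow> complex"
  assumes U: "open U" and j: "j > 0" and R: "B_admissible \<MM>"
    and g: "(\<lambda>x. f x ^ j) \<in> Beurling_class \<MM> U" and h: "(\<lambda>x. f x ^ (j+1)) \<in> Beurling_class \<MM> U"
  shows "f \<in> Beurling_class \<MM> U"
proof -
  obtain i where i: "4 * (7 * j * (j+1) * (j+1)) \<le> 2 ^ i" using exists_power_two_ge by blast
  have ws: "weight_sequence M" if "M \<in> \<MM>" for M using R that by (auto simp: B_admissible_def weight_matrix_def)
  have pos: "M k > 0" "M 0 = 1" if "M \<in> \<MM>" for M k using ws[OF that] by (auto simp: weight_sequence_def)
  have lim: "filterlim (\<lambda>k. root k (reduced M k)) at_top sequentially" if "M \<in> \<MM>" for M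
    using R that by (auto simp: B_admissible_def)
  have smooth: "smooth_fun_on U (\<lambda>x. f x ^ j)" "smooth_fun_on U (\<lambda>x. f x ^ (j+1))"
    using g h by (auto simp: Beurling_class_def)
  have main: "\<exists>C e0. class_approx f K (reduced L) B C e0" if K: "compact K" "K \<subseteq> U" and L: "L \<in> \<MM>" and B: "B > 0" for K L B
  proof -
    obtain r K' where r: "0 < r" "compact K'" "K' \<subseteq> U" "\<And>x. x \<in> K \<Longrightarrow> cball x r \<subseteq> K'"
      using compact_nbhd[OF K U] by metis
    obtain M C where M: "M \<in> \<MM>" "C \<ge> 1" "\<And>t k. t > 0 \<Longrightarrow>
        reduced M (Gamma_lower (reduced M) t) * t ^ Gamma_lower (reduced M) t \<le> (reduced L k * (C * t) ^ k) ^ 2 ^ i"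
      using B_admissible_h_bound[OF R L, of i] by blast
    have A: "root_scale j > 0" by (simp add: root_scale_def)
    define \<rho> where "\<rho> = B / (2 * C * root_scale j)"
    have \<rho>: "\<rho> > 0" "2 * C * root_scale j * \<rho> = B" using B M A by (auto simp: \<rho>_def)
    have "M_seminorm M K' \<rho> (\<lambda>x. f x ^ j) < \<infinity>" using g r M \<rho> unfolding Beurling_class_def by blast
    from M_seminorm_finiteD[OF this pos(1)[OF M(1)] \<rho>(1)]
    obtain c1 where c1: "c1 \<ge> 1" "\<And>x vs. x \<in> K' \<Longrightarrow> (\<forall>v\<in>set vs. norm v \<le> 1) \<Longrightarrow>
        cmod (Frechet_deriv (\<lambda>x. f x ^ j) vs x) \<le> c1 * (\<rho> ^ length vs * M (length vs))" by blast
    have "M_seminorm M K' \<rho> (\<lambda>x. f x ^ (j+1)) < \<infinity>" using h r M \<rho> unfolding Beurling_class_def by blast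
    from M_seminorm_finiteD[OF this pos(1)[OF M(1)] \<rho>(1)]
    obtain c2 where c2: "c2 \<ge> 1" "\<And>x vs. x \<in> K' \<Longrightarrow> (\<forall>v\<in>set vs. norm v \<le> 1) \<Longrightarrow>
        cmod (Frechet_deriv (\<lambda>x. f x ^ (j+1)) vs x) \<le> c2 * (\<rho> ^ length vs * M (length vs))" by blast
    define C0 where "C0 = max c1 c2"
    have C0: "C0 \<ge> 1" "c1 \<le> C0" "c2 \<le> C0" using c1 by (auto simp: C0_def)
    have fm: "fact k * reduced M k = M k" for k by (simp add: reduced_def)
    have le: "c * (\<rho> ^ k * M k) \<le> C0 * (\<rho> ^ k * (fact k * reduced M k))" if "c \<le> C0" for c k
      unfolding fm using that \<rho> pos(1)[OF M(1), of k] by (intro mult_right_mono) auto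
    have "\<exists>C' e0. class_approx f K (reduced L) (2 * C * root_scale j * \<rho>) C' e0"
    proof (rule class_approx_root[OF j U r(3,1) r(4) smooth _ _ lim[OF M(1)] C0(1) \<rho>(1) _ _ _ _ i M(3)])
      show "reduced M k > 0" "reduced L k > 0" "reduced M 0 = 1" for k
        using pos(1)[OF M(1)] pos(1)[OF L] pos(2)[OF M(1)] by (auto simp: reduced_def)
      fix x and vs :: "'a list" assume x: "x \<in> K'" "\<forall>v\<in>set vs. norm v \<le> 1"
      show "cmod (Frechet_deriv (\<lambda>x. f x ^ j) vs x) \<le> C0 * (\<rho> ^ length vs * (fact (length vs) * reduced M (length vs)))"
        by (rule order_trans[OF c1(2)[OF x] le[OF C0(2)]])
      show "cmod (Frechet_deriv (\<lambda>x. f x ^ (j+1)) vs x) \<le> C0 * (\<rho> ^ length vs * (fact (length vs) * reduced M (length vs)))"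
        by (rule order_trans[OF c2(2)[OF x] le[OF C0(3)]])
    qed (use M in auto)
    then show ?thesis unfolding \<rho>(2) .
  qed
  \<comment> \<open>Smoothness of \<open>f\<close> needs approximants for just one sequence, and the
    matrix is nonempty.\<close>
  obtain L0 where L0: "L0 \<in> \<MM>" using R unfolding B_admissible_def weight_matrix_def by blast
  have sm: "smooth_fun_on U f"
    by (rule holo_approx_imp_smooth[OF U class_approx_imp_holo_approx]) (use main[OF _ _ L0 zero_less_one] in blast)
  show ?thesis unfolding Beurling_class_def
  proof (intro CollectI conjI allI ballI impI sm, elim conjE)
    fix K L and \<rho> :: real assume L: "L \<in> \<MM>" and \<rho>: "\<rho> > 0" and K: "compact K" "K \<subseteq> U"
    have B: "\<rho> / 1728 > 0" using \<rho> by simp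
    obtain C e0 where ca: "class_approx f K (reduced L) (\<rho> / 1728) C e0" using main[OF K L B] by blast
    from class_approx_imp_seminorm_finite[OF ca pos(1)[OF L] lim[OF L] B sm U K(2)]
    show "M_seminorm L K \<rho> f < \<infinity>" by simp
  qed
qed

theorem theorem1p1:
  fixes \<MM> :: "(nat \<Rightarrow> real) set"
    and U :: "(real ^ 'd) set"
    and f :: "real ^ 'd \<Rightarrow> complex"
    and j :: nat
  assumes "open U" and "j > 0"
  shows "(R_admissible \<MM> \<longrightarrow>
            (\<lambda>x. f x ^ j) \<in> Roumieu_class \<MM> U \<longrightarrow> (\<lambda>x. f x ^ (j + 1)) \<in> Roumieu_class \<MM> U \<longrightarrow>
            f \<in> Roumieu_class \<MM> U) \<and>
         (B_admissible \<MM> \<longrightarrow>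
            (\<lambda>x. f x ^ j) \<in> Beurling_class \<MM> U \<longrightarrow> (\<lambda>x. f x ^ (j + 1)) \<in> Beurling_class \<MM> U \<longrightarrow>
            f \<in> Beurling_class \<MM> U)"
  using Roumieu_root[OF assms] Beurling_root[OF assms] by blast

end
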